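(* Let $(\Omega,\mu)$ be a measure space, and let $p,q\in[1,\infty)$. Then a subset of $L^1(\mu)$ is relatively weakly compact if and only if it is almost $(p,q)$-multi-bounded.
   Context: Banach spaces are over $\mathbb{C}$; $E'$ denotes the dual of $E$ and $E_{[1]}$ its closed unit ball. For $1\le p<\infty$, $n\in\mathbb{N}$ and $\boldsymbol{x}=(x_1,\ldots,x_n)\in E^n$, the weak $p$-summing norm is $$\mu_{p,n}(\boldsymbol{x}):=\sup\Big\{\Big(\sum_{i=1}^n|\langle x_i,\lambda\rangle|^p\Big)^{1/p}:\lambda\in E'_{[1]}\Big\}.$$ For $p,q\in[1,\infty)$ define, for $\boldsymbol{x}=(x_1,\ldots,x_n)\in E^n$, $$\|\boldsymbol{x}\|_n^{(p,q)}:=\sup\Big\{\Big(\sum_{j=1}^n|\langle x_j,\lambda_j\rangle|^q\Big)^{1/q}:\ \boldsymbol{\lambda}=(\lambda_1,\ldots,\lambda_n)\in(E')^n,\ \mu_{p,n}(\boldsymbol{\lambda})\le1\Big\},$$ where $\mu_{p,n}(\boldsymbol\lambda)$ is computed in the Banach space $E'$. For $B\subseteq E$, set $$c_{p,q}(B):=\lim_{n\to\infty}\sup\Big\{\frac{\|(x_1,\ldots,x_n)\|_n^{(p,q)}}{n^{1/q}}:x_1,\ldots,x_n\in B\Big\}\in[0,\infty]$$ (the limit always exists and equals the infimum over $n\in\mathbb{N}$). The set $B$ is almost $(p,q)$-multi-bounded if $c_{p,q}(B)=0$. (Suprema are taken in $[0,\infty]$, so the supremum of the empty set is $0$.) *)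

theory Defs
  imports "HOL-Analysis.Analysis"
begin

section \<open>Complex normed spaces with an explicit carrier\<close>

text \<open>The space \<open>L\<^sup>1\<close> depends on the measure, so normed spaces cannot be types here; they are
  records, with all axioms relativised to the carrier \<open>vecs E\<close>. Completeness is not recorded, as
  none of the notions below refers to it.\<close>

record 'v cnormed =
  vecs :: "'v set"
  vzero :: 'v
  vadd :: "'v \<Rightarrow> 'v \<Rightarrow> 'v"
  vscale :: "complex \<Rightarrow> 'v \<Rightarrow> 'v"
  vnorm :: "'v \<Rightarrow> real"

locale complex_normed_space =
  fixes E :: "'v cnormed"
  assumes zero_mem: "vzero E \<in> vecs E"
    and add_mem: "x \<in> vecs E \<Longrightarrow> y \<in> vecs E \<Longrightarrow> vadd E x y \<in> vecs E"
    and scale_mem: "x \<in> vecs E \<Longrightarrow> vscale E a x \<in> vecs E"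
    and add_assoc: "x \<in> vecs E \<Longrightarrow> y \<in> vecs E \<Longrightarrow> z \<in> vecs E \<Longrightarrow>
      vadd E (vadd E x y) z = vadd E x (vadd E y z)"
    and add_commute: "x \<in> vecs E \<Longrightarrow> y \<in> vecs E \<Longrightarrow> vadd E x y = vadd E y x"
    and add_zero: "x \<in> vecs E \<Longrightarrow> vadd E (vzero E) x = x"
    and add_neg: "x \<in> vecs E \<Longrightarrow> vadd E (vscale E (- 1) x) x = vzero E"
    and scale_scale: "x \<in> vecs E \<Longrightarrow> vscale E a (vscale E b x) = vscale E (a * b) x"
    and scale_one: "x \<in> vecs E \<Longrightarrow> vscale E 1 x = x"
    and scale_add_right: "x \<in> vecs E \<Longrightarrow> y \<in> vecs E \<Longrightarrow>
      vscale E a (vadd E x y) = vadd E (vscale E a x) (vscale E a y)"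
    and scale_add_left: "x \<in> vecs E \<Longrightarrow>
      vscale E (a + b) x = vadd E (vscale E a x) (vscale E b x)"
    and norm_nonneg: "x \<in> vecs E \<Longrightarrow> 0 \<le> vnorm E x"
    and norm_eq_zero: "x \<in> vecs E \<Longrightarrow> vnorm E x = 0 \<longleftrightarrow> x = vzero E"
    and norm_add: "x \<in> vecs E \<Longrightarrow> y \<in> vecs E \<Longrightarrow> vnorm E (vadd E x y) \<le> vnorm E x + vnorm E y"
    and norm_scale: "x \<in> vecs E \<Longrightarrow> vnorm E (vscale E a x) = cmod a * vnorm E x"

definition unit_ball :: "'v cnormed \<Rightarrow> 'v set" where
  "unit_ball E = {x \<in> vecs E. vnorm E x \<le> 1}"

text \<open>Functionals are taken extensional (\<open>undefined\<close> off the carrier), so that equality in the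
  dual space is equality of functionals on \<open>E\<close>.\<close>

definition bounded_functionals :: "'v cnormed \<Rightarrow> ('v \<Rightarrow> complex) set" where
  "bounded_functionals E = {\<phi> \<in> extensional (vecs E).
     (\<forall>x\<in>vecs E. \<forall>y\<in>vecs E. \<phi> (vadd E x y) = \<phi> x + \<phi> y) \<and>
     (\<forall>a. \<forall>x\<in>vecs E. \<phi> (vscale E a x) = a * \<phi> x) \<and>
     (\<exists>C. \<forall>x\<in>vecs E. cmod (\<phi> x) \<le> C * vnorm E x)}"

definition dual :: "'v cnormed \<Rightarrow> ('v \<Rightarrow> complex) cnormed" where
  "dual E = \<lparr>
     vecs = bounded_functionals E,
     vzero = (\<lambda>x\<in>vecs E. 0),
     vadd = (\<lambda>\<phi> \<psi>. \<lambda>x\<in>vecs E. \<phi> x + \<psi> x),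
     vscale = (\<lambda>a \<phi>. \<lambda>x\<in>vecs E. a * \<phi> x),
     vnorm = (\<lambda>\<phi>. SUP x\<in>unit_ball E. cmod (\<phi> x)) \<rparr>"

context complex_normed_space
begin

lemma cmod_le_dual_norm_unit:
  assumes "\<phi> \<in> vecs (dual E)" "x \<in> unit_ball E"
  shows "cmod (\<phi> x) \<le> vnorm (dual E) \<phi>"
proof -
  from assms(1) obtain C where C: "\<And>x. x \<in> vecs E \<Longrightarrow> cmod (\<phi> x) \<le> C * vnorm E x"
    by (simp add: dual_def bounded_functionals_def) blast
  have "cmod (\<phi> y) \<le> \<bar>C\<bar>" if y: "y \<in> unit_ball E" for y
  proof -
    have "cmod (\<phi> y) \<le> \<bar>C\<bar> * vnorm E y"
      using y by (intro order_trans[OF C] mult_right_mono) (auto simp: unit_ball_def norm_nonneg)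
    also have "\<dots> \<le> \<bar>C\<bar> * 1"
      using y by (intro mult_left_mono) (auto simp: unit_ball_def)
    finally show ?thesis by simp
  qed
  then have "bdd_above ((\<lambda>x. cmod (\<phi> x)) ` unit_ball E)"
    by (rule bdd_aboveI2)
  then show ?thesis
    unfolding dual_def using assms(2) by (auto intro!: cSUP_upper)
qed

lemma zero_mem_unit_ball: "vzero E \<in> unit_ball E"
  using zero_mem norm_eq_zero[of "vzero E"] by (simp add: unit_ball_def)

lemma dual_norm_le:
  assumes "\<And>x. x \<in> unit_ball E \<Longrightarrow> cmod (\<phi> x) \<le> C"
  shows "vnorm (dual E) \<phi> \<le> C"
  using zero_mem_unit_ball assms unfolding dual_def by (auto intro!: cSUP_least)

lemma cmod_le_dual_norm:
  assumes "\<phi> \<in> vecs (dual E)" "x \<in> vecs E"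
  shows "cmod (\<phi> x) \<le> vnorm (dual E) \<phi> * vnorm E x"
proof (cases "vnorm E x = 0")
  case True
  from assms obtain C where "cmod (\<phi> x) \<le> C * vnorm E x"
    by (auto simp: dual_def bounded_functionals_def)
  with True show ?thesis by simp
next
  case False
  then have pos: "vnorm E x > 0"
    using norm_nonneg[OF assms(2)] by linarith
  define y where "y = vscale E (of_real (1 / vnorm E x)) x"
  have "y \<in> unit_ball E"
    using pos assms(2) unfolding y_def unit_ball_def
    by (simp add: scale_mem norm_scale norm_divide)
  from cmod_le_dual_norm_unit[OF assms(1) this]
  have "cmod (of_real (1 / vnorm E x) * \<phi> x) \<le> vnorm (dual E) \<phi>"
    using assms unfolding y_def by (simp add: dual_def bounded_functionals_def)
  then show ?thesis
    using pos by (simp add: norm_mult norm_divide field_simps)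
qed

lemma complex_normed_space_dual: "complex_normed_space (dual E)"
proof
  show "vzero (dual E) \<in> vecs (dual E)"
    by (auto simp: dual_def bounded_functionals_def add_mem scale_mem intro: exI[of _ 0])
next
  fix \<phi> assume \<phi>: "\<phi> \<in> vecs (dual E)"
  then have lin: "\<phi> \<in> extensional (vecs E)"
      "\<And>x y. x \<in> vecs E \<Longrightarrow> y \<in> vecs E \<Longrightarrow> \<phi> (vadd E x y) = \<phi> x + \<phi> y"
      "\<And>a x. x \<in> vecs E \<Longrightarrow> \<phi> (vscale E a x) = a * \<phi> x"
    by (auto simp: dual_def bounded_functionals_def)
  show "vadd (dual E) (vzero (dual E)) \<phi> = \<phi>"
    "vadd (dual E) (vscale (dual E) (- 1) \<phi>) \<phi> = vzero (dual E)"
    "vscale (dual E) 1 \<phi> = \<phi>"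
    using lin(1) by (auto simp: dual_def fun_eq_iff extensional_def)
  show nonneg: "0 \<le> vnorm (dual E) \<phi>"
    using cmod_le_dual_norm_unit[OF \<phi> zero_mem_unit_ball] norm_ge_zero[of "\<phi> (vzero E)"] by linarith
  show "vnorm (dual E) \<phi> = 0 \<longleftrightarrow> \<phi> = vzero (dual E)"
  proof
    assume 0: "vnorm (dual E) \<phi> = 0"
    have "\<phi> x = 0" if "x \<in> vecs E" for x
      using cmod_le_dual_norm[OF \<phi> that] 0 by simp
    then show "\<phi> = vzero (dual E)"
      using lin(1) by (auto simp: dual_def fun_eq_iff extensional_def)
  next
    assume "\<phi> = vzero (dual E)"
    then have "vnorm (dual E) \<phi> \<le> 0"
      by (intro dual_norm_le) (auto simp: dual_def unit_ball_def)
    with nonneg show "vnorm (dual E) \<phi> = 0" by simp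
  qed
  fix a b
  have mem: "vscale (dual E) a \<phi> \<in> vecs (dual E)" for a
  proof -
    have "cmod (a * \<phi> x) \<le> cmod a * vnorm (dual E) \<phi> * vnorm E x" if "x \<in> vecs E" for x
      using cmod_le_dual_norm[OF \<phi> that] by (simp add: norm_mult mult.assoc mult_left_mono)
    then have "\<exists>C. \<forall>x\<in>vecs E. cmod (a * \<phi> x) \<le> C * vnorm E x"
      by blast
    then show ?thesis
      by (auto simp: dual_def bounded_functionals_def add_mem scale_mem lin distrib_left)
  qed
  then show "vscale (dual E) a \<phi> \<in> vecs (dual E)" .
  show "vscale (dual E) a (vscale (dual E) b \<phi>) = vscale (dual E) (a * b) \<phi>"
    "vscale (dual E) (a + b) \<phi> = vadd (dual E) (vscale (dual E) a \<phi>) (vscale (dual E) b \<phi>)"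
    by (auto simp: dual_def fun_eq_iff distrib_right)
  show "vnorm (dual E) (vscale (dual E) a \<phi>) = cmod a * vnorm (dual E) \<phi>"
  proof (rule antisym)
    show "vnorm (dual E) (vscale (dual E) a \<phi>) \<le> cmod a * vnorm (dual E) \<phi>"
    proof (rule dual_norm_le)
      fix x assume x: "x \<in> unit_ball E"
      then have "vscale (dual E) a \<phi> x = a * \<phi> x"
        by (simp add: dual_def unit_ball_def)
      then show "cmod (vscale (dual E) a \<phi> x) \<le> cmod a * vnorm (dual E) \<phi>"
        using cmod_le_dual_norm_unit[OF \<phi> x] by (simp add: norm_mult mult_left_mono)
    qed
    show "cmod a * vnorm (dual E) \<phi> \<le> vnorm (dual E) (vscale (dual E) a \<phi>)"
    proof (cases "a = 0")
      case True
      then show ?thesis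
        using cmod_le_dual_norm_unit[OF mem zero_mem_unit_ball, of a]
        by (simp add: order_trans[OF norm_ge_zero])
    next
      case False
      have "vnorm (dual E) \<phi> \<le> vnorm (dual E) (vscale (dual E) a \<phi>) / cmod a"
      proof (rule dual_norm_le)
        fix x assume x: "x \<in> unit_ball E"
        then have "vscale (dual E) a \<phi> x = a * \<phi> x"
          by (simp add: dual_def unit_ball_def)
        then show "cmod (\<phi> x) \<le> vnorm (dual E) (vscale (dual E) a \<phi>) / cmod a"
          using cmod_le_dual_norm_unit[OF mem x, of a] False by (simp add: norm_mult field_simps)
      qed
      then show ?thesis using False by (simp add: field_simps)
    qed
  qed
  fix \<psi> assume \<psi>: "\<psi> \<in> vecs (dual E)"
  then have lin': "\<And>x y. x \<in> vecs E \<Longrightarrow> y \<in> vecs E \<Longrightarrow> \<psi> (vadd E x y) = \<psi> x + \<psi> y"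
      "\<And>a x. x \<in> vecs E \<Longrightarrow> \<psi> (vscale E a x) = a * \<psi> x"
    by (auto simp: dual_def bounded_functionals_def)
  have "cmod (\<phi> x + \<psi> x) \<le> (vnorm (dual E) \<phi> + vnorm (dual E) \<psi>) * vnorm E x"
    if "x \<in> vecs E" for x
    using cmod_le_dual_norm[OF \<phi> that] cmod_le_dual_norm[OF \<psi> that]
      norm_triangle_ineq[of "\<phi> x" "\<psi> x"] by (simp add: distrib_right)
  then have "\<exists>C. \<forall>x\<in>vecs E. cmod (\<phi> x + \<psi> x) \<le> C * vnorm E x"
    by blast
  then show "vadd (dual E) \<phi> \<psi> \<in> vecs (dual E)"
    by (auto simp: dual_def bounded_functionals_def add_mem scale_mem lin lin' algebra_simps)
  show "vadd (dual E) \<phi> \<psi> = vadd (dual E) \<psi> \<phi>"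
    "vscale (dual E) a (vadd (dual E) \<phi> \<psi>) =
      vadd (dual E) (vscale (dual E) a \<phi>) (vscale (dual E) a \<psi>)"
    by (auto simp: dual_def fun_eq_iff distrib_left add.commute)
  show "vnorm (dual E) (vadd (dual E) \<phi> \<psi>) \<le> vnorm (dual E) \<phi> + vnorm (dual E) \<psi>"
  proof (rule dual_norm_le)
    fix x assume x: "x \<in> unit_ball E"
    then have "vadd (dual E) \<phi> \<psi> x = \<phi> x + \<psi> x"
      by (simp add: dual_def unit_ball_def)
    then show "cmod (vadd (dual E) \<phi> \<psi> x) \<le> vnorm (dual E) \<phi> + vnorm (dual E) \<psi>"
      using cmod_le_dual_norm_unit[OF \<phi> x] cmod_le_dual_norm_unit[OF \<psi> x]
        norm_triangle_ineq[of "\<phi> x" "\<psi> x"] by simp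
  qed
  fix \<theta> assume "\<theta> \<in> vecs (dual E)"
  show "vadd (dual E) (vadd (dual E) \<phi> \<psi>) \<theta> = vadd (dual E) \<phi> (vadd (dual E) \<psi> \<theta>)"
    by (auto simp: dual_def fun_eq_iff add.assoc)
qed

end

definition weak_topology :: "'v cnormed \<Rightarrow> 'v topology" where
  "weak_topology E = topology_generated_by
     {{x \<in> vecs E. \<phi> x \<in> U} | \<phi> U. \<phi> \<in> vecs (dual E) \<and> open U}"

lemma (in complex_normed_space) topspace_weak_topology: "topspace (weak_topology E) = vecs E"
proof -
  have "vzero (dual E) \<in> vecs (dual E)"
    using complex_normed_space_dual by (rule complex_normed_space.zero_mem)
  then show ?thesis
    by (auto simp: weak_topology_def topology_generated_by_topspace intro: exI[of _ "UNIV"])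
qed

definition relatively_weakly_compact :: "'v cnormed \<Rightarrow> 'v set \<Rightarrow> bool" where
  "relatively_weakly_compact E B \<longleftrightarrow>
     compactin (weak_topology E) (weak_topology E closure_of B)"


section \<open>Multi-norms\<close>

text \<open>An \<open>n\<close>-tuple is a function on \<open>nat\<close> of which only the values at \<open>0, \<dots>, n - 1\<close> matter.
  Suprema are taken in \<open>ennreal\<close>, where the supremum of the empty set is \<open>0\<close>.\<close>

definition weak_summing_norm :: "'v cnormed \<Rightarrow> real \<Rightarrow> nat \<Rightarrow> (nat \<Rightarrow> 'v) \<Rightarrow> ennreal" where
  "weak_summing_norm E p n x =
     (SUP \<phi>\<in>unit_ball (dual E). ennreal ((\<Sum>i<n. cmod (\<phi> (x i)) powr p) powr (1 / p)))"

definition multi_norm :: "'v cnormed \<Rightarrow> real \<Rightarrow> real \<Rightarrow> nat \<Rightarrow> (nat \<Rightarrow> 'v) \<Rightarrow> ennreal" where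
  "multi_norm E p q n x =
     (SUP l\<in>{l \<in> {..<n} \<rightarrow> vecs (dual E). weak_summing_norm (dual E) p n l \<le> 1}.
        ennreal ((\<Sum>j<n. cmod (l j (x j)) powr q) powr (1 / q)))"

definition multi_bound_const :: "'v cnormed \<Rightarrow> real \<Rightarrow> real \<Rightarrow> 'v set \<Rightarrow> ennreal" where
  "multi_bound_const E p q B =
     lim (\<lambda>n. SUP x\<in>{..<n} \<rightarrow> B. multi_norm E p q n x / ennreal (real n powr (1 / q)))"

definition almost_multi_bounded :: "'v cnormed \<Rightarrow> real \<Rightarrow> real \<Rightarrow> 'v set \<Rightarrow> bool" where
  "almost_multi_bounded E p q B \<longleftrightarrow> multi_bound_const E p q B = 0"


section \<open>The space \<open>L\<^sup>1\<close>\<close>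

definition ae_rel :: "'a measure \<Rightarrow> (('a \<Rightarrow> complex) \<times> ('a \<Rightarrow> complex)) set" where
  "ae_rel M = {(f, g). integrable M f \<and> integrable M g \<and> (AE x in M. f x = g x)}"

text \<open>The elements of \<open>L\<^sup>1\<close> are almost-everywhere classes of integrable functions; a class
  operation is the union of the classes obtained from all representatives, which is a single class
  because the operation respects \<open>ae_rel M\<close>.\<close>

definition L1 :: "'a measure \<Rightarrow> ('a \<Rightarrow> complex) set cnormed" where
  "L1 M = \<lparr>
     vecs = {f. integrable M f} // ae_rel M,
     vzero = ae_rel M `` {\<lambda>x. 0},
     vadd = (\<lambda>X Y. \<Union>f\<in>X. \<Union>g\<in>Y. ae_rel M `` {\<lambda>x. f x + g x}),
     vscale = (\<lambda>a X. \<Union>f\<in>X. ae_rel M `` {\<lambda>x. a * f x}),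
     vnorm = (\<lambda>X. the_elem ((\<lambda>f. LINT x|M. cmod (f x)) ` X)) \<rparr>"

lemma equiv_ae_rel: "equiv {f. integrable M f} (ae_rel M)"
proof (rule equivI)
  show "ae_rel M \<subseteq> {f. integrable M f} \<times> {f. integrable M f}"
    by (auto simp: ae_rel_def)
  show "refl_on {f. integrable M f} (ae_rel M)"
    by (auto simp: refl_on_def ae_rel_def)
  show "sym (ae_rel M)"
    by (auto simp: sym_def ae_rel_def elim: eventually_mono)
  show "trans (ae_rel M)"
    by (auto simp: trans_def ae_rel_def elim: eventually_elim2)
qed

lemma vecs_L1_cases:
  assumes "X \<in> vecs (L1 M)"
  obtains f where "integrable M f" "X = ae_rel M `` {f}"
  using assms by (auto simp: L1_def elim!: quotientE)

lemma class_mem_L1: "integrable M f \<Longrightarrow> ae_rel M `` {f} \<in> vecs (L1 M)"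
  by (simp add: L1_def quotientI)

lemma class_eq_iff:
  "integrable M f \<Longrightarrow> integrable M g \<Longrightarrow>
    ae_rel M `` {f} = ae_rel M `` {g} \<longleftrightarrow> (AE x in M. f x = g x)"
  using eq_equiv_class_iff[OF equiv_ae_rel, of f M g] by (simp add: ae_rel_def)

lemma vadd_L1_class:
  assumes "integrable M f" "integrable M g"
  shows "vadd (L1 M) (ae_rel M `` {f}) (ae_rel M `` {g}) = ae_rel M `` {\<lambda>x. f x + g x}"
proof -
  have "(\<lambda>f g. ae_rel M `` {\<lambda>x. f x + g x}) respects2 ae_rel M"
  proof (rule congruent2I')
    fix f f' g g' assume "(f, f') \<in> ae_rel M" "(g, g') \<in> ae_rel M"
    moreover from this have "AE x in M. f x + g x = f' x + g' x"
      by (auto simp: ae_rel_def elim: eventually_elim2)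
    ultimately show "ae_rel M `` {\<lambda>x. f x + g x} = ae_rel M `` {\<lambda>x. f' x + g' x}"
      by (subst class_eq_iff) (auto simp: ae_rel_def)
  qed
  from UN_equiv_class2[OF equiv_ae_rel equiv_ae_rel this] show ?thesis
    using assms by (simp add: L1_def)
qed

lemma vscale_L1_class:
  assumes "integrable M f"
  shows "vscale (L1 M) a (ae_rel M `` {f}) = ae_rel M `` {\<lambda>x. a * f x}"
proof -
  have "(\<lambda>f. ae_rel M `` {\<lambda>x. a * f x}) respects ae_rel M"
  proof (rule congruentI)
    fix f f' assume "(f, f') \<in> ae_rel M"
    moreover from this have "AE x in M. a * f x = a * f' x"
      by (auto simp: ae_rel_def elim: eventually_mono)
    ultimately show "ae_rel M `` {\<lambda>x. a * f x} = ae_rel M `` {\<lambda>x. a * f' x}"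
      by (subst class_eq_iff) (auto simp: ae_rel_def)
  qed
  from UN_equiv_class[OF equiv_ae_rel this] show ?thesis
    using assms by (simp add: L1_def)
qed

lemma vnorm_L1_class:
  assumes "integrable M f"
  shows "vnorm (L1 M) (ae_rel M `` {f}) = (LINT x|M. cmod (f x))"
proof -
  have "(LINT x|M. cmod (g x)) = (LINT x|M. cmod (f x))" if "g \<in> ae_rel M `` {f}" for g
    using that by (intro integral_cong_AE) (auto simp: ae_rel_def)
  moreover have "f \<in> ae_rel M `` {f}"
    using assms by (simp add: ae_rel_def)
  ultimately have "(\<lambda>f. LINT x|M. cmod (f x)) ` (ae_rel M `` {f}) = {LINT x|M. cmod (f x)}"
    by blast
  then show ?thesis by (simp add: L1_def)
qed

lemma vzero_L1: "vzero (L1 M) = ae_rel M `` {\<lambda>x. 0}"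
  by (simp add: L1_def)

lemma complex_normed_space_L1: "complex_normed_space (L1 M)"
proof
  show "vzero (L1 M) \<in> vecs (L1 M)"
    by (simp add: vzero_L1 class_mem_L1)
next
  fix X assume "X \<in> vecs (L1 M)"
  then obtain f where f: "integrable M f" and X: "X = ae_rel M `` {f}"
    by (rule vecs_L1_cases)
  note c = f X vzero_L1 vadd_L1_class vscale_L1_class vnorm_L1_class class_mem_L1
  show "vadd (L1 M) (vzero (L1 M)) X = X" "vadd (L1 M) (vscale (L1 M) (- 1) X) X = vzero (L1 M)"
    "vscale (L1 M) 1 X = X" "0 \<le> vnorm (L1 M) X"
    by (simp_all add: c)
  show "vnorm (L1 M) X = 0 \<longleftrightarrow> X = vzero (L1 M)"
    using f by (simp add: c class_eq_iff integral_nonneg_eq_0_iff_AE)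
  fix a b
  show "vscale (L1 M) a X \<in> vecs (L1 M)"
    "vscale (L1 M) a (vscale (L1 M) b X) = vscale (L1 M) (a * b) X"
    "vscale (L1 M) (a + b) X = vadd (L1 M) (vscale (L1 M) a X) (vscale (L1 M) b X)"
    "vnorm (L1 M) (vscale (L1 M) a X) = cmod a * vnorm (L1 M) X"
    by (simp_all add: c mult.assoc distrib_right norm_mult)
  fix Y assume "Y \<in> vecs (L1 M)"
  then obtain g where g: "integrable M g" and Y: "Y = ae_rel M `` {g}"
    by (rule vecs_L1_cases)
  show "vadd (L1 M) X Y \<in> vecs (L1 M)" "vadd (L1 M) X Y = vadd (L1 M) Y X"
    "vscale (L1 M) a (vadd (L1 M) X Y) = vadd (L1 M) (vscale (L1 M) a X) (vscale (L1 M) a Y)"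
    by (simp_all add: c g Y distrib_left add.commute)
  show "vnorm (L1 M) (vadd (L1 M) X Y) \<le> vnorm (L1 M) X + vnorm (L1 M) Y"
  proof -
    have "(LINT x|M. cmod (f x + g x)) \<le> (LINT x|M. cmod (f x) + cmod (g x))"
      using f g by (intro integral_mono norm_triangle_ineq) auto
    then show ?thesis
      using f g by (simp add: c Y)
  qed
  fix Z assume "Z \<in> vecs (L1 M)"
  then obtain h where h: "integrable M h" and Z: "Z = ae_rel M `` {h}"
    by (rule vecs_L1_cases)
  show "vadd (L1 M) (vadd (L1 M) X Y) Z = vadd (L1 M) X (vadd (L1 M) Y Z)"
    by (simp add: c g Y h Z add.assoc)
qed

end

theory Submission
  imports Defs
begin

text \<open>Both properties are equivalent to almost order boundedness: for every \<open>\<epsilon> > 0\<close> there is an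
  integrable \<open>g \<ge> 0\<close> such that \<open>\<integral> (\<bar>f\<bar> - g)\<^sup>+ \<le> \<epsilon>\<close> for all \<open>f\<close> in the set. If a bounded set is not
  almost order bounded, it contains \<open>f n\<close> with \<open>\<integral>\<^bsub>D n\<^esub> \<bar>f n\<bar> \<ge> \<delta>\<close> on disjoint sets \<open>D n\<close>. The phases
  of the \<open>f n\<close> on the \<open>D n\<close> then have weak summing norm at most 1 and bound the multi-bound
  constant from below; and after Rosenthal's lemma has made the off-diagonal masses small, their
  tail sums are functionals that tend to 0 pointwise on \<open>L\<^sup>1\<close> while staying large on a subsequence
  of the \<open>f n\<close>, which contradicts weak compactness.

  Conversely, functionals \<open>l j\<close> with weak \<open>p\<close>-summing norm at most 1 satisfy
  \<open>\<Sum>j<n. \<bar>l j x\<bar> = o(n)\<close>, and on an order interval \<open>\<bar>y j\<bar> \<le> g\<close> the sum \<open>\<Sum>j<n. \<bar>l j (y j)\<bar>\<close> reduces to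
  such sums over a finite partition. For weak compactness, a generalized limit along the set gives
  set functions \<open>A \<mapsto> lim \<integral>\<^bsub>A\<^esub> f\<close>, which are countably additive by almost order boundedness and whose
  Radon-Nikodym density is the weak limit. Functionals on \<open>L\<^sup>1\<close> need not come from \<open>L\<^sup>\<infinity>\<close> for
  arbitrary \<open>M\<close>, but they do on the set where a suitable integrable function is positive, and
  the whole set is supported there.\<close>

section \<open>Functionals on \<open>L\<^sup>1\<close>\<close>

text \<open>Almost order boundedness is the middle term because \<open>M\<close> is arbitrary: on a
  space of infinite measure uniform integrability would have to be joined by a tightness condition,
  while a bound \<open>g\<close> that may change with \<epsilon> controls concentration and escape
  to infinity at once. The exponents \<open>p\<close> and \<open>q\<close> disappear for two
  reasons: disjointly supported multipliers are weakly summing already for exponent 1, and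
  \<open>le_add_powr\<close> trades a power for a linear bound at the cost of an arbitrarily small
  multiple of \<open>n\<close>.

  The two halves differ in the functionals they meet. To refute a property it suffices to exhibit
  functionals, and multiplication by bounded measurable functions provides enough of them. To
  establish a property all functionals must be faced: the order interval estimate copes with them
  through norm and joint summability alone, whereas the weak limit calls for an integral
  representation, and for this a reference function \<open>g0\<close> is built before any density is
  taken.\<close>

abbreviation cls :: "'a measure \<Rightarrow> ('a \<Rightarrow> complex) \<Rightarrow> ('a \<Rightarrow> complex) set" where
  "cls M f \<equiv> ae_rel M `` {f}"

lemma cls_eqI: "integrable M f \<Longrightarrow> integrable M g \<Longrightarrow> (AE x in M. f x = g x) \<Longrightarrow> cls M f = cls M g"
  by (simp add: class_eq_iff)

lemma L1_rep:
  assumes "X \<in> vecs (L1 M)" "f \<in> X"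
  shows "integrable M f" "X = cls M f"
proof -
  obtain g where g: "integrable M g" "X = cls M g"
    using assms(1) by (rule vecs_L1_cases)
  with assms(2) have "(g, f) \<in> ae_rel M" by simp
  then show "integrable M f" "X = cls M f"
    using g equiv_class_eq[OF equiv_ae_rel] by (auto simp: ae_rel_def)
qed

lemma mem_cls: "integrable M f \<Longrightarrow> f \<in> cls M f"
  by (simp add: ae_rel_def)

lemma dual_vecsD:
  assumes "\<phi> \<in> vecs (dual E)"
  shows "\<phi> \<in> extensional (vecs E)"
    and "x \<in> vecs E \<Longrightarrow> y \<in> vecs E \<Longrightarrow> \<phi> (vadd E x y) = \<phi> x + \<phi> y"
    and "x \<in> vecs E \<Longrightarrow> \<phi> (vscale E a x) = a * \<phi> x"
  using assms by (auto simp: dual_def bounded_functionals_def)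

section \<open>Functionals on \<open>L1\<close> evaluated at representatives\<close>

lemma functional_add:
  assumes "\<phi> \<in> vecs (dual (L1 M))" "integrable M f" "integrable M g"
  shows "\<phi> (cls M (\<lambda>x. f x + g x)) = \<phi> (cls M f) + \<phi> (cls M g)"
  using dual_vecsD(2)[OF assms(1) class_mem_L1 class_mem_L1, OF assms(2,3)] assms(2,3)
  by (simp add: vadd_L1_class)

lemma functional_scale:
  assumes "\<phi> \<in> vecs (dual (L1 M))" "integrable M f"
  shows "\<phi> (cls M (\<lambda>x. a * f x)) = a * \<phi> (cls M f)"
  using dual_vecsD(3)[OF assms(1) class_mem_L1, OF assms(2)] assms(2)
  by (simp add: vscale_L1_class)

lemma functional_zero:
  assumes "\<phi> \<in> vecs (dual (L1 M))"
  shows "\<phi> (cls M (\<lambda>x. 0)) = 0"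
  using functional_scale[OF assms, of "\<lambda>x. 0" 0] by simp

lemma functional_diff:
  assumes "\<phi> \<in> vecs (dual (L1 M))" "integrable M f" "integrable M g"
  shows "\<phi> (cls M (\<lambda>x. f x - g x)) = \<phi> (cls M f) - \<phi> (cls M g)"
  using functional_add[OF assms(1,2), of "\<lambda>x. (-1) * g x"] functional_scale[OF assms(1,3), of "-1"]
    assms(3) by simp

lemma functional_sum:
  assumes "\<phi> \<in> vecs (dual (L1 M))" "finite I" "\<And>i. i \<in> I \<Longrightarrow> integrable M (f i)"
  shows "\<phi> (cls M (\<lambda>x. \<Sum>i\<in>I. f i x)) = (\<Sum>i\<in>I. \<phi> (cls M (f i)))"
  using assms(2,3)
proof (induction I)
  case empty
  show ?case using functional_zero[OF assms(1)] by simp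
next
  case (insert i I)
  then show ?case
    using functional_add[OF assms(1), of "f i" "\<lambda>x. \<Sum>i\<in>I. f i x"] by simp
qed

lemma functional_bound:
  assumes "\<phi> \<in> vecs (dual (L1 M))" "integrable M f"
  shows "cmod (\<phi> (cls M f)) \<le> vnorm (dual (L1 M)) \<phi> * (LINT x|M. cmod (f x))"
  using complex_normed_space.cmod_le_dual_norm[OF complex_normed_space_L1 assms(1) class_mem_L1]
    assms(2) by (simp add: vnorm_L1_class)

lemma dual_norm_nonneg: "complex_normed_space E \<Longrightarrow> \<phi> \<in> vecs (dual E) \<Longrightarrow> 0 \<le> vnorm (dual E) \<phi>"
  by (rule complex_normed_space.norm_nonneg[OF complex_normed_space.complex_normed_space_dual])

section \<open>Multiplication by a bounded measurable function as a functional\<close>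

definition mult_functional :: "'a measure \<Rightarrow> ('a \<Rightarrow> complex) \<Rightarrow> ('a \<Rightarrow> complex) set \<Rightarrow> complex" where
  "mult_functional M w = (\<lambda>X\<in>vecs (L1 M). LINT x|M. w x * (SOME f. f \<in> X) x)"

text \<open>The bound holds at every point of the space rather than almost everywhere, so that sums,
  series and finite partitions can be handled pointwise without null sets. The sign of
  \<open>K\<close> is free: on an empty space any \<open>K\<close> qualifies.\<close>

definition bounded_measurable :: "'a measure \<Rightarrow> ('a \<Rightarrow> 'b::{real_normed_vector}) \<Rightarrow> real \<Rightarrow> bool" where
  "bounded_measurable M w K \<longleftrightarrow> w \<in> borel_measurable M \<and> (\<forall>x\<in>space M. norm (w x) \<le> K)"

lemma bounded_measurableD[measurable_dest]: "bounded_measurable M w K \<Longrightarrow> w \<in> borel_measurable M"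
  by (simp add: bounded_measurable_def)

lemma bounded_measurable_bound: "bounded_measurable M w K \<Longrightarrow> x \<in> space M \<Longrightarrow> norm (w x) \<le> K"
  by (simp add: bounded_measurable_def)

lemma integrable_bounded_mult:
  fixes w f :: "'a \<Rightarrow> 'b::{real_normed_field, second_countable_topology, banach}"
  assumes "bounded_measurable M w K" "integrable M f"
  shows "integrable M (\<lambda>x. w x * f x)"
proof (rule Bochner_Integration.integrable_bound)
  show "integrable M (\<lambda>x. K * norm (f x))" using assms(2) by simp
  show "(\<lambda>x. w x * f x) \<in> borel_measurable M" using assms
    by (intro borel_measurable_times) (auto simp: bounded_measurable_def)
  show "AE x in M. norm (w x * f x) \<le> norm (K * norm (f x))"
  proof (rule AE_I2)
    fix x assume "x \<in> space M"
    then have "norm (w x) \<le> \<bar>K\<bar>"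
      using bounded_measurable_bound[OF assms(1)] by fastforce
    then show "norm (w x * f x) \<le> norm (K * norm (f x))"
      by (simp add: norm_mult abs_mult mult_right_mono)
  qed
qed

lemma integral_bounded_mult_le:
  fixes w f :: "'a \<Rightarrow> 'b::{real_normed_field, second_countable_topology, banach}"
  assumes "bounded_measurable M w K" "integrable M f"
  shows "norm (LINT x|M. w x * f x) \<le> K * (LINT x|M. norm (f x))"
proof -
  have "norm (LINT x|M. w x * f x) \<le> (LINT x|M. norm (w x * f x))"
    by (rule integral_norm_bound)
  also have "\<dots> \<le> (LINT x|M. K * norm (f x))"
  proof (rule integral_mono)
    show "integrable M (\<lambda>x. norm (w x * f x))"
      using integrable_bounded_mult[OF assms] by simp
    show "integrable M (\<lambda>x. K * norm (f x))" using assms(2) by simp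
  qed (simp add: norm_mult mult_right_mono bounded_measurable_bound[OF assms(1)])
  finally show ?thesis by simp
qed

text \<open>The choice made in \<open>mult_functional\<close> is harmless: two members of a class
  agree almost everywhere, so they have the same integral against \<open>w\<close>.\<close>

lemma mult_functional_cls:
  assumes "bounded_measurable M w K" "integrable M f"
  shows "mult_functional M w (cls M f) = (LINT x|M. w x * f x)"
proof -
  define g where "g = (SOME g. g \<in> cls M f)"
  have "g \<in> cls M f"
    unfolding g_def by (rule someI[of "\<lambda>g. g \<in> cls M f" f], rule mem_cls, fact)
  then have g: "integrable M g" "AE x in M. f x = g x"
    by (auto simp: ae_rel_def)
  have "(LINT x|M. w x * g x) = (LINT x|M. w x * f x)"
  proof (rule integral_cong_AE)
    show "AE x in M. w x * g x = w x * f x"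
      using g(2) by eventually_elim simp
  qed (intro borel_measurable_integrable integrable_bounded_mult[OF assms(1)] assms(2) g(1))+
  then show ?thesis
    using class_mem_L1[OF assms(2)] by (simp add: mult_functional_def g_def)
qed

lemma mult_functional_mem:
  assumes w: "bounded_measurable M w K"
  shows "mult_functional M w \<in> vecs (dual (L1 M))"
proof -
  let ?m = "mult_functional M w"
  note c = vadd_L1_class vscale_L1_class vnorm_L1_class mult_functional_cls[OF w]
  have "?m (vadd (L1 M) X Y) = ?m X + ?m Y" if XY: "X \<in> vecs (L1 M)" "Y \<in> vecs (L1 M)" for X Y
  proof -
    obtain f where f: "integrable M f" "X = cls M f" using XY(1) by (rule vecs_L1_cases)
    obtain g where g: "integrable M g" "Y = cls M g" using XY(2) by (rule vecs_L1_cases)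
    show ?thesis
      using f g integrable_bounded_mult[OF w] by (simp add: c distrib_left)
  qed
  moreover have "?m (vscale (L1 M) a X) = a * ?m X" if X: "X \<in> vecs (L1 M)" for a X
  proof -
    obtain f where f: "integrable M f" "X = cls M f" using X by (rule vecs_L1_cases)
    then show ?thesis by (simp add: c mult.left_commute)
  qed
  moreover have "\<forall>X\<in>vecs (L1 M). cmod (?m X) \<le> K * vnorm (L1 M) X"
  proof
    fix X assume X: "X \<in> vecs (L1 M)"
    obtain f where f: "integrable M f" "X = cls M f" using X by (rule vecs_L1_cases)
    then show "cmod (?m X) \<le> K * vnorm (L1 M) X"
      using integral_bounded_mult_le[OF w f(1)] by (simp add: c)
  qed
  moreover have "?m \<in> extensional (vecs (L1 M))"
    by (simp add: mult_functional_def)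
  ultimately show ?thesis
    unfolding dual_def bounded_functionals_def by simp blast
qed

lemma norm_mult_functional_le:
  assumes w: "bounded_measurable M w K" and "0 \<le> K"
  shows "vnorm (dual (L1 M)) (mult_functional M w) \<le> K"
proof (rule complex_normed_space.dual_norm_le[OF complex_normed_space_L1])
  fix X assume "X \<in> unit_ball (L1 M)"
  then have X: "X \<in> vecs (L1 M)" "vnorm (L1 M) X \<le> 1"
    by (auto simp: unit_ball_def)
  obtain f where f: "integrable M f" "X = cls M f" using X(1) by (rule vecs_L1_cases)
  have "cmod (mult_functional M w X) \<le> K * (LINT x|M. cmod (f x))"
    using integral_bounded_mult_le[OF w f(1)] by (simp add: f mult_functional_cls[OF w])
  also have "\<dots> \<le> K * 1"
    using X(2) f assms(2) by (intro mult_left_mono) (auto simp: vnorm_L1_class)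
  finally show "cmod (mult_functional M w X) \<le> K" by simp
qed

lemma mult_functional_add:
  assumes "bounded_measurable M v J" "bounded_measurable M w K"
  shows "vadd (dual (L1 M)) (mult_functional M v) (mult_functional M w) =
    mult_functional M (\<lambda>x. v x + w x)"
proof
  fix X
  have vw: "bounded_measurable M (\<lambda>x. v x + w x) (J + K)"
    using assms by (simp add: bounded_measurable_def norm_triangle_mono borel_measurable_add)
  show "vadd (dual (L1 M)) (mult_functional M v) (mult_functional M w) X =
    mult_functional M (\<lambda>x. v x + w x) X"
  proof (cases "X \<in> vecs (L1 M)")
    case True
    then obtain f where f: "integrable M f" "X = cls M f" by (rule vecs_L1_cases)
    have "(LINT x|M. v x * f x) + (LINT x|M. w x * f x) = (LINT x|M. (v x + w x) * f x)"
      using integrable_bounded_mult[OF assms(1) f(1)] integrable_bounded_mult[OF assms(2) f(1)]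
      by (simp add: distrib_right)
    then show ?thesis
      using True f by (simp add: dual_def mult_functional_cls[OF assms(1)]
          mult_functional_cls[OF assms(2)] mult_functional_cls[OF vw])
  next
    case False
    then show ?thesis by (simp add: dual_def mult_functional_def)
  qed
qed

lemma mult_functional_scale:
  assumes "bounded_measurable M w K"
  shows "vscale (dual (L1 M)) a (mult_functional M w) = mult_functional M (\<lambda>x. a * w x)"
proof
  fix X
  have aw: "bounded_measurable M (\<lambda>x. a * w x) (cmod a * K)"
    using assms by (simp add: bounded_measurable_def norm_mult mult_left_mono borel_measurable_times)
  show "vscale (dual (L1 M)) a (mult_functional M w) X = mult_functional M (\<lambda>x. a * w x) X"
  proof (cases "X \<in> vecs (L1 M)")
    case True
    then obtain f where f: "integrable M f" "X = cls M f" by (rule vecs_L1_cases)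
    then show ?thesis
      using True by (simp add: dual_def mult_functional_cls[OF assms] mult_functional_cls[OF aw]
          mult.assoc)
  next
    case False
    then show ?thesis by (simp add: dual_def mult_functional_def)
  qed
qed

text \<open>Since \<open>sgn 0 = 0\<close>, the product \<open>conj_phase z * z\<close> is the
  modulus of \<open>z\<close> at 0 as well. A multiplier bounded by 1 thus turns the integral of a
  function into its norm.\<close>

definition conj_phase :: "complex \<Rightarrow> complex" where
  "conj_phase z = cnj (sgn z)"

lemma conj_phase_mult: "conj_phase z * z = of_real (cmod z)"
proof -
  have "conj_phase z * z = (z * cnj z) / of_real (cmod z)"
    unfolding conj_phase_def sgn_eq complex_cnj_divide complex_cnj_complex_of_real
    by (simp only: times_divide_eq_left times_divide_eq_right mult.commute)
  also have "\<dots> = (of_real (cmod z))\<^sup>2 / of_real (cmod z)"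
    by (simp only: complex_norm_square[symmetric] of_real_power)
  also have "\<dots> = of_real (cmod z)"
    by (simp add: power2_eq_square)
  finally show ?thesis .
qed

lemma norm_conj_phase_le: "cmod (conj_phase z) \<le> 1"
  by (simp add: conj_phase_def norm_sgn)

lemma measurable_conj_phase[measurable]: "conj_phase \<in> borel_measurable borel"
proof -
  have c: "cnj \<in> borel_measurable borel"
    by (rule borel_measurable_continuous_onI, rule continuous_on_cnj, rule continuous_on_id)
  have "sgn \<in> borel_measurable (borel :: complex measure)"
    unfolding sgn_div_norm[abs_def] by (intro borel_measurable_scaleR) auto
  then show ?thesis
    unfolding conj_phase_def[abs_def] by (rule measurable_compose[OF _ c])
qed

section \<open>Almost multi-bounded sets\<close>

definition weakly_summing_ball :: "'v cnormed \<Rightarrow> real \<Rightarrow> nat \<Rightarrow> (nat \<Rightarrow> 'v) set" where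
  "weakly_summing_ball E p n =
     {x \<in> {..<n} \<rightarrow> vecs E. \<forall>\<phi>\<in>unit_ball (dual E). (\<Sum>i<n. cmod (\<phi> (x i)) powr p) \<le> 1}"

section \<open>Suprema in \<open>ennreal\<close> rewritten as inequalities between finite
  sums\<close>

lemma powr_inverse_le_iff:
  fixes S c q :: real
  assumes "0 \<le> S" "0 \<le> c" "0 < q"
  shows "S powr (1 / q) \<le> c \<longleftrightarrow> S \<le> c powr q"
proof
  assume "S powr (1 / q) \<le> c"
  then have "(S powr (1 / q)) powr q \<le> c powr q"
    using assms by (intro powr_mono2) auto
  then show "S \<le> c powr q"
    using assms by (cases "S = 0") (auto simp: powr_powr)
next
  assume "S \<le> c powr q"
  then have "S powr (1 / q) \<le> (c powr q) powr (1 / q)"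
    using assms by (intro powr_mono2) auto
  then show "S powr (1 / q) \<le> c"
    using assms by (cases "c = 0") (auto simp: powr_powr)
qed

lemma weakly_summing_ball_altdef:
  assumes "0 < p"
  shows "weakly_summing_ball E p n = {x \<in> {..<n} \<rightarrow> vecs E. weak_summing_norm E p n x \<le> 1}"
  using assms
  by (auto simp: weakly_summing_ball_def weak_summing_norm_def SUP_le_iff powr_inverse_le_iff sum_nonneg
      simp flip: ennreal_1)

text \<open>The sequence whose limit is \<open>multi_bound_const\<close>, named so that its
  monotonicity can be stated.\<close>

definition multi_bound_rate :: "'v cnormed \<Rightarrow> real \<Rightarrow> real \<Rightarrow> 'v set \<Rightarrow> nat \<Rightarrow> ennreal" where
  "multi_bound_rate E p q B n =
     (SUP x\<in>{..<n} \<rightarrow> B. multi_norm E p q n x / ennreal (real n powr (1 / q)))"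

text \<open>Raising to the power \<open>q\<close> turns the denominator
  \<open>real n powr (1 / q)\<close> into a factor \<open>real n\<close> on the other side, so that
  only sums of real numbers remain to be bounded.\<close>

lemma multi_bound_rate_le_iff:
  assumes "0 < p" "0 < q" "0 < n" "0 \<le> r"
  shows "multi_bound_rate E p q B n \<le> ennreal r \<longleftrightarrow>
    (\<forall>x\<in>{..<n} \<rightarrow> B. \<forall>l\<in>weakly_summing_ball (dual E) p n.
      (\<Sum>j<n. cmod (l j (x j)) powr q) \<le> r powr q * real n)"
proof -
  let ?t = "real n powr (1 / q)"
  have t: "0 < ?t" using assms by simp
  have div: "A / ennreal ?t \<le> ennreal r \<longleftrightarrow> A \<le> ennreal (r * ?t)" for A
  proof (cases A)
    case (real a)
    then show ?thesis using t assms(4) by (simp add: divide_ennreal field_simps)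
  next
    case top
    then show ?thesis using t by (simp add: ennreal_top_divide top_unique)
  qed
  have "S powr (1 / q) \<le> r * ?t \<longleftrightarrow> S \<le> r powr q * real n" if "0 \<le> S" for S
    using that assms t by (subst powr_inverse_le_iff) (auto simp: powr_mult powr_powr)
  then show ?thesis
    using assms t
    by (simp add: multi_bound_rate_def SUP_le_iff div multi_norm_def sum_nonneg ennreal_le_iff
        flip: weakly_summing_ball_altdef)
qed

text \<open>The increasing injection whose range omits exactly \<open>i\<close>, that is, the coface
  map of index \<open>i\<close>.\<close>

definition skip :: "nat \<Rightarrow> nat \<Rightarrow> nat" where
  "skip i k = (if k < i then k else Suc k)"

lemma bij_betw_skip: "i \<le> n \<Longrightarrow> bij_betw (skip i) {..<n} ({..n} - {i})"
  by (rule bij_betwI[where g = "\<lambda>k. if k < i then k else k - 1"]) (auto simp: skip_def split: if_splits)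

text \<open>Averaging over the \<open>n + 1\<close> ways of omitting one entry of an \<open>(n + 1)\<close>-tuple.\<close>

lemma multi_bound_rate_Suc_le:
  assumes "0 < p" "0 < q" "0 < n"
  shows "multi_bound_rate E p q B (Suc n) \<le> multi_bound_rate E p q B n"
proof (cases "multi_bound_rate E p q B n")
  case (real r)
  then have R: "\<forall>x\<in>{..<n} \<rightarrow> B. \<forall>l\<in>weakly_summing_ball (dual E) p n.
      (\<Sum>j<n. cmod (l j (x j)) powr q) \<le> r powr q * real n"
    by (subst multi_bound_rate_le_iff[OF assms, symmetric]) auto
  have "(\<Sum>j<Suc n. cmod (l j (x j)) powr q) \<le> r powr q * real (Suc n)"
    if x: "x \<in> {..<Suc n} \<rightarrow> B" and l: "l \<in> weakly_summing_ball (dual E) p (Suc n)" for x l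
  proof -
    define a where "a j = cmod (l j (x j)) powr q" for j
    have a: "(\<Sum>j\<in>{..n} - {i}. a j) \<le> r powr q * real n" if i: "i \<le> n" for i
    proof -
      have s: "skip i k < Suc n" if "k < n" for k
        using that by (auto simp: skip_def)
      \<comment> \<open>Dropping an entry only removes nonnegative terms from the sums that define
        weak summability.\<close>
      have "l \<circ> skip i \<in> weakly_summing_ball (dual E) p n"
        unfolding weakly_summing_ball_def
      proof (intro CollectI conjI ballI)
        show "l \<circ> skip i \<in> {..<n} \<rightarrow> vecs (dual E)"
          using l s by (auto simp: weakly_summing_ball_def)
        fix \<Phi> assume "\<Phi> \<in> unit_ball (dual (dual E))"
        then have "(\<Sum>j<Suc n. cmod (\<Phi> (l j)) powr p) \<le> 1"
          using l unfolding weakly_summing_ball_def by blast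
        moreover have "(\<Sum>j\<in>{..n} - {i}. cmod (\<Phi> (l j)) powr p) \<le> (\<Sum>j<Suc n. cmod (\<Phi> (l j)) powr p)"
          by (rule sum_mono2) auto
        moreover have "(\<Sum>k<n. cmod (\<Phi> ((l \<circ> skip i) k)) powr p) =
            (\<Sum>j\<in>{..n} - {i}. cmod (\<Phi> (l j)) powr p)"
          using sum.reindex_bij_betw[OF bij_betw_skip[OF i], of "\<lambda>j. cmod (\<Phi> (l j)) powr p"] by simp
        ultimately show "(\<Sum>k<n. cmod (\<Phi> ((l \<circ> skip i) k)) powr p) \<le> 1"
          by linarith
      qed
      moreover have "x \<circ> skip i \<in> {..<n} \<rightarrow> B"
        using x s by auto
      ultimately have "(\<Sum>k<n. cmod ((l \<circ> skip i) k ((x \<circ> skip i) k)) powr q) \<le> r powr q * real n"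
        using R by blast
      then show ?thesis
        using sum.reindex_bij_betw[OF bij_betw_skip[OF i], of a] by (simp add: a_def)
    qed
    \<comment> \<open>Every entry survives in exactly \<open>n\<close> of the \<open>n + 1\<close>
      shortened tuples.\<close>
    have "real n * (\<Sum>j\<le>n. a j) = (\<Sum>i\<le>n. (\<Sum>j\<le>n. a j) - a i)"
      by (simp add: sum_subtractf algebra_simps)
    also have "\<dots> = (\<Sum>i\<le>n. \<Sum>j\<in>{..n} - {i}. a j)"
      by (intro sum.cong refl) (simp add: sum_diff1)
    also have "\<dots> \<le> (\<Sum>i\<le>n. r powr q * real n)"
      using a by (intro sum_mono) auto
    finally have "real n * (\<Sum>j\<le>n. a j) \<le> real n * (r powr q * real (Suc n))"
      by (simp add: algebra_simps)
    then show ?thesis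
      using assms(3) by (simp add: a_def lessThan_Suc_atMost)
  qed
  then show ?thesis
    using real assms by (subst real(2), subst multi_bound_rate_le_iff) auto
qed simp

text \<open>The rate decreases for positive \<open>n\<close>, so its limit is an infimum and one
  \<open>n\<close> for each \<epsilon> is enough. The tolerance can be \<epsilon> instead of
  \<open>r powr q\<close> because \<open>r powr q\<close> takes every positive value.\<close>

lemma almost_multi_bounded_iff:
  assumes "0 < p" "0 < q"
  shows "almost_multi_bounded E p q B \<longleftrightarrow>
    (\<forall>\<epsilon>>0. \<exists>n>0. \<forall>x\<in>{..<n} \<rightarrow> B. \<forall>l\<in>weakly_summing_ball (dual E) p n.
      (\<Sum>j<n. cmod (l j (x j)) powr q) \<le> \<epsilon> * real n)"
    (is "_ \<longleftrightarrow> (\<forall>\<epsilon>>0. \<exists>n>0. ?P \<epsilon> n)")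
proof -
  let ?r = "multi_bound_rate E p q B"
  \<comment> \<open>Index 0 is left out: there the rate is \<open>0 / 0 = 0\<close>, which would
    break monotonicity and make the infimum 0.\<close>
  have "decseq (\<lambda>n. ?r (Suc n))"
    by (rule decseq_SucI) (simp add: multi_bound_rate_Suc_le assms)
  then have "(\<lambda>n. ?r (Suc n)) \<longlonglongrightarrow> (INF n. ?r (Suc n))"
    by (rule LIMSEQ_INF)
  then have lim: "?r \<longlonglongrightarrow> (INF n. ?r (Suc n))"
    by (rule LIMSEQ_imp_Suc)
  then have "multi_bound_const E p q B = (INF n. ?r (Suc n))"
    unfolding multi_bound_const_def multi_bound_rate_def[abs_def] by (rule limI)
  then have "almost_multi_bounded E p q B \<longleftrightarrow> (INF n. ?r (Suc n)) = 0"
    by (simp add: almost_multi_bounded_def)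
  also have "\<dots> \<longleftrightarrow> (\<forall>r>0. \<exists>n>0. ?r n \<le> ennreal r)"
  proof
    assume 0: "(INF n. ?r (Suc n)) = 0"
    show "\<forall>r>0. \<exists>n>0. ?r n \<le> ennreal r"
    proof (intro allI impI)
      fix r :: real assume "0 < r"
      then have "(INF n. ?r (Suc n)) < ennreal r" using 0 by simp
      then obtain n where "?r (Suc n) < ennreal r"
        by (auto simp: INF_less_iff)
      then show "\<exists>n>0. ?r n \<le> ennreal r"
        by (intro exI[of _ "Suc n"]) auto
    qed
  next
    assume *: "\<forall>r>0. \<exists>n>0. ?r n \<le> ennreal r"
    have "(INF n. ?r (Suc n)) \<le> 0 + ennreal r" if r: "0 < r" for r
    proof -
      obtain n where n: "0 < n" "?r n \<le> ennreal r" using * r by blast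
      have "(INF n. ?r (Suc n)) \<le> ?r (Suc (n - 1))"
        by (rule INF_lower) simp
      then show ?thesis using n by simp
    qed
    then have "(INF n. ?r (Suc n)) \<le> 0"
      by (rule ennreal_le_epsilon)
    then show "(INF n. ?r (Suc n)) = 0" by simp
  qed
  also have "\<dots> \<longleftrightarrow> (\<forall>r>0. \<exists>n>0. ?P (r powr q) n)"
  proof -
    have "?r n \<le> ennreal r \<longleftrightarrow> ?P (r powr q) n" if "0 < n" "0 < r" for n r
      using that by (intro multi_bound_rate_le_iff assms) auto
    then show ?thesis by (smt (verit))
  qed
  also have "\<dots> \<longleftrightarrow> (\<forall>\<epsilon>>0. \<exists>n>0. ?P \<epsilon> n)"
  proof (intro iffI allI impI)
    fix \<epsilon> :: real assume "\<forall>r>0. \<exists>n>0. ?P (r powr q) n" "0 < \<epsilon>"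
    then have "\<exists>n>0. ?P ((\<epsilon> powr (1 / q)) powr q) n" by simp
    then show "\<exists>n>0. ?P \<epsilon> n" using assms \<open>0 < \<epsilon>\<close> by (simp add: powr_powr)
  qed simp
  finally show ?thesis .
qed

text \<open>The integral of \<open>max 0 (cmod (f x) - g x)\<close> is the \<open>L1\<close>
  distance from \<open>f\<close> to the functions dominated by \<open>g\<close>, attained at the
  truncation of \<open>f\<close> (see \<open>truncate_bounds\<close>). On a finite measure space the
  notion coincides with uniform integrability.\<close>

definition almost_order_bounded :: "'a measure \<Rightarrow> ('a \<Rightarrow> complex) set \<Rightarrow> bool" where
  "almost_order_bounded M F \<longleftrightarrow> (\<forall>\<epsilon>>0. \<exists>g. integrable M g \<and> (\<forall>x. 0 \<le> g x) \<and>
     (\<forall>f\<in>F. (LINT x|M. max 0 (cmod (f x) - g x)) \<le> \<epsilon>))"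

text \<open>Replaces Hoelder's inequality: a bound \<open>o(n)\<close> for sums of \<open>n\<close> terms is all that is needed.\<close>

lemma le_add_powr:
  fixes a \<eta> p :: real
  assumes "0 \<le> a" "0 < \<eta>" "1 \<le> p"
  shows "a \<le> \<eta> + \<eta> powr (1 - p) * a powr p"
proof (cases "a \<le> \<eta>")
  case True
  have "0 \<le> \<eta> powr (1 - p) * a powr p" by simp
  with True show ?thesis by linarith
next
  case False
  have "\<eta> powr (p - 1) \<le> a powr (p - 1)"
    using assms False by (intro powr_mono2) auto
  then have "\<eta> powr (1 - p) * \<eta> powr (p - 1) * a \<le> \<eta> powr (1 - p) * a powr (p - 1) * a"
    using assms by (intro mult_right_mono mult_left_mono) auto
  moreover have "\<eta> powr (1 - p) * \<eta> powr (p - 1) = 1"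
    using assms by (simp flip: powr_add)
  moreover have "a powr (p - 1) * a = a powr p"
    using assms False powr_add[of a "p - 1" 1] by simp
  ultimately show ?thesis using assms by (simp add: mult.assoc)
qed

section \<open>Order boundedness and disjoint sets\<close>

text \<open>The indefinite integral of \<open>\<bar>f\<bar>\<close>, taken as a measure so that
  countable subadditivity and continuity along decreasing sets come from
  \<open>finite_measure\<close>.\<close>

abbreviation abs_measure :: "'a measure \<Rightarrow> ('a \<Rightarrow> complex) \<Rightarrow> 'a measure" where
  "abs_measure M f \<equiv> density M (\<lambda>x. ennreal (cmod (f x)))"

lemma integrable_indicator_mult:
  fixes f :: "'a \<Rightarrow> 'b::{banach, second_countable_topology, real_normed_algebra_1}"
  assumes "integrable M f" "A \<in> sets M"
  shows "integrable M (\<lambda>x. indicator A x * f x)"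
proof -
  have "(\<lambda>x. indicator A x * f x) = (\<lambda>x. indicator A x *\<^sub>R f x)"
    by (auto simp: indicator_def)
  then show ?thesis
    using integrable_mult_indicator[OF assms(2,1)] by simp
qed

lemma emeasure_abs_measure:
  assumes "integrable M f" "A \<in> sets M"
  shows "emeasure (abs_measure M f) A = ennreal (LINT x|M. indicator A x * cmod (f x))"
proof -
  have "emeasure (abs_measure M f) A = (\<integral>\<^sup>+x. ennreal (cmod (f x)) * indicator A x \<partial>M)"
    using assms by (subst emeasure_density) auto
  also have "\<dots> = (\<integral>\<^sup>+x. ennreal (indicator A x * cmod (f x)) \<partial>M)"
    by (intro nn_integral_cong) (auto simp: indicator_def)
  also have "\<dots> = ennreal (LINT x|M. indicator A x * cmod (f x))"
    using assms by (intro nn_integral_eq_integral integrable_indicator_mult) auto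
  finally show ?thesis .
qed

lemma measure_abs_measure:
  assumes "integrable M f" "A \<in> sets M"
  shows "measure (abs_measure M f) A = (LINT x|M. indicator A x * cmod (f x))"
  unfolding measure_def emeasure_abs_measure[OF assms] by (simp add: integral_nonneg_AE)

lemma measure_abs_measure_space:
  assumes "integrable M f"
  shows "measure (abs_measure M f) (space M) = (LINT x|M. cmod (f x))"
  unfolding measure_abs_measure[OF assms sets.top]
  by (intro Bochner_Integration.integral_cong) auto

lemma finite_measure_abs_measure: "integrable M f \<Longrightarrow> finite_measure (abs_measure M f)"
  by (rule finite_measureI) (simp add: emeasure_abs_measure)

lemma measure_abs_measure_le:
  "integrable M f \<Longrightarrow> measure (abs_measure M f) A \<le> (LINT x|M. cmod (f x))"
  using finite_measure.bounded_measure[OF finite_measure_abs_measure, of M f A]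
  by (simp add: measure_abs_measure_space)

lemma Union_L1D:
  assumes "B \<subseteq> vecs (L1 M)" "f \<in> \<Union>B"
  shows "integrable M f" "cls M f \<in> B"
proof -
  obtain X where X: "X \<in> B" "f \<in> X" using assms(2) by blast
  with assms(1) have XL: "X \<in> vecs (L1 M)" by blast
  show "integrable M f" by (rule L1_rep(1)[OF XL X(2)])
  show "cls M f \<in> B" using L1_rep(2)[OF XL X(2)] X(1) by simp
qed

text \<open>Each \<open>f n\<close> is chosen to exceed a large multiple of \<open>\<Sum>i<n. \<bar>f i\<bar>\<close> in the mean. The set \<open>A n\<close>
  where it does so carries little of the earlier \<open>f i\<close>, so the \<open>A n\<close> can be made disjoint.\<close>

lemma not_almost_order_bounded_disjoint:
  assumes int: "\<And>f. f \<in> F \<Longrightarrow> integrable M f"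
    and bound: "\<And>f. f \<in> F \<Longrightarrow> (LINT x|M. cmod (f x)) \<le> C"
    and "\<not> almost_order_bounded M F"
  obtains \<delta> f D where "\<delta> > 0" "\<And>n::nat. f n \<in> F" "\<And>n. D n \<in> sets M" "disjoint_family D"
    "\<And>n. \<delta> \<le> measure (abs_measure M (f n)) (D n)"
proof -
  obtain \<epsilon> where \<epsilon>: "\<epsilon> > 0" and ex: "\<And>g. integrable M g \<Longrightarrow> (\<forall>x. 0 \<le> g x) \<Longrightarrow>
      \<exists>f\<in>F. \<epsilon> < (LINT x|M. max 0 (cmod (f x) - g x))"
    using assms(3) unfolding almost_order_bounded_def by (meson not_le)
  obtain f0 where "f0 \<in> F" using ex[of "\<lambda>x. 0"] by auto
  then have C: "0 \<le> C"
    using order_trans[OF integral_nonneg_AE bound, of f0] by auto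
  \<comment> \<open>\<open>T\<close> satisfies \<open>C \<le> \<epsilon> * T\<close>. Hence on
    \<open>A n\<close>, where \<open>\<bar>f n\<bar>\<close> exceeds \<open>t n * G n\<close>, every
    earlier \<open>f i\<close> has mass at most
    \<open>C / t n \<le> \<epsilon> / 2 ^ Suc n\<close>.\<close>
  define T where "T = C / \<epsilon> + 1"
  have T: "0 < T" "C \<le> \<epsilon> * T" using \<epsilon> C by (auto simp: T_def field_simps add_pos_nonneg)
  define t where "t n = 2 ^ Suc n * T" for n :: nat
  have t: "0 < t n" for n using T by (simp add: t_def)
  define pick where
    "pick g = (SOME f. f \<in> F \<and> \<epsilon> < (LINT x|M. max 0 (cmod (f x) - g x)))" for g
  have pick: "pick g \<in> F" "\<epsilon> < (LINT x|M. max 0 (cmod (pick g x) - g x))"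
    if "integrable M g" "\<forall>x. 0 \<le> g x" for g
  proof -
    from ex[OF that] have "\<exists>f. f \<in> F \<and> \<epsilon> < (LINT x|M. max 0 (cmod (f x) - g x))" by blast
    from someI_ex[OF this] show "pick g \<in> F" "\<epsilon> < (LINT x|M. max 0 (cmod (pick g x) - g x))"
      unfolding pick_def by blast+
  qed
  \<comment> \<open>The recursion carries only the running sum of the \<open>\<bar>f i\<bar>\<close>
    with \<open>i < n\<close>; the function \<open>f n\<close> is recovered from it.\<close>
  define G where "G = rec_nat (\<lambda>x. 0) (\<lambda>n g x. g x + cmod (pick (\<lambda>y. t n * g y) x))"
  define f where "f n = pick (\<lambda>y. t n * G n y)" for n
  have G0: "G 0 = (\<lambda>x. 0)" and GS: "G (Suc n) = (\<lambda>x. G n x + cmod (f n x))" for n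
    by (simp_all add: G_def f_def)
  have G: "integrable M (G n) \<and> (\<forall>x. 0 \<le> G n x)" for n
  proof (induction n)
    case 0
    show ?case by (simp add: G0)
  next
    case (Suc n)
    then have "f n \<in> F" unfolding f_def using t by (intro pick(1)) (auto simp: less_imp_le)
    with Suc show ?case by (auto simp: GS int intro!: add_nonneg_nonneg)
  qed
  have tG: "integrable M (\<lambda>x. t n * G n x)" "\<forall>x. 0 \<le> t n * G n x" for n
    using G t by (auto simp: less_imp_le)
  have f: "f n \<in> F" "\<epsilon> < (LINT x|M. max 0 (cmod (f n x) - t n * G n x))" for n
    unfolding f_def using pick[OF tG] by auto
  note fi = int[OF f(1)]
  have f_le_G: "cmod (f i x) \<le> G n x" if "i < n" for i n x
    using that
  proof (induction n)
    case (Suc n)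
    show ?case
    proof (cases "i = n")
      case True
      then show ?thesis using G[of n] by (simp add: GS)
    next
      case False
      then have "cmod (f i x) \<le> G n x" using Suc by auto
      then show ?thesis by (simp add: GS add_increasing2)
    qed
  qed simp
  define A where "A n = {x\<in>space M. t n * G n x < cmod (f n x)}" for n
  have A: "A n \<in> sets M" for n
    unfolding A_def using tG(1)[of n] fi[of n] by measurable
  have big: "\<epsilon> \<le> measure (abs_measure M (f n)) (A n)" for n
  proof -
    have "(LINT x|M. max 0 (cmod (f n x) - t n * G n x)) \<le> (LINT x|M. indicator (A n) x * cmod (f n x))"
    proof (rule integral_mono)
      show "integrable M (\<lambda>x. max 0 (cmod (f n x) - t n * G n x))"
        using tG(1) fi by (intro integrable_max) auto
      show "integrable M (\<lambda>x. indicator (A n) x * cmod (f n x))"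
        using fi A by (intro integrable_indicator_mult) auto
      show "max 0 (cmod (f n x) - t n * G n x) \<le> indicator (A n) x * cmod (f n x)"
        if "x \<in> space M" for x
        using that tG(2)[of n] by (auto simp: A_def indicator_def)
    qed
    with f(2)[of n] show ?thesis by (simp add: measure_abs_measure fi A)
  qed
  have small: "measure (abs_measure M (f i)) (A n) \<le> \<epsilon> * (1 / 2) ^ Suc n" if "i < n" for i n
  proof -
    have "(LINT x|M. indicator (A n) x * cmod (f i x)) \<le> (LINT x|M. cmod (f n x) / t n)"
    proof (rule integral_mono)
      show "integrable M (\<lambda>x. indicator (A n) x * cmod (f i x))"
        using fi A by (intro integrable_indicator_mult) auto
      show "integrable M (\<lambda>x. cmod (f n x) / t n)"
        using fi by simp
      show "indicator (A n) x * cmod (f i x) \<le> cmod (f n x) / t n" for x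
      proof (cases "x \<in> A n")
        case True
        have "t n * cmod (f i x) \<le> t n * G n x"
          using f_le_G[OF that] t by (simp add: less_imp_le)
        also have "\<dots> \<le> cmod (f n x)" using True by (simp add: A_def)
        finally show ?thesis using True t by (simp add: field_simps)
      qed (use t in \<open>simp add: less_imp_le\<close>)
    qed
    also have "\<dots> \<le> C / t n"
      using bound[OF f(1)] t[of n] by (simp add: divide_right_mono)
    also have "\<dots> \<le> \<epsilon> * T / t n"
      using T(2) t[of n] by (intro divide_right_mono) auto
    also have "\<dots> = \<epsilon> * (1 / 2) ^ Suc n"
      using T(1) by (simp add: t_def field_simps)
    finally show ?thesis by (simp add: measure_abs_measure fi A)
  qed
  \<comment> \<open>The later sets are removed from \<open>A n\<close>, not the earlier ones:
    \<open>small\<close> bounds the mass of \<open>f n\<close> on sets that belong to later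
    functions.\<close>
  define U where "U n = (\<Union>i. A (n + 1 + i))" for n
  define D where "D n = A n - U n" for n
  have U: "U n \<in> sets M" for n unfolding U_def using A by blast
  have D: "D n \<in> sets M" for n unfolding D_def using A U by blast
  have "disjoint_family D"
  proof -
    have "D m \<inter> D n = {}" if "m < n" for m n
    proof -
      have "A n \<subseteq> U m"
        using that UN_upper[of "n - m - 1" UNIV "\<lambda>i. A (m + 1 + i)"] by (simp add: U_def)
      then show ?thesis unfolding D_def by blast
    qed
    then show ?thesis
      unfolding disjoint_family_on_def by (metis Int_commute linorder_neqE_nat)
  qed
  moreover have "\<epsilon> / 2 \<le> measure (abs_measure M (f n)) (D n)" for n
  proof -
    let ?N = "abs_measure M (f n)"
    interpret N: finite_measure ?N by (rule finite_measure_abs_measure[OF fi])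
    \<comment> \<open>The worst case is \<open>n = 0\<close>, where the bounds of
      \<open>small\<close> add up to exactly \<open>\<epsilon> / 2\<close>; so at least half of the
      mass \<epsilon> on \<open>A n\<close> is kept.\<close>
    have le: "measure ?N (A (n + 1 + i)) \<le> \<epsilon> / 2 * (1 / 2) ^ Suc i" for i
    proof -
      have "(1 / 2 :: real) ^ Suc (n + 1 + i) \<le> (1 / 2) ^ Suc (Suc i)"
        by (rule power_decreasing) auto
      then have "\<epsilon> * (1 / 2) ^ Suc (n + 1 + i) \<le> \<epsilon> * (1 / 2) ^ Suc (Suc i)"
        using \<epsilon> by (intro mult_left_mono) auto
      then show ?thesis
        using small[of n "n + 1 + i"] by simp
    qed
    have half: "(\<lambda>i. \<epsilon> / 2 * (1 / 2) ^ Suc i) sums (\<epsilon> / 2)"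
      using sums_mult[OF power_half_series, of "\<epsilon> / 2"] by simp
    have summ: "summable (\<lambda>i. measure ?N (A (n + 1 + i)))"
      by (rule summable_comparison_test'[OF sums_summable[OF half]]) (use le in simp)
    have "measure ?N (U n) \<le> (\<Sum>i. measure ?N (A (n + 1 + i)))"
      unfolding U_def by (rule N.finite_measure_subadditive_countably) (use A summ in auto)
    also have "\<dots> \<le> (\<Sum>i. \<epsilon> / 2 * (1 / 2) ^ Suc i)"
      by (rule suminf_le[OF le summ sums_summable[OF half]])
    finally have 1: "measure ?N (U n) \<le> \<epsilon> / 2"
      using sums_unique[OF half] by simp
    have "measure ?N (A n) \<le> measure ?N (D n \<union> U n)"
      by (rule N.finite_measure_mono) (use A U in \<open>auto simp: D_def\<close>)
    also have "\<dots> \<le> measure ?N (D n) + measure ?N (U n)"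
      by (rule measure_Un_le) (use D U in auto)
    finally show ?thesis using 1 big[of n] by linarith
  qed
  ultimately show thesis
    using that[of "\<epsilon> / 2" f D] \<epsilon> f(1) D by simp
qed

section \<open>Almost multi-bounded sets are almost order bounded\<close>

lemma bounded_measurable_scale:
  fixes w :: "'a \<Rightarrow> complex"
  shows "bounded_measurable M w K \<Longrightarrow> bounded_measurable M (\<lambda>x. a * w x) (cmod a * K)"
  by (simp add: bounded_measurable_def norm_mult mult_left_mono borel_measurable_times)

lemma bounded_measurable_sum:
  fixes w :: "'i \<Rightarrow> 'a \<Rightarrow> complex"
  assumes "\<And>i. i \<in> I \<Longrightarrow> bounded_measurable M (w i) (K i)"
  shows "bounded_measurable M (\<lambda>x. \<Sum>i\<in>I. w i x) (\<Sum>i\<in>I. K i)"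
  using assms unfolding bounded_measurable_def
  by (auto intro!: borel_measurable_sum sum_norm_le)

text \<open>Linearity of \<open>\<Phi>\<close> transported to the multipliers, so that coefficients
  can be moved inside and the supremum norm of the combined multiplier can be estimated.\<close>

lemma bidual_mult_functional_sum:
  assumes \<Phi>: "\<Phi> \<in> vecs (dual (dual (L1 M)))" and "finite I"
    and w: "\<And>i. i \<in> I \<Longrightarrow> bounded_measurable M (w i) (K i)"
  shows "\<Phi> (mult_functional M (\<lambda>x. \<Sum>i\<in>I. a i * w i x)) = (\<Sum>i\<in>I. a i * \<Phi> (mult_functional M (w i)))"
  using assms(2) w
proof (induction I)
  case empty
  have "\<Phi> (mult_functional M (\<lambda>x. 0 * 0)) = 0 * \<Phi> (mult_functional M (\<lambda>x. 0))"
  proof -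
    have 0: "bounded_measurable M (\<lambda>x. 0 :: complex) 0"
      by (simp add: bounded_measurable_def)
    show ?thesis
      using dual_vecsD(3)[OF \<Phi> mult_functional_mem[OF 0], of 0] mult_functional_scale[OF 0, of 0]
      by simp
  qed
  then show ?case by simp
next
  case (insert i I)
  have wi: "bounded_measurable M (w i) (K i)" using insert.prems by simp
  have s: "bounded_measurable M (\<lambda>x. \<Sum>i\<in>I. a i * w i x) (\<Sum>i\<in>I. cmod (a i) * K i)"
    using insert.prems by (intro bounded_measurable_sum bounded_measurable_scale) auto
  note ai = bounded_measurable_scale[OF wi, of "a i"]
  have "\<Phi> (mult_functional M (\<lambda>x. \<Sum>i\<in>insert i I. a i * w i x)) =
      \<Phi> (vadd (dual (L1 M)) (mult_functional M (\<lambda>x. a i * w i x))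
        (mult_functional M (\<lambda>x. \<Sum>i\<in>I. a i * w i x)))"
    using insert.hyps by (simp add: mult_functional_add[OF ai s])
  also have "\<dots> = \<Phi> (mult_functional M (\<lambda>x. a i * w i x)) +
      \<Phi> (mult_functional M (\<lambda>x. \<Sum>i\<in>I. a i * w i x))"
    by (rule dual_vecsD(2)[OF \<Phi> mult_functional_mem[OF ai] mult_functional_mem[OF s]])
  also have "\<Phi> (mult_functional M (\<lambda>x. a i * w i x)) = a i * \<Phi> (mult_functional M (w i))"
    using dual_vecsD(3)[OF \<Phi> mult_functional_mem[OF wi], of "a i"]
    by (simp add: mult_functional_scale[OF wi])
  finally show ?case using insert by simp
qed

lemma unit_ball_dual_le:
  assumes "complex_normed_space E" "\<phi> \<in> unit_ball (dual E)" "x \<in> vecs E"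
  shows "cmod (\<phi> x) \<le> vnorm E x"
proof -
  have "cmod (\<phi> x) \<le> vnorm (dual E) \<phi> * vnorm E x"
    using assms complex_normed_space.cmod_le_dual_norm[OF assms(1)] by (auto simp: unit_ball_def)
  also have "\<dots> \<le> 1 * vnorm E x"
    using assms complex_normed_space.norm_nonneg[OF assms(1)]
    by (intro mult_right_mono) (auto simp: unit_ball_def)
  finally show ?thesis by simp
qed

text \<open>Disjointly supported multipliers of modulus at most 1 stay bounded by 1 under any
  combination with coefficients of modulus at most 1. Taking as coefficients the conjugate phases of
  the values of \<open>\<Phi>\<close> bounds the sum of their moduli by 1, which is the case
  \<open>p = 1\<close>; larger \<open>p\<close> follows since each modulus is at most 1.\<close>

lemma mult_functional_weakly_summing:
  assumes D: "disjoint_family_on D {..<n}"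
    and w: "\<And>j. j < n \<Longrightarrow> bounded_measurable M (w j) 1"
    and w0: "\<And>j x. j < n \<Longrightarrow> x \<notin> D j \<Longrightarrow> w j x = 0" and p: "1 \<le> p"
  shows "(\<lambda>j. mult_functional M (w j)) \<in> weakly_summing_ball (dual (L1 M)) p n"
  unfolding weakly_summing_ball_def
proof (intro CollectI conjI ballI)
  show "(\<lambda>j. mult_functional M (w j)) \<in> {..<n} \<rightarrow> vecs (dual (L1 M))"
    using mult_functional_mem[OF w] by auto
  fix \<Phi> assume \<Phi>: "\<Phi> \<in> unit_ball (dual (dual (L1 M)))"
  define c where "c j = \<Phi> (mult_functional M (w j))" for j
  define v where "v x = (\<Sum>j<n. conj_phase (c j) * w j x)" for x
  have v: "bounded_measurable M v 1"
    unfolding bounded_measurable_def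
  proof (intro conjI ballI)
    show "v \<in> borel_measurable M"
      unfolding v_def using w by (auto simp: bounded_measurable_def intro!: borel_measurable_sum borel_measurable_times)
    fix x assume x: "x \<in> space M"
    show "norm (v x) \<le> 1"
    proof (cases "\<exists>k<n. x \<in> D k")
      case True
      then obtain k where k: "k < n" "x \<in> D k" by blast
      have "conj_phase (c j) * w j x = (if j = k then conj_phase (c k) * w k x else 0)" if "j < n" for j
        using that k w0[of j x] disjoint_family_onD[OF D, of j k] by auto
      then have "v x = (\<Sum>j<n. if j = k then conj_phase (c k) * w k x else 0)"
        unfolding v_def by (intro sum.cong) auto
      then have "v x = conj_phase (c k) * w k x"
        using k by simp
      then show ?thesis
        using bounded_measurable_bound[OF w[OF k(1)] x] norm_conj_phase_le[of "c k"]
        by (simp add: norm_mult mult_le_one)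
    next
      case False
      then have "v x = 0" unfolding v_def using w0 by (intro sum.neutral) auto
      then show ?thesis by simp
    qed
  qed
  have "(\<Sum>j<n. cmod (c j)) \<le> 1"
  proof -
    have "\<Phi> (mult_functional M v) = (\<Sum>j<n. conj_phase (c j) * c j)"
      unfolding v_def[abs_def] c_def
      using \<Phi> w by (intro bidual_mult_functional_sum[where K = "\<lambda>_. 1"]) (auto simp: unit_ball_def)
    also have "\<dots> = of_real (\<Sum>j<n. cmod (c j))"
      by (simp add: conj_phase_mult)
    finally have "(\<Sum>j<n. cmod (c j)) = cmod (\<Phi> (mult_functional M v))"
      by (simp add: sum_nonneg del: of_real_sum)
    also have "\<dots> \<le> vnorm (dual (L1 M)) (mult_functional M v)"
      by (intro unit_ball_dual_le \<Phi> mult_functional_mem[OF v]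
          complex_normed_space.complex_normed_space_dual complex_normed_space_L1)
    also have "\<dots> \<le> 1"
      by (rule norm_mult_functional_le[OF v]) simp
    finally show ?thesis .
  qed
  moreover have "cmod (c j) powr p \<le> cmod (c j)" if "j < n" for j
  proof -
    have "cmod (c j) \<le> (\<Sum>j<n. cmod (c j))"
      using that by (intro member_le_sum) auto
    with \<open>(\<Sum>j<n. cmod (c j)) \<le> 1\<close> have "cmod (c j) \<le> 1" by linarith
    then show ?thesis
      using powr_mono'[of 1 p "cmod (c j)"] p by simp
  qed
  then have "(\<Sum>j<n. cmod (c j) powr p) \<le> (\<Sum>j<n. cmod (c j))"
    by (intro sum_mono) auto
  ultimately show "(\<Sum>j<n. cmod (\<Phi> (mult_functional M (w j))) powr p) \<le> 1"
    by (simp add: c_def)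
qed

text \<open>The functionals that carry the conjugate phase of \<open>f j\<close> on
  \<open>D j\<close> form an admissible tuple, and their values at the \<open>f j\<close> are the
  masses on the \<open>D j\<close>. \<open>le_add_powr\<close> with \<eta> equal to \<epsilon>
  removes the exponent \<open>q\<close>; each of its two terms contributes
  \<open>\<epsilon> * real n\<close>.\<close>

lemma multi_bounded_disjoint_sum:
  assumes p: "1 \<le> p" and q: "1 \<le> q" and B: "B \<subseteq> vecs (L1 M)" and \<epsilon>: "0 < \<epsilon>"
    and *: "\<And>x l. x \<in> {..<n} \<rightarrow> B \<Longrightarrow> l \<in> weakly_summing_ball (dual (L1 M)) p n \<Longrightarrow>
      (\<Sum>j<n. cmod (l j (x j)) powr q) \<le> \<epsilon> powr q * real n"
    and f: "\<And>j. j < n \<Longrightarrow> f j \<in> \<Union>B"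
    and D: "disjoint_family_on D {..<n}" "\<And>j. j < n \<Longrightarrow> D j \<in> sets M"
  shows "(\<Sum>j<n. measure (abs_measure M (f j)) (D j)) \<le> 2 * \<epsilon> * real n"
proof -
  have fB: "integrable M (f j)" "cls M (f j) \<in> B" if "j < n" for j
    using Union_L1D[OF B f[OF that]] by blast+
  define w where "w j x = indicator (D j) x * conj_phase (f j x)" for j x
  have w: "bounded_measurable M (w j) 1" if "j < n" for j
    unfolding bounded_measurable_def
  proof (intro conjI ballI)
    have [measurable]: "D j \<in> sets M" "f j \<in> borel_measurable M"
      using that D fB by auto
    show "w j \<in> borel_measurable M"
      unfolding w_def[abs_def] by measurable
    show "norm (w j x) \<le> 1" for x
      using norm_conj_phase_le[of "f j x"] by (simp add: w_def norm_mult indicator_def)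
  qed
  define l where "l j = mult_functional M (w j)" for j
  define a where "a j = measure (abs_measure M (f j)) (D j)" for j
  have la: "cmod (l j (cls M (f j))) = a j" if j: "j < n" for j
  proof -
    have "l j (cls M (f j)) = (LINT x|M. w j x * f j x)"
      unfolding l_def by (rule mult_functional_cls[OF w[OF j] fB(1)[OF j]])
    also have "\<dots> = (LINT x|M. complex_of_real (indicator (D j) x * cmod (f j x)))"
      by (intro Bochner_Integration.integral_cong refl)
        (simp add: w_def mult.assoc conj_phase_mult indicator_def)
    also have "\<dots> = of_real (a j)"
      unfolding a_def integral_complex_of_real using j by (simp add: measure_abs_measure fB D)
    finally show ?thesis by (simp add: a_def)
  qed
  have "l \<in> weakly_summing_ball (dual (L1 M)) p n"
    unfolding l_def
    by (rule mult_functional_weakly_summing[OF D(1) w _ p]) (auto simp: w_def)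
  from *[OF _ this, of "\<lambda>j. cls M (f j)"]
  have sum: "(\<Sum>j<n. a j powr q) \<le> \<epsilon> powr q * real n"
    using fB(2) la by auto
  have "(\<Sum>j<n. a j) \<le> (\<Sum>j<n. \<epsilon> + \<epsilon> powr (1 - q) * a j powr q)"
    by (intro sum_mono le_add_powr \<epsilon> q) (simp add: a_def)
  also have "\<dots> = \<epsilon> * real n + \<epsilon> powr (1 - q) * (\<Sum>j<n. a j powr q)"
    by (simp add: sum.distrib sum_distrib_left)
  also have "\<dots> \<le> \<epsilon> * real n + \<epsilon> powr (1 - q) * (\<epsilon> powr q * real n)"
    using sum by (intro add_left_mono mult_left_mono) auto
  also have "\<epsilon> powr (1 - q) * (\<epsilon> powr q * real n) = \<epsilon> * real n"
    using \<epsilon> by (simp flip: mult.assoc powr_add)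
  finally show ?thesis by (simp add: a_def)
qed

lemma almost_multi_bounded_imp_almost_order_bounded:
  assumes p: "1 \<le> p" and q: "1 \<le> q" and B: "B \<subseteq> vecs (L1 M)"
    and "almost_multi_bounded (L1 M) p q B"
  shows "almost_order_bounded M (\<Union>B)"
proof (rule ccontr)
  assume not: "\<not> almost_order_bounded M (\<Union>B)"
  note int = Union_L1D(1)[OF B]
  have pq: "0 < p" "0 < q" using p q by auto
  note am = iffD1[OF almost_multi_bounded_iff[OF pq] assms(4)]
  have key: "\<exists>n>0. \<forall>f D. (\<forall>j<n. f j \<in> \<Union>B) \<longrightarrow> disjoint_family_on D {..<n} \<longrightarrow>
      (\<forall>j<n. D j \<in> sets M) \<longrightarrow> (\<Sum>j<n. measure (abs_measure M (f j)) (D j)) \<le> 2 * \<epsilon> * real n"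
    if \<epsilon>: "0 < \<epsilon>" for \<epsilon>
  proof -
    have "0 < \<epsilon> powr q" using \<epsilon> by simp
    from mp[OF spec[OF am] this] obtain n where n: "0 < n" "\<forall>x\<in>{..<n} \<rightarrow> B. \<forall>l\<in>weakly_summing_ball (dual (L1 M)) p n.
        (\<Sum>j<n. cmod (l j (x j)) powr q) \<le> \<epsilon> powr q * real n"
      by (elim exE conjE)
    show ?thesis
    proof (intro exI[of _ n] conjI allI impI n(1))
      fix f and D :: "nat \<Rightarrow> 'a set"
      assume "\<forall>j<n. f j \<in> \<Union>B" "disjoint_family_on D {..<n}" "\<forall>j<n. D j \<in> sets M"
      then show "(\<Sum>j<n. measure (abs_measure M (f j)) (D j)) \<le> 2 * \<epsilon> * real n"
        using n(2) by (intro multi_bounded_disjoint_sum[OF p q B \<epsilon>]) auto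
    qed
  qed
  obtain n where n: "0 < n" "\<And>f D. (\<forall>j<n. f j \<in> \<Union>B) \<Longrightarrow> disjoint_family_on D {..<n} \<Longrightarrow>
      (\<forall>j<n. D j \<in> sets M) \<Longrightarrow> (\<Sum>j<n. measure (abs_measure M (f j)) (D j)) \<le> 2 * 1 * real n"
    using key[of 1] by auto
  have bound: "(LINT x|M. cmod (f x)) \<le> 2 * real n" if f: "f \<in> \<Union>B" for f
  proof -
    \<comment> \<open>With all sets but the first empty, the estimate concerns a single function on
      the whole space and becomes a norm bound.\<close>
    let ?D = "\<lambda>j::nat. if j = 0 then space M else {}"
    have "(\<Sum>j<n. measure (abs_measure M f) (?D j)) \<le> 2 * 1 * real n"
      by (rule n(2)) (use f in \<open>auto simp: disjoint_family_on_def\<close>)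
    moreover have "(\<Sum>j<n. measure (abs_measure M f) (?D j)) =
        (\<Sum>j<n. if j = 0 then measure (abs_measure M f) (space M) else 0)"
      by (intro sum.cong) auto
    ultimately show ?thesis
      using n(1) by (simp add: measure_abs_measure_space int[OF f])
  qed
  obtain \<delta> f D where \<delta>: "\<delta> > 0" and fD: "\<And>n::nat. f n \<in> \<Union>B" "\<And>n. D n \<in> sets M" "disjoint_family D"
    "\<And>n. \<delta> \<le> measure (abs_measure M (f n)) (D n)"
    by (rule not_almost_order_bounded_disjoint[OF int bound not]) blast+
  \<comment> \<open>\<open>\<delta> / 4\<close> makes the average mass at most
    \<open>\<delta> / 2\<close>, whereas each term is at least \<delta>.\<close>
  obtain k where k: "0 < k" "(\<Sum>j<k. measure (abs_measure M (f j)) (D j)) \<le> 2 * (\<delta> / 4) * real k"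
    using key[of "\<delta> / 4"] \<delta> fD(1,2) disjoint_family_on_mono[OF subset_UNIV fD(3)] by auto
  have "(\<Sum>j<k. \<delta>) \<le> (\<Sum>j<k. measure (abs_measure M (f j)) (D j))"
    by (intro sum_mono fD(4))
  then have "\<delta> * real k \<le> (\<Sum>j<k. measure (abs_measure M (f j)) (D j))"
    by (simp add: mult.commute)
  moreover have "0 < \<delta> * real k" using \<delta> k(1) by simp
  ultimately show False using k(2) by linarith
qed

section \<open>Almost order bounded sets are almost multi-bounded\<close>

text \<open>Weak summability of functionals is tested on the bidual; evaluation at a vector of the
  unit ball is the test that turns it into a statement about values on \<open>E\<close>.\<close>

lemma evaluation_mem_unit_ball_bidual:
  assumes E: "complex_normed_space E" and x: "x \<in> unit_ball E"
  shows "(\<lambda>\<phi>\<in>vecs (dual E). \<phi> x) \<in> unit_ball (dual (dual E))"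
proof -
  interpret E: complex_normed_space E by fact
  interpret D: complex_normed_space "dual E" by (rule E.complex_normed_space_dual)
  have x': "x \<in> vecs E" using x by (simp add: unit_ball_def)
  let ?e = "\<lambda>\<phi>\<in>vecs (dual E). \<phi> x"
  have le: "cmod (?e \<phi>) \<le> 1 * vnorm (dual E) \<phi>" if "\<phi> \<in> vecs (dual E)" for \<phi>
    using E.cmod_le_dual_norm_unit[OF that x] that by simp
  have "?e (vadd (dual E) \<phi> \<psi>) = ?e \<phi> + ?e \<psi>" if "\<phi> \<in> vecs (dual E)" "\<psi> \<in> vecs (dual E)" for \<phi> \<psi>
    using D.add_mem[OF that] that x' by (simp add: dual_def[of E])
  moreover have "?e (vscale (dual E) a \<phi>) = a * ?e \<phi>" if "\<phi> \<in> vecs (dual E)" for a \<phi>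
    using D.scale_mem[OF that, of a] that x' by (simp add: dual_def[of E])
  ultimately have "?e \<in> bounded_functionals (dual E)"
    using le unfolding bounded_functionals_def by blast
  moreover have "vnorm (dual (dual E)) ?e \<le> 1"
    by (rule D.dual_norm_le) (use le in \<open>force simp: unit_ball_def\<close>)
  ultimately show ?thesis by (simp add: unit_ball_def dual_def[of "dual E"])
qed

text \<open>After \<open>x\<close> is normalised to length 1, evaluation there bounds the sum of the
  \<open>p\<close>-th powers by 1. For fixed \<eta> the second bound is small on average once
  \<open>n\<close> is large, since \<open>\<eta> powr (1 - p)\<close> does not grow with
  \<open>n\<close>.\<close>

lemma
  assumes E: "complex_normed_space E" and l: "l \<in> weakly_summing_ball (dual E) p n"
    and x: "x \<in> vecs E" and p: "1 \<le> p"
  shows weakly_summing_ball_dual_le: "j < n \<Longrightarrow> cmod (l j x) \<le> vnorm E x"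
    and weakly_summing_ball_dual_sum_le:
      "0 < \<eta> \<Longrightarrow> (\<Sum>j<n. cmod (l j x)) \<le> (\<eta> * real n + \<eta> powr (1 - p)) * vnorm E x"
proof -
  interpret E: complex_normed_space E by fact
  have l': "l j \<in> vecs (dual E)" if "j < n" for j
    using l that by (auto simp: weakly_summing_ball_def)
  have unit: "(\<Sum>j<n. cmod (l j y) powr p) \<le> 1" if "y \<in> unit_ball E" for y
  proof -
    have "(\<Sum>j<n. cmod ((\<lambda>\<phi>\<in>vecs (dual E). \<phi> y) (l j)) powr p) \<le> 1"
      using l evaluation_mem_unit_ball_bidual[OF E that] unfolding weakly_summing_ball_def by blast
    then show ?thesis using l' by simp
  qed
  have "(j < n \<longrightarrow> cmod (l j x) \<le> vnorm E x) \<and>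
    (0 < \<eta> \<longrightarrow> (\<Sum>j<n. cmod (l j x)) \<le> (\<eta> * real n + \<eta> powr (1 - p)) * vnorm E x)" for j \<eta>
  proof (cases "vnorm E x = 0")
    case True
    then have "l j x = 0" if "j < n" for j
      using E.cmod_le_dual_norm[OF l'[OF that] x] by simp
    with True show ?thesis by simp
  next
    case False
    define r where "r = vnorm E x"
    have r: "r > 0" using False E.norm_nonneg[OF x] by (simp add: r_def)
    define y where "y = vscale E (of_real (1 / r)) x"
    have y: "y \<in> unit_ball E"
      using r x unfolding y_def unit_ball_def
      by (simp add: E.scale_mem E.norm_scale norm_divide r_def)
    have ly: "cmod (l j x) = r * cmod (l j y)" if "j < n" for j
      unfolding y_def dual_vecsD(3)[OF l'[OF that] x] using r by (simp add: norm_mult norm_divide)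
    have 1: "cmod (l j y) \<le> 1" if "j < n" for j
    proof -
      have "cmod (l j y) powr p \<le> (\<Sum>j<n. cmod (l j y) powr p)"
        using that by (intro member_le_sum) auto
      then have "cmod (l j y) powr p \<le> 1" using unit[OF y] by simp
      then show ?thesis using p gr_one_powr[of "cmod (l j y)" p] by linarith
    qed
    have "(\<Sum>j<n. cmod (l j y)) \<le> \<eta> * real n + \<eta> powr (1 - p)" if \<eta>: "0 < \<eta>"
    proof -
      have "(\<Sum>j<n. cmod (l j y)) \<le> (\<Sum>j<n. \<eta> + \<eta> powr (1 - p) * cmod (l j y) powr p)"
        by (intro sum_mono le_add_powr \<eta> p) simp
      also have "\<dots> = \<eta> * real n + \<eta> powr (1 - p) * (\<Sum>j<n. cmod (l j y) powr p)"
        by (simp add: sum.distrib sum_distrib_left)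
      also have "\<dots> \<le> \<eta> * real n + \<eta> powr (1 - p) * 1"
        using unit[OF y] by (intro add_left_mono mult_left_mono) auto
      finally show ?thesis by simp
    qed
    moreover have "(\<Sum>j<n. cmod (l j x)) = r * (\<Sum>j<n. cmod (l j y))"
      using ly by (simp add: sum_distrib_left)
    ultimately show ?thesis
      using 1 ly r by (simp add: r_def[symmetric] mult.commute mult_left_mono)
  qed
  then show "j < n \<Longrightarrow> cmod (l j x) \<le> vnorm E x"
    and "0 < \<eta> \<Longrightarrow> (\<Sum>j<n. cmod (l j x)) \<le> (\<eta> * real n + \<eta> powr (1 - p)) * vnorm E x"
    by blast+
qed

text \<open>The cells are the fibres of the simultaneous rounding \<kappa>: boundedness leaves
  finitely many values of \<kappa>, and reals with the same floor after division by \<delta> differ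
  by at most \<delta>. Only attained values index a cell, so every cell has a point to
  sample.\<close>

lemma finite_partition_approx:
  fixes v :: "'j \<Rightarrow> 'a \<Rightarrow> real"
  assumes J: "finite J" and v: "\<And>j. j \<in> J \<Longrightarrow> bounded_measurable M (v j) K" and \<delta>: "0 < \<delta>"
  obtains P where "finite P" "P \<subseteq> sets M" "disjoint P" "\<Union>P = space M" "{} \<notin> P"
    "\<And>A j x y. A \<in> P \<Longrightarrow> j \<in> J \<Longrightarrow> x \<in> A \<Longrightarrow> y \<in> A \<Longrightarrow> \<bar>v j x - v j y\<bar> \<le> \<delta>"
proof -
  define \<kappa> where "\<kappa> x = (\<lambda>j\<in>J. \<lfloor>v j x / \<delta>\<rfloor>)" for x
  define cell where "cell k = {y\<in>space M. \<kappa> y = k}" for k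
  define P where "P = cell ` \<kappa> ` space M"
  have "\<kappa> ` space M \<subseteq> (\<Pi>\<^sub>E j\<in>J. {\<lfloor>- K / \<delta>\<rfloor>..\<lfloor>K / \<delta>\<rfloor>})"
  proof -
    have "\<lfloor>- K / \<delta>\<rfloor> \<le> \<lfloor>v j x / \<delta>\<rfloor> \<and> \<lfloor>v j x / \<delta>\<rfloor> \<le> \<lfloor>K / \<delta>\<rfloor>" if "j \<in> J" "x \<in> space M" for j x
      using bounded_measurable_bound[OF v[OF that(1)] that(2)] \<delta>
      by (intro conjI floor_mono divide_right_mono) auto
    then show ?thesis by (auto simp: \<kappa>_def)
  qed
  then have "finite (\<kappa> ` space M)"
    by (rule finite_subset) (intro finite_PiE J finite_atLeastAtMost_int)
  then have "finite P" by (simp add: P_def)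
  moreover have "cell (\<kappa> x) \<in> sets M" for x
  proof -
    have "cell (\<kappa> x) = {y\<in>space M. \<forall>j\<in>J. real_of_int (\<kappa> x j) \<le> v j y / \<delta> \<and> v j y / \<delta> < real_of_int (\<kappa> x j) + 1}"
      unfolding cell_def \<kappa>_def by (auto simp: fun_eq_iff restrict_def floor_eq_iff)
    also have "\<dots> \<in> sets M"
    proof (rule sets.sets_Collect_finite_All[OF _ J])
      fix j assume "j \<in> J"
      then have [measurable]: "v j \<in> borel_measurable M" using v by (auto simp: bounded_measurable_def)
      show "{y\<in>space M. real_of_int (\<kappa> x j) \<le> v j y / \<delta> \<and> v j y / \<delta> < real_of_int (\<kappa> x j) + 1} \<in> sets M"
        by measurable
    qed
    finally show ?thesis .
  qed
  then have "P \<subseteq> sets M" by (auto simp: P_def)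
  moreover have "disjoint P"
    by (auto simp: P_def disjoint_def cell_def)
  moreover have "\<Union>P = space M" "{} \<notin> P"
    by (auto simp: P_def cell_def)
  moreover have "\<bar>v j x - v j y\<bar> \<le> \<delta>" if "A \<in> P" "j \<in> J" "x \<in> A" "y \<in> A" for A j x y
  proof -
    have "\<kappa> x = \<kappa> y" using that by (auto simp: P_def cell_def)
    then have "\<lfloor>v j x / \<delta>\<rfloor> = \<lfloor>v j y / \<delta>\<rfloor>" using that(2) by (metis \<kappa>_def restrict_apply')
    then have "\<bar>v j x / \<delta> - v j y / \<delta>\<bar> \<le> 1" by linarith
    then show ?thesis using \<delta> by (simp add: abs_le_iff field_simps)
  qed
  ultimately show thesis by (rule that)
qed

lemma sum_disjoint_indicator:
  fixes c :: "'a set \<Rightarrow> real"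
  assumes "finite P" "disjoint P" "B \<in> P" "x \<in> B"
  shows "(\<Sum>A\<in>P. c A * indicator A x) = c B"
proof -
  have "c A * indicator A x = (if A = B then c B else 0)" if "A \<in> P" for A
    using that assms(3,4) disjointD[OF assms(2), of A B] by (auto simp: indicator_def)
  then have "(\<Sum>A\<in>P. c A * indicator A x) = (\<Sum>A\<in>P. if A = B then c B else 0)"
    by (intro sum.cong) auto
  then show ?thesis using assms(1,3) by simp
qed

text \<open>A finite partition on which every \<open>v j\<close> is nearly constant reduces the sum to the values of
  the functionals at \<open>g\<close> restricted to the cells, where their joint weak summability applies.\<close>

lemma weakly_summing_ball_order_interval_real:
  fixes v :: "nat \<Rightarrow> 'a \<Rightarrow> real"
  assumes l: "l \<in> weakly_summing_ball (dual (L1 M)) p n" and p: "1 \<le> p" and \<eta>: "0 < \<eta>"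
    and g: "integrable M g" "\<And>x. 0 \<le> g x"
    and v: "\<And>j. j < n \<Longrightarrow> bounded_measurable M (v j) 1"
  shows "(\<Sum>j<n. cmod (l j (cls M (\<lambda>x. complex_of_real (v j x * g x))))) \<le>
    (2 * \<eta> * real n + \<eta> powr (1 - p)) * (LINT x|M. g x)"
proof -
  have l': "l j \<in> vecs (dual (L1 M))" if "j < n" for j
    using l that by (auto simp: weakly_summing_ball_def)
  obtain P where P: "finite P" "P \<subseteq> sets M" "disjoint P" "\<Union>P = space M" "{} \<notin> P"
    and Pv: "\<And>A j x y. A \<in> P \<Longrightarrow> j \<in> {..<n} \<Longrightarrow> x \<in> A \<Longrightarrow> y \<in> A \<Longrightarrow> \<bar>v j x - v j y\<bar> \<le> \<eta>"
    by (rule finite_partition_approx[of "{..<n}" M v 1 \<eta>]) (use v \<eta> in auto)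
  define pt where "pt A = (SOME x. x \<in> A)" for A :: "'a set"
  have pt: "pt A \<in> A" if "A \<in> P" for A
    using that P(5) unfolding pt_def by (intro some_in_eq[THEN iffD2]) auto
  define G where "G A x = complex_of_real (indicator A x * g x)" for A x
  have gA: "integrable M (\<lambda>x. indicator A x * g x)" if "A \<in> P" for A
    using g(1) P(2) that by (intro integrable_indicator_mult) auto
  have G: "integrable M (G A)" if "A \<in> P" for A
    unfolding G_def[abs_def] using gA[OF that] by (rule integrable_of_real)
  note part = sum_disjoint_indicator[OF P(1,3)]
  have approx: "cmod (l j (cls M (\<lambda>x. complex_of_real (v j x * g x)))) \<le>
      \<eta> * (LINT x|M. g x) + (\<Sum>A\<in>P. cmod (l j (cls M (G A))))" if j: "j < n" for j
  proof -
    \<comment> \<open>On each cell \<open>v j\<close> is replaced by its value at the sample point.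
      The functional \<open>l j\<close> has norm at most 1, so the error costs \<eta> times the
      integral of \<open>g\<close>.\<close>
    define s where "s x = (\<Sum>A\<in>P. complex_of_real (v j (pt A)) * G A x)" for x
    define d where "d x = complex_of_real (v j x * g x) - s x" for x
    have vg: "integrable M (\<lambda>x. complex_of_real (v j x * g x))"
      using integrable_bounded_mult[OF v[OF j] g(1)] by (rule integrable_of_real)
    have s: "integrable M s" unfolding s_def[abs_def] using G by auto
    have d: "integrable M d" unfolding d_def[abs_def] using vg s by simp
    have dle: "cmod (d x) \<le> \<eta> * g x" if "x \<in> space M" for x
    proof -
      obtain B where B: "B \<in> P" "x \<in> B" using P(4) \<open>x \<in> space M\<close> by blast
      have "s x = complex_of_real ((\<Sum>A\<in>P. v j (pt A) * indicator A x) * g x)"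
        by (simp add: s_def G_def sum_distrib_right mult.assoc)
      also have "\<dots> = complex_of_real (v j (pt B) * g x)"
        using part[OF B, of "\<lambda>A. v j (pt A)"] by simp
      finally have "d x = complex_of_real ((v j x - v j (pt B)) * g x)"
        by (simp add: d_def algebra_simps)
      then have "cmod (d x) = \<bar>v j x - v j (pt B)\<bar> * g x"
        using g(2)[of x] by (simp only: norm_of_real abs_mult)
      also have "\<dots> \<le> \<eta> * g x"
        using Pv[OF B(1) _ B(2) pt[OF B(1)], of j] j g(2)[of x] by (intro mult_right_mono) auto
      finally show ?thesis .
    qed
    have "cmod (l j (cls M d)) \<le> vnorm (L1 M) (cls M d)"
      by (rule weakly_summing_ball_dual_le[OF complex_normed_space_L1 l class_mem_L1[OF d] p j])
    also have "\<dots> = (LINT x|M. cmod (d x))" by (rule vnorm_L1_class[OF d])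
    also have "\<dots> \<le> (LINT x|M. \<eta> * g x)"
      using d g by (intro integral_mono dle) auto
    finally have ld: "cmod (l j (cls M d)) \<le> \<eta> * (LINT x|M. g x)" by simp
    have "l j (cls M s) = (\<Sum>A\<in>P. l j (cls M (\<lambda>x. complex_of_real (v j (pt A)) * G A x)))"
      unfolding s_def[abs_def] using G by (intro functional_sum l' j P) auto
    also have "\<dots> = (\<Sum>A\<in>P. complex_of_real (v j (pt A)) * l j (cls M (G A)))"
      by (intro sum.cong refl functional_scale l' j G)
    finally have "cmod (l j (cls M s)) \<le> (\<Sum>A\<in>P. cmod (complex_of_real (v j (pt A)) * l j (cls M (G A))))"
      by (simp add: norm_sum)
    \<comment> \<open>The sample values have modulus at most 1 and are discarded, so what remains no
      longer depends on \<open>v j\<close>.\<close>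
    also have "\<dots> \<le> (\<Sum>A\<in>P. cmod (l j (cls M (G A))))"
    proof (rule sum_mono)
      fix A assume A: "A \<in> P"
      have "pt A \<in> space M" using pt[OF A] P(4) A by blast
      then have "\<bar>v j (pt A)\<bar> \<le> 1" using bounded_measurable_bound[OF v[OF j]] by auto
      then show "cmod (complex_of_real (v j (pt A)) * l j (cls M (G A))) \<le> cmod (l j (cls M (G A)))"
        by (simp add: norm_mult mult_left_le_one_le)
    qed
    finally have ls: "cmod (l j (cls M s)) \<le> (\<Sum>A\<in>P. cmod (l j (cls M (G A))))" .
    have "l j (cls M (\<lambda>x. complex_of_real (v j x * g x))) = l j (cls M d) + l j (cls M s)"
      using functional_add[OF l'[OF j] d s] by (simp add: d_def)
    then show ?thesis using norm_triangle_ineq[of "l j (cls M d)" "l j (cls M s)"] ld ls by simp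
  qed
  have "(\<Sum>j<n. cmod (l j (cls M (\<lambda>x. complex_of_real (v j x * g x))))) \<le>
      (\<Sum>j<n. \<eta> * (LINT x|M. g x) + (\<Sum>A\<in>P. cmod (l j (cls M (G A)))))"
    using approx by (intro sum_mono) auto
  also have "\<dots> = \<eta> * real n * (LINT x|M. g x) + (\<Sum>A\<in>P. \<Sum>j<n. cmod (l j (cls M (G A))))"
    by (simp add: sum.distrib sum.swap[of _ P])
  \<comment> \<open>The number of cells never enters: each cell contributes in proportion to its
    share of the integral of \<open>g\<close>, and the shares add up. The second \<eta> of the final
    bound comes from here.\<close>
  also have "(\<Sum>A\<in>P. \<Sum>j<n. cmod (l j (cls M (G A)))) \<le>
      (\<Sum>A\<in>P. (\<eta> * real n + \<eta> powr (1 - p)) * (LINT x|M. indicator A x * g x))"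
  proof (rule sum_mono)
    fix A assume A: "A \<in> P"
    have "vnorm (L1 M) (cls M (G A)) = (LINT x|M. indicator A x * g x)"
      unfolding vnorm_L1_class[OF G[OF A]] G_def norm_of_real using g(2)
      by (intro Bochner_Integration.integral_cong) (auto simp: indicator_def)
    then show "(\<Sum>j<n. cmod (l j (cls M (G A)))) \<le>
        (\<eta> * real n + \<eta> powr (1 - p)) * (LINT x|M. indicator A x * g x)"
      using weakly_summing_ball_dual_sum_le[OF complex_normed_space_L1 l class_mem_L1[OF G[OF A]] p \<eta>]
      by simp
  qed
  also have "\<dots> = (\<eta> * real n + \<eta> powr (1 - p)) * (LINT x|M. g x)"
  proof -
    have "(\<Sum>A\<in>P. (LINT x|M. indicator A x * g x)) = (LINT x|M. (\<Sum>A\<in>P. indicator A x * g x))"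
      using gA by (intro Bochner_Integration.integral_sum[symmetric])
    also have "\<dots> = (LINT x|M. g x)"
    proof (rule Bochner_Integration.integral_cong[OF refl])
      fix x assume "x \<in> space M"
      then obtain B where B: "B \<in> P" "x \<in> B" using P(4) by blast
      show "(\<Sum>A\<in>P. indicator A x * g x) = g x"
        using part[OF B, of "\<lambda>_. 1"] by (simp add: sum_distrib_right[symmetric])
    qed
    finally show ?thesis by (simp flip: sum_distrib_left)
  qed
  finally show ?thesis by (simp add: algebra_simps)
qed

text \<open>Real and imaginary parts are estimated separately, whence the additional factor
  2.\<close>

lemma weakly_summing_ball_order_interval:
  assumes l: "l \<in> weakly_summing_ball (dual (L1 M)) p n" and p: "1 \<le> p" and \<eta>: "0 < \<eta>"
    and g: "integrable M g" "\<And>x. 0 \<le> g x"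
    and y: "\<And>j. j < n \<Longrightarrow> integrable M (y j)" "\<And>j x. j < n \<Longrightarrow> cmod (y j x) \<le> g x"
  shows "(\<Sum>j<n. cmod (l j (cls M (y j)))) \<le>
    2 * (2 * \<eta> * real n + \<eta> powr (1 - p)) * (LINT x|M. g x)"
proof -
  have l': "l j \<in> vecs (dual (L1 M))" if "j < n" for j
    using l that by (auto simp: weakly_summing_ball_def)
  have ry: "\<bar>Re (y j x)\<bar> \<le> g x" "\<bar>Im (y j x)\<bar> \<le> g x" if "j < n" for j x
    using y(2)[OF that, of x] abs_Re_le_cmod[of "y j x"] abs_Im_le_cmod[of "y j x"] by linarith+
  \<comment> \<open>A function with modulus at most \<open>g\<close> is \<open>g\<close> times a
    multiplier bounded by 1: where \<open>g\<close> vanishes the function does too, and the quotient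
    is 0 by convention.\<close>
  have quot: "bounded_measurable M (\<lambda>x. h x / g x) 1 \<and> (\<forall>x. h x / g x * g x = h x)"
    if h: "integrable M h" "\<And>x. \<bar>h x\<bar> \<le> g x" for h :: "'a \<Rightarrow> real"
  proof (intro conjI allI)
    show "bounded_measurable M (\<lambda>x. h x / g x) 1"
      unfolding bounded_measurable_def
    proof (intro conjI ballI)
      show "(\<lambda>x. h x / g x) \<in> borel_measurable M"
        using h(1) g(1) by (intro borel_measurable_divide) auto
      show "norm (h x / g x) \<le> 1" for x
        using h(2)[of x] g(2)[of x] by (simp add: abs_div divide_le_eq)
    qed
    show "h x / g x * g x = h x" for x
      using h(2)[of x] by (cases "g x = 0") auto
  qed
  have Re: "bounded_measurable M (\<lambda>x. Re (y j x) / g x) 1" "\<And>x. Re (y j x) / g x * g x = Re (y j x)"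
    and Im: "bounded_measurable M (\<lambda>x. Im (y j x) / g x) 1" "\<And>x. Im (y j x) / g x * g x = Im (y j x)"
    if "j < n" for j
    using quot[of "\<lambda>x. Re (y j x)"] quot[of "\<lambda>x. Im (y j x)"] ry[OF that] y(1)[OF that] by auto
  let ?R = "\<lambda>j. l j (cls M (\<lambda>x. complex_of_real (Re (y j x) / g x * g x)))"
  let ?I = "\<lambda>j. l j (cls M (\<lambda>x. complex_of_real (Im (y j x) / g x * g x)))"
  let ?b = "(2 * \<eta> * real n + \<eta> powr (1 - p)) * (LINT x|M. g x)"
  have "cmod (l j (cls M (y j))) \<le> cmod (?R j) + cmod (?I j)" if j: "j < n" for j
  proof -
    have iR: "integrable M (\<lambda>x. complex_of_real (Re (y j x)))"
      and iI: "integrable M (\<lambda>x. complex_of_real (Im (y j x)))"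
      using y(1)[OF j] by (auto intro!: integrable_of_real)
    have "y j = (\<lambda>x. complex_of_real (Re (y j x)) + \<i> * complex_of_real (Im (y j x)))"
      by (simp add: fun_eq_iff complex_eq)
    then have "l j (cls M (y j)) =
        l j (cls M (\<lambda>x. complex_of_real (Re (y j x)) + \<i> * complex_of_real (Im (y j x))))"
      by simp
    also have "\<dots> = l j (cls M (\<lambda>x. complex_of_real (Re (y j x)))) +
        \<i> * l j (cls M (\<lambda>x. complex_of_real (Im (y j x))))"
      using functional_add[OF l'[OF j] iR, of "\<lambda>x. \<i> * complex_of_real (Im (y j x))"]
        functional_scale[OF l'[OF j] iI, of \<i>] iI by simp
    also have "\<dots> = ?R j + \<i> * ?I j"
      by (simp only: Re(2)[OF j] Im(2)[OF j])
    finally show ?thesis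
      using norm_triangle_ineq[of "?R j" "\<i> * ?I j"] by (simp add: norm_mult)
  qed
  then have "(\<Sum>j<n. cmod (l j (cls M (y j)))) \<le> (\<Sum>j<n. cmod (?R j) + cmod (?I j))"
    by (intro sum_mono) auto
  also have "\<dots> = (\<Sum>j<n. cmod (?R j)) + (\<Sum>j<n. cmod (?I j))"
    by (rule sum.distrib)
  also have "(\<Sum>j<n. cmod (?R j)) \<le> ?b"
    by (rule weakly_summing_ball_order_interval_real[OF l p \<eta> g Re(1)])
  also have "(\<Sum>j<n. cmod (?I j)) \<le> ?b"
    by (rule weakly_summing_ball_order_interval_real[OF l p \<eta> g Im(1)])
  finally have "(\<Sum>j<n. cmod (l j (cls M (y j)))) \<le> ?b + ?b" by simp
  then show ?thesis by (simp only: mult.assoc mult_2 distrib_right)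
qed

section \<open>Norm bounds and truncation\<close>

lemma almost_order_bounded_imp_bounded:
  assumes "almost_order_bounded M F" and int: "\<And>f. f \<in> F \<Longrightarrow> integrable M f"
  obtains C where "C > 0" "\<And>f. f \<in> F \<Longrightarrow> (LINT x|M. cmod (f x)) \<le> C"
proof -
  obtain g where g: "integrable M g" "\<forall>x. 0 \<le> g x"
    "\<And>f. f \<in> F \<Longrightarrow> (LINT x|M. max 0 (cmod (f x) - g x)) \<le> 1"
    using assms(1) unfolding almost_order_bounded_def by (meson zero_less_one)
  have "(LINT x|M. cmod (f x)) \<le> (LINT x|M. g x) + 1" if f: "f \<in> F" for f
  proof -
    have m: "integrable M (\<lambda>x. max 0 (cmod (f x) - g x))"
      using int[OF f] g(1) by (intro integrable_max) auto
    have "(LINT x|M. cmod (f x)) \<le> (LINT x|M. g x + max 0 (cmod (f x) - g x))"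
      using int[OF f] g(1) m by (intro integral_mono) auto
    also have "\<dots> = (LINT x|M. g x) + (LINT x|M. max 0 (cmod (f x) - g x))"
      using g(1) m by simp
    finally show ?thesis using g(3)[OF f] by linarith
  qed
  moreover have "(LINT x|M. g x) + 1 > 0"
    using g(2) by (simp add: add_nonneg_pos)
  ultimately show thesis using that by blast
qed

text \<open>For \<open>g x \<ge> 0\<close> this is the nearest-point projection of
  \<open>f x\<close> onto the disc of radius \<open>g x\<close>; at zeros of \<open>f\<close> the
  quotient is 0 by convention, and so is the product.\<close>

definition truncate :: "('a \<Rightarrow> real) \<Rightarrow> ('a \<Rightarrow> complex) \<Rightarrow> 'a \<Rightarrow> complex" where
  "truncate g f x = complex_of_real (min 1 (g x / cmod (f x))) * f x"

lemma truncate_bounds: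
  assumes "0 \<le> g x"
  shows "cmod (truncate g f x) \<le> g x"
    and "cmod (f x - truncate g f x) = max 0 (cmod (f x) - g x)"
proof -
  show "cmod (truncate g f x) \<le> g x"
    using assms by (auto simp: truncate_def norm_mult min_def field_simps)
  show "cmod (f x - truncate g f x) = max 0 (cmod (f x) - g x)"
  proof (cases "f x = 0")
    case False
    have "f x - truncate g f x = complex_of_real (1 - min 1 (g x / cmod (f x))) * f x"
      by (simp add: truncate_def algebra_simps)
    then have "cmod (f x - truncate g f x) = (1 - min 1 (g x / cmod (f x))) * cmod (f x)"
      by (simp only: norm_mult norm_of_real)
    also have "\<dots> = max 0 (cmod (f x) - g x)"
      using False by (auto simp: min_def max_def field_simps)
    finally show ?thesis .
  qed (use assms in \<open>simp add: truncate_def\<close>)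
qed

lemma integrable_truncate:
  assumes "integrable M f" "integrable M g" "\<And>x. 0 \<le> g x"
  shows "integrable M (truncate g f)"
proof (rule Bochner_Integration.integrable_bound[OF assms(2)])
  have [measurable]: "f \<in> borel_measurable M" "g \<in> borel_measurable M" using assms by auto
  show "truncate g f \<in> borel_measurable M"
    unfolding truncate_def[abs_def] by measurable
  show "AE x in M. norm (truncate g f x) \<le> norm (g x)"
    using truncate_bounds(1)[of g _ f] assms(3) by (intro AE_I2) fastforce
qed

lemma almost_order_bounded_imp_almost_multi_bounded:
  assumes p: "1 \<le> p" and q: "1 \<le> q" and B: "B \<subseteq> vecs (L1 M)"
    and aob: "almost_order_bounded M (\<Union>B)"
  shows "almost_multi_bounded (L1 M) p q B"
proof -
  note int = Union_L1D(1)[OF B]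
  obtain C where C: "C > 0" "\<And>f. f \<in> \<Union>B \<Longrightarrow> (LINT x|M. cmod (f x)) \<le> C"
    using almost_order_bounded_imp_bounded[OF aob int] by blast
  have "\<exists>n>0. \<forall>X\<in>{..<n} \<rightarrow> B. \<forall>l\<in>weakly_summing_ball (dual (L1 M)) p n.
      (\<Sum>j<n. cmod (l j (X j)) powr q) \<le> \<epsilon> * real n" if \<epsilon>: "0 < \<epsilon>" for \<epsilon>
  proof -
    \<comment> \<open>The values \<open>a j\<close> below lie between 0 and \<open>C\<close>, so
      \<open>K * a j\<close> dominates \<open>a j powr q\<close>.\<close>
    define K where "K = C powr (q - 1)"
    have K: "K > 0" using C by (simp add: K_def)
    \<comment> \<open>Three errors receive a third of \<epsilon> each: the distance to the order
      interval through \<delta>, the part of the order interval estimate that is linear in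
      \<open>n\<close> through \<eta>, and its constant part through the size of \<open>n\<close>.
      The summand 1 in \<open>I + 1\<close> keeps the denominator of \<eta> positive.\<close>
    define \<delta> where "\<delta> = \<epsilon> / (3 * K)"
    have "\<delta> > 0" using \<epsilon> K by (simp add: \<delta>_def)
    then obtain g where g: "integrable M g" "\<forall>x. 0 \<le> g x"
      "\<And>f. f \<in> \<Union>B \<Longrightarrow> (LINT x|M. max 0 (cmod (f x) - g x)) \<le> \<delta>"
      using aob unfolding almost_order_bounded_def by meson
    define I where "I = (LINT x|M. g x)"
    have I: "0 \<le> I" using g(2) by (simp add: I_def)
    define \<eta> where "\<eta> = \<epsilon> / (12 * K * (I + 1))"
    have \<eta>: "\<eta> > 0" using \<epsilon> K I by (simp add: \<eta>_def)
    define n where "n = nat \<lceil>6 * K * \<eta> powr (1 - p) * I / \<epsilon>\<rceil> + 1"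
    have n: "6 * K * \<eta> powr (1 - p) * I / \<epsilon> \<le> real n" "0 < n"
      unfolding n_def by linarith+
    have "(\<Sum>j<n. cmod (l j (X j)) powr q) \<le> \<epsilon> * real n"
      if X: "X \<in> {..<n} \<rightarrow> B" and l: "l \<in> weakly_summing_ball (dual (L1 M)) p n" for X l
    proof -
      have l': "l j \<in> vecs (dual (L1 M))" if "j < n" for j
        using l that by (auto simp: weakly_summing_ball_def)
      have "\<exists>f. f \<in> \<Union>B \<and> X j = cls M f" if j: "j < n" for j
      proof -
        have XB: "X j \<in> B" using X j by auto
        then obtain f where f: "integrable M f" "X j = cls M f"
          using B vecs_L1_cases by (metis subsetD)
        then show ?thesis using mem_cls[OF f(1)] XB by (intro exI[of _ f]) auto
      qed
      then obtain f where f: "\<And>j. j < n \<Longrightarrow> f j \<in> \<Union>B" "\<And>j. j < n \<Longrightarrow> X j = cls M (f j)"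
        by metis
      note lle = weakly_summing_ball_dual_le[OF complex_normed_space_L1 l class_mem_L1 p]
      define y where "y j = truncate g (f j)" for j
      have y: "integrable M (y j)" if "j < n" for j
        unfolding y_def using g(2) by (intro integrable_truncate int f that g) auto
      have yg: "cmod (y j x) \<le> g x" for j x
        unfolding y_def using g(2) by (intro truncate_bounds) auto
      define a where "a j = cmod (l j (X j))" for j
      have aC: "a j \<le> C" if j: "j < n" for j
        using lle[OF int[OF f(1)] j, OF j] C(2)[OF f(1)[OF j]]
        by (simp add: a_def f(2)[OF j] vnorm_L1_class int[OF f(1)[OF j]])
      have a_le: "a j \<le> \<delta> + cmod (l j (cls M (y j)))" if j: "j < n" for j
      proof -
        note fj = int[OF f(1)[OF j]]
        have d: "integrable M (\<lambda>x. f j x - y j x)" using fj y[OF j] by simp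
        have "cmod (l j (cls M (\<lambda>x. f j x - y j x))) \<le> (LINT x|M. cmod (f j x - y j x))"
          using lle[OF d j] by (simp add: vnorm_L1_class d)
        also have "\<dots> = (LINT x|M. max 0 (cmod (f j x) - g x))"
          unfolding y_def using g(2) by (simp add: truncate_bounds)
        also have "\<dots> \<le> \<delta>" by (rule g(3)[OF f(1)[OF j]])
        finally have "cmod (l j (X j) - l j (cls M (y j))) \<le> \<delta>"
          by (simp add: functional_diff[OF l'[OF j] fj y[OF j]] f(2)[OF j])
        then show ?thesis
          unfolding a_def using norm_triangle_ineq2[of "l j (X j)" "l j (cls M (y j))"] by linarith
      qed
      have "a j powr q \<le> K * a j" if j: "j < n" for j
      proof (cases "a j = 0")
        case False
        then have "a j > 0" by (simp add: a_def)
        then have "a j powr q = a j powr (q - 1) * a j"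
          using powr_add[of "a j" "q - 1" 1] by simp
        also have "\<dots> \<le> K * a j"
          unfolding K_def using aC[OF j] q \<open>a j > 0\<close>
          by (intro mult_right_mono powr_mono2) auto
        finally show ?thesis .
      qed (use q in simp)
      then have "(\<Sum>j<n. a j powr q) \<le> (\<Sum>j<n. K * a j)"
        by (intro sum_mono) auto
      also have "\<dots> \<le> (\<Sum>j<n. K * (\<delta> + cmod (l j (cls M (y j)))))"
        using K a_le by (intro sum_mono mult_left_mono) auto
      also have "\<dots> = K * (\<delta> * real n + (\<Sum>j<n. cmod (l j (cls M (y j)))))"
        by (simp add: sum.distrib distrib_left flip: sum_distrib_left)
      also have "\<dots> \<le> K * (\<delta> * real n + 2 * (2 * \<eta> * real n + \<eta> powr (1 - p)) * I)"
        unfolding I_def using K g(2)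
        by (intro mult_left_mono add_left_mono weakly_summing_ball_order_interval[OF l p \<eta> g(1) _ y yg]) auto
      also have "\<dots> = K * \<delta> * real n + (4 * K * I * \<eta>) * real n + 2 * K * \<eta> powr (1 - p) * I"
        by (simp add: algebra_simps)
      also have "\<dots> \<le> \<epsilon> / 3 * real n + \<epsilon> / 3 * real n + \<epsilon> / 3 * real n"
      proof (intro add_mono mult_right_mono)
        show "K * \<delta> \<le> \<epsilon> / 3" using K by (simp add: \<delta>_def)
        have "12 * K * (I + 1) * \<eta> = \<epsilon>"
          using K I by (simp add: \<eta>_def)
        moreover have "0 < K * \<eta>" using K \<eta> by simp
        ultimately show "4 * K * I * \<eta> \<le> \<epsilon> / 3"
          by (simp add: algebra_simps)
        show "2 * K * \<eta> powr (1 - p) * I \<le> \<epsilon> / 3 * real n"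
          using n(1) \<epsilon> by (simp add: field_simps)
      qed auto
      finally show ?thesis by (simp add: a_def)
    qed
    with n(2) show ?thesis by blast
  qed
  then show ?thesis
    using p q by (subst almost_multi_bounded_iff) auto
qed

section \<open>Relatively weakly compact sets are almost order bounded\<close>

lemma openin_weak_topology:
  "\<phi> \<in> vecs (dual E) \<Longrightarrow> open U \<Longrightarrow> openin (weak_topology E) {x \<in> vecs E. \<phi> x \<in> U}"
  unfolding weak_topology_def by (rule topology_generated_by_Basis) blast

text \<open>This is the form in which weak compactness is exploited: a sequence of basic weakly open
  sets that covers the whole space covers \<open>B\<close> after finitely many steps. A
  contradiction then calls for functionals that catch every single vector eventually, but not
  \<open>B\<close> uniformly.\<close>

lemma relatively_weakly_compact_countable_cover:
  fixes \<phi> :: "nat \<Rightarrow> 'v \<Rightarrow> complex"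
  assumes E: "complex_normed_space E" and B: "B \<subseteq> vecs E" and rwc: "relatively_weakly_compact E B"
    and \<phi>: "\<And>m. \<phi> m \<in> vecs (dual E)" and U: "\<And>m. open (U m)"
    and cover: "\<And>x. x \<in> vecs E \<Longrightarrow> \<exists>m. \<phi> m x \<in> U m"
  obtains N where "\<And>x. x \<in> B \<Longrightarrow> \<exists>m<N. \<phi> m x \<in> U m"
proof -
  define V where "V m = {x \<in> vecs E. \<phi> m x \<in> U m}" for m
  let ?K = "weak_topology E closure_of B"
  have K: "compactin (weak_topology E) ?K"
    using rwc by (simp add: relatively_weakly_compact_def)
  have top: "topspace (weak_topology E) = vecs E"
    by (rule complex_normed_space.topspace_weak_topology[OF E])
  have "?K \<subseteq> \<Union>(range V)"
    using closure_of_subset_topspace[of "weak_topology E" B] cover unfolding top V_def by fastforce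
  moreover have "openin (weak_topology E) A" if "A \<in> range V" for A
    using that openin_weak_topology[OF \<phi> U] unfolding V_def by blast
  ultimately obtain \<F> where \<F>: "finite \<F>" "\<F> \<subseteq> range V" "?K \<subseteq> \<Union>\<F>"
    using compactinD[OF K, of "range V"] by metis
  then obtain I where I: "finite I" "\<F> = V ` I"
    using finite_subset_image[of \<F> V UNIV] by auto
  then obtain N where N: "I \<subseteq> {..<N}" using finite_nat_bounded by blast
  have "\<exists>m<N. \<phi> m x \<in> U m" if x: "x \<in> B" for x
  proof -
    have "x \<in> ?K" using closure_of_subset[of B "weak_topology E"] B x top by blast
    then obtain m where "m \<in> I" "x \<in> V m" using \<F>(3) I(2) by blast
    then show ?thesis using N by (auto simp: V_def)
  qed
  then show thesis by (rule that)
qed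

text \<open>The uniform boundedness principle, by a gliding hump: a multiple \<open>4 ^ (-n)\<close> of the phase of
  \<open>f n\<close> is added to the multiplier whenever the value at \<open>f n\<close> would otherwise be small.\<close>

lemma relatively_weakly_compact_L1_bounded:
  assumes B: "B \<subseteq> vecs (L1 M)" and rwc: "relatively_weakly_compact (L1 M) B"
  obtains C where "\<And>f. f \<in> \<Union>B \<Longrightarrow> (LINT x|M. cmod (f x)) \<le> C"
proof (rule ccontr)
  assume "\<not> thesis"
  then have unb: "\<exists>f\<in>\<Union>B. C < (LINT x|M. cmod (f x))" for C
    using that by (meson not_le)
  \<comment> \<open>The norm of \<open>f n\<close> has to outgrow the weight \<open>4 ^ n\<close>,
    so that \<open>c n * N n\<close> below is at least \<open>n\<close>.\<close>
  have "\<exists>f. \<forall>n::nat. f n \<in> \<Union>B \<and> 4 ^ n * real n < (LINT x|M. cmod (f n x))"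
    by (intro choice allI, fold Bex_def, rule unb)
  then obtain f where fB: "\<And>n::nat. f n \<in> \<Union>B"
    and big: "\<And>n::nat. 4 ^ n * real n < (LINT x|M. cmod (f n x))" by blast
  note f = Union_L1D[OF B fB]
  define c :: "nat \<Rightarrow> real" where "c n = (1 / 4) ^ n" for n
  have c: "0 < c n" for n by (simp add: c_def)
  define N where "N n = (LINT x|M. cmod (f n x))" for n
  have N: "0 \<le> N n" for n by (simp add: N_def)
  define step where "step n w x = (if cmod (LINT y|M. w y * f n y) < c n / 2 * N n
      then complex_of_real (c n) * conj_phase (f n x) else 0)" for n w x
  define w where "w = rec_nat (\<lambda>x. 0) (\<lambda>n w x. w x + step n w x)"
  have w0: "w 0 = (\<lambda>x. 0)" and wS: "w (Suc n) = (\<lambda>x. w n x + step n (w n) x)" for n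
    by (simp_all add: w_def)
  define d where "d n = step n (w n)" for n
  have wsum: "w n = (\<lambda>x. \<Sum>i<n. d i x)" for n
    by (induction n) (simp_all add: w0 wS d_def fun_eq_iff)
  have d: "bounded_measurable M (d n) (c n)" for n
    unfolding bounded_measurable_def
  proof (intro conjI ballI)
    have [measurable]: "f n \<in> borel_measurable M" using f(1) by auto
    show "d n \<in> borel_measurable M"
      unfolding d_def step_def by measurable
    show "norm (d n x) \<le> c n" for x
      using c[of n] norm_conj_phase_le[of "f n x"]
      by (simp add: d_def step_def norm_mult mult_left_le)
  qed
  have wb: "bounded_measurable M (w n) (\<Sum>i<n. c i)" for n
    unfolding wsum by (intro bounded_measurable_sum d)
  \<comment> \<open>A correction changes the value at \<open>f n\<close> by exactly
    \<open>c n * N n\<close>, so a value below half of that in modulus ends above half. If no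
    correction is made, the value was large already.\<close>
  have hump: "c n / 2 * N n \<le> cmod (LINT x|M. w (Suc n) x * f n x)" for n
  proof (cases "cmod (LINT y|M. w n y * f n y) < c n / 2 * N n")
    case True
    have "(LINT x|M. w (Suc n) x * f n x) = (LINT x|M. w n x * f n x + complex_of_real (c n * cmod (f n x)))"
      using True by (simp add: wS step_def distrib_right mult.assoc conj_phase_mult)
    also have "\<dots> = (LINT x|M. w n x * f n x) + (LINT x|M. complex_of_real (c n * cmod (f n x)))"
      using integrable_bounded_mult[OF wb f(1)] f(1)
      by (intro Bochner_Integration.integral_add integrable_of_real integrable_mult_right integrable_norm)
    also have "(LINT x|M. complex_of_real (c n * cmod (f n x))) = complex_of_real (c n * N n)"
      by (simp only: integral_complex_of_real integral_mult_right_zero N_def)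
    finally have "cmod (complex_of_real (c n * N n)) \<le>
        cmod (LINT x|M. w (Suc n) x * f n x) + cmod (LINT x|M. w n x * f n x)"
      by (metis add_diff_cancel_left' norm_triangle_ineq4)
    moreover have "cmod (complex_of_real (c n * N n)) = c n * N n"
      using c[of n] N[of n] by (simp only: norm_of_real) simp
    ultimately show ?thesis using True by linarith
  next
    case False
    then show ?thesis by (simp add: wS step_def)
  qed
  define W where "W x = (\<Sum>i. d i x)" for x
  \<comment> \<open>The corrections after the \<open>n\<close>-th total at most
    \<open>4 / 3 * c (Suc n) = c n / 3\<close>, less than the \<open>c n / 2\<close> secured at
    \<open>f n\<close>; the difference is the \<open>1 / 6\<close> in \<open>large\<close>.\<close>
  have geo: "(\<lambda>i. c (i + k)) sums (4 / 3 * c k)" for k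
  proof -
    have "(\<lambda>i. (1 / 4) ^ i * (1 / 4) ^ k) sums (1 / (1 - 1 / 4) * (1 / 4 :: real) ^ k)"
      by (intro sums_mult2 geometric_sums) simp
    then show ?thesis by (simp add: c_def power_add)
  qed
  have tail: "cmod (W x - w k x) \<le> 4 / 3 * c k" if x: "x \<in> space M" for k x
  proof -
    have le: "norm (d i x) \<le> c i" for i
      using bounded_measurable_bound[OF d x] .
    have sd: "summable (\<lambda>i. norm (d i x))"
      by (rule summable_comparison_test'[OF sums_summable[OF geo[of 0]]]) (use le in simp)
    have sdk: "summable (\<lambda>i. norm (d (i + k) x))"
      by (rule summable_ignore_initial_segment[OF sd])
    have "W x - w k x = (\<Sum>i. d (i + k) x)"
      unfolding W_def wsum using suminf_split_initial_segment[OF summable_norm_cancel[OF sd], of k] by simp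
    also have "norm \<dots> \<le> (\<Sum>i. norm (d (i + k) x))"
      by (rule summable_norm[OF sdk])
    also have "\<dots> \<le> (\<Sum>i. c (i + k))"
      by (rule suminf_le[OF le sdk sums_summable[OF geo]])
    also have "\<dots> = 4 / 3 * c k"
      using sums_unique[OF geo] by simp
    finally show ?thesis .
  qed
  have W: "bounded_measurable M W (4 / 3)"
    unfolding bounded_measurable_def
  proof (intro conjI ballI)
    show "W \<in> borel_measurable M"
      unfolding W_def[abs_def] using d by (intro borel_measurable_suminf) (auto simp: bounded_measurable_def)
    show "norm (W x) \<le> 4 / 3" if "x \<in> space M" for x
      using tail[OF that, of 0] by (simp add: w0 c_def)
  qed
  have large: "real n / 6 \<le> cmod (mult_functional M W (cls M (f n)))" for n
  proof -
    have Ww: "bounded_measurable M (\<lambda>x. W x - w (Suc n) x) (4 / 3 * c (Suc n))"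
      unfolding bounded_measurable_def
    proof (intro conjI ballI tail)
      show "(\<lambda>x. W x - w (Suc n) x) \<in> borel_measurable M"
        by (intro borel_measurable_diff bounded_measurableD[OF W] bounded_measurableD[OF wb])
    qed
    have "(LINT x|M. W x * f n x) = (LINT x|M. w (Suc n) x * f n x + (W x - w (Suc n) x) * f n x)"
      by (simp add: algebra_simps)
    also have "\<dots> = (LINT x|M. w (Suc n) x * f n x) + (LINT x|M. (W x - w (Suc n) x) * f n x)"
      by (intro Bochner_Integration.integral_add integrable_bounded_mult[OF wb] integrable_bounded_mult[OF Ww] f(1))
    finally have "cmod (LINT x|M. w (Suc n) x * f n x) \<le>
        cmod (LINT x|M. W x * f n x) + cmod (LINT x|M. (W x - w (Suc n) x) * f n x)"
      by (metis add_diff_cancel_right' norm_triangle_ineq4)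
    moreover have "cmod (LINT x|M. (W x - w (Suc n) x) * f n x) \<le> 4 / 3 * c (Suc n) * N n"
      unfolding N_def by (rule integral_bounded_mult_le[OF Ww f(1)])
    moreover have "4 / 3 * c (Suc n) * N n = c n / 3 * N n"
      by (simp add: c_def)
    moreover have "real n \<le> c n * N n"
      using big[of n] by (simp add: c_def N_def power_divide field_simps)
    moreover have "c n / 2 * N n = c n * N n / 2" "c n / 3 * N n = c n * N n / 3" by simp_all
    ultimately have "real n / 6 \<le> cmod (LINT x|M. W x * f n x)"
      using hump[of n] by linarith
    then show ?thesis by (simp add: mult_functional_cls[OF W f(1)])
  qed
  \<comment> \<open>The discs \<open>ball 0 (real m)\<close> cover the plane, so those with
    \<open>m < k\<close> contain all values on \<open>B\<close>; but at \<open>f (6 * k)\<close> the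
    value has modulus at least \<open>k\<close>.\<close>
  obtain k where k: "\<And>X. X \<in> B \<Longrightarrow> \<exists>m<k. mult_functional M W X \<in> ball 0 (real m)"
  proof (rule relatively_weakly_compact_countable_cover[OF complex_normed_space_L1 B rwc,
        of "\<lambda>_. mult_functional M W" "\<lambda>m. ball 0 (real m)"])
    show "\<exists>m. mult_functional M W X \<in> ball 0 (real m)" for X
      using reals_Archimedean2[of "cmod (mult_functional M W X)"] by auto
  qed (auto intro: mult_functional_mem[OF W])
  obtain m where "m < k" "mult_functional M W (cls M (f (6 * k))) \<in> ball 0 (real m)"
    using k[OF f(2)] by blast
  with large[of "6 * k"] show False by simp
qed

text \<open>Rosenthal's lemma. If no block of a partition of \<open>I\<close> into infinitely many infinite sets works,
  each block contains a row with mass more than \<open>\<eta>\<close> inside that block; the rows so chosen have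
  total mass on the chosen indices reduced by \<open>\<eta>\<close>.\<close>

lemma rosenthal:
  fixes a :: "nat \<Rightarrow> nat \<Rightarrow> real"
  assumes \<eta>: "0 < \<eta>" and a: "\<And>n k. 0 \<le> a n k"
  shows "infinite I \<Longrightarrow> (\<And>n F. n \<in> I \<Longrightarrow> finite F \<Longrightarrow> F \<subseteq> I \<Longrightarrow> (\<Sum>k\<in>F. a n k) \<le> real N * \<eta>) \<Longrightarrow>
    \<exists>J\<subseteq>I. infinite J \<and> (\<forall>n\<in>J. \<forall>F. finite F \<longrightarrow> F \<subseteq> J - {n} \<longrightarrow> (\<Sum>k\<in>F. a n k) \<le> \<eta>)"
proof (induction N arbitrary: I)
  case 0
  \<comment> \<open>\<open>N\<close> counts the available mass in units of \<eta>; with none left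
    every sum is at most 0.\<close>
  have "(\<Sum>k\<in>F. a n k) \<le> \<eta>" if "n \<in> I" "finite F" "F \<subseteq> I - {n}" for n F
  proof -
    have "F \<subseteq> I" using that(3) by blast
    then show ?thesis using 0(2)[OF that(1,2)] \<eta> by simp
  qed
  with 0(1) show ?case by blast
next
  case (Suc N)
  define e where "e = enumerate I"
  have e: "inj e" "range e = I"
    using range_enumerate[OF Suc.prems(1)] strict_mono_imp_inj_on[OF strict_mono_enumerate[OF Suc.prems(1)]]
    by (simp_all add: e_def)
  \<comment> \<open>The pairing of natural numbers splits \<open>I\<close> into infinitely many
    infinite blocks.\<close>
  define P where "P p = range (\<lambda>i. e (prod_encode (p, i)))" for p
  have P: "infinite (P p)" "P p \<subseteq> I" for p
  proof -
    show "infinite (P p)"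
      unfolding P_def by (intro range_inj_infinite injI) (simp add: inj_eq[OF e(1)] prod_encode_eq)
    show "P p \<subseteq> I" using e(2) by (auto simp: P_def)
  qed
  have Pd: "p = q" if "k \<in> P p" "k \<in> P q" for p q k
    using that by (auto simp: P_def inj_eq[OF e(1)] prod_encode_eq)
  let ?good = "\<lambda>J. \<forall>n\<in>J. \<forall>F. finite F \<longrightarrow> F \<subseteq> J - {n} \<longrightarrow> (\<Sum>k\<in>F. a n k) \<le> \<eta>"
  show ?case
  proof (cases "\<exists>p. ?good (P p)")
    case True
    then obtain p where "?good (P p)" ..
    then show ?thesis using P by (intro exI[of _ "P p"] conjI)
  next
    case False
    then have ex: "\<forall>p. \<exists>n F. n \<in> P p \<and> finite F \<and> F \<subseteq> P p - {n} \<and> \<not> (\<Sum>k\<in>F. a n k) \<le> \<eta>"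
      by blast
    obtain r where "\<forall>p. \<exists>F. r p \<in> P p \<and> finite F \<and> F \<subseteq> P p - {r p} \<and> \<not> (\<Sum>k\<in>F. a (r p) k) \<le> \<eta>"
      using choice[OF ex] by (elim exE)
    from choice[OF this] obtain F where rF: "\<And>p. r p \<in> P p \<and> finite (F p) \<and> F p \<subseteq> P p - {r p} \<and>
        \<not> (\<Sum>k\<in>F p. a (r p) k) \<le> \<eta>"
      by blast
    then have r: "\<And>p. r p \<in> P p" and F: "\<And>p. finite (F p)" "\<And>p. F p \<subseteq> P p - {r p}"
      "\<And>p. \<not> (\<Sum>k\<in>F p. a (r p) k) \<le> \<eta>" by blast+
    have "inj r" by (rule injI) (metis Pd r)
    then have inf: "infinite (range r)" by (rule range_inj_infinite)
    have sub: "range r \<subseteq> I" using r P(2) by blast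
    have "(\<Sum>k\<in>G. a n k) \<le> real N * \<eta>" if "n \<in> range r" "finite G" "G \<subseteq> range r" for n G
    proof -
      obtain p where p: "n = r p" using \<open>n \<in> range r\<close> by blast
      \<comment> \<open>The block \<open>P p\<close> holds no chosen row except \<open>r p\<close>,
        and \<open>F p\<close> avoids that one. Hence the mass on \<open>F p\<close> comes on top of
        the mass on \<open>G\<close> and uses up one unit \<eta>.\<close>
      have "G \<inter> F p = {}"
      proof -
        have False if "k \<in> G" "k \<in> F p" for k
        proof -
          obtain q where "k = r q" using \<open>G \<subseteq> range r\<close> \<open>k \<in> G\<close> by blast
          moreover have "k \<in> P p" "k \<noteq> r p" using F(2)[of p] \<open>k \<in> F p\<close> by auto
          ultimately show False using Pd[OF _ r[of q]] by metis
        qed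
        then show ?thesis by blast
      qed
      then have "(\<Sum>k\<in>G \<union> F p. a n k) = (\<Sum>k\<in>G. a n k) + (\<Sum>k\<in>F p. a n k)"
        using that F(1) by (intro sum.union_disjoint) auto
      moreover have "(\<Sum>k\<in>G \<union> F p. a n k) \<le> real (Suc N) * \<eta>"
      proof (rule Suc.prems(2))
        show "G \<union> F p \<subseteq> I" using that(3) sub F(2)[of p] P(2)[of p] by blast
      qed (use that F(1) sub in auto)
      moreover have "real (Suc N) * \<eta> = real N * \<eta> + \<eta>" by (simp add: algebra_simps)
      ultimately show ?thesis using F(3)[of p, folded p] by linarith
    qed
    then have "\<exists>J\<subseteq>range r. infinite J \<and> ?good J"
      by (intro Suc.IH[OF inf])
    then obtain J where J: "J \<subseteq> range r" "infinite J" "?good J"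
      by (elim exE conjE)
    then show ?thesis using sub by (intro exI[of _ J] conjI order_trans[OF J(1)])
  qed
qed

lemma relatively_weakly_compact_imp_almost_order_bounded:
  assumes B: "B \<subseteq> vecs (L1 M)" and rwc: "relatively_weakly_compact (L1 M) B"
  shows "almost_order_bounded M (\<Union>B)"
proof (rule ccontr)
  assume not: "\<not> almost_order_bounded M (\<Union>B)"
  obtain C where C: "\<And>f. f \<in> \<Union>B \<Longrightarrow> (LINT x|M. cmod (f x)) \<le> C"
    using relatively_weakly_compact_L1_bounded[OF B rwc] by blast
  obtain \<delta> f D where \<delta>: "\<delta> > 0" and fB: "\<And>n::nat. f n \<in> \<Union>B" and D: "\<And>n. D n \<in> sets M"
    and disj: "disjoint_family D" and mass: "\<And>n. \<delta> \<le> measure (abs_measure M (f n)) (D n)"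
    by (rule not_almost_order_bounded_disjoint[OF Union_L1D(1)[OF B] C not]) blast+
  note f = Union_L1D[OF B fB]
  define a where "a n k = measure (abs_measure M (f n)) (D k)" for n k
  \<comment> \<open>\<open>L\<close> units of \<open>\<delta> / 2\<close> exceed the norm bound. An
    off-diagonal mass of at most \<open>\<delta> / 2\<close> will leave at least
    \<open>\<delta> / 2\<close> of the diagonal mass.\<close>
  obtain L :: nat where L: "C < real L * (\<delta> / 2)"
    using ex_less_of_nat_mult[of "\<delta> / 2" C] \<delta> by auto
  have "\<exists>J\<subseteq>UNIV. infinite J \<and> (\<forall>n\<in>J. \<forall>F. finite F \<longrightarrow> F \<subseteq> J - {n} \<longrightarrow> (\<Sum>k\<in>F. a n k) \<le> \<delta> / 2)"
  proof (rule rosenthal[where N = L])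
    fix n F assume F: "finite (F :: nat set)"
    interpret N: finite_measure "abs_measure M (f n)" by (rule finite_measure_abs_measure[OF f(1)])
    have "(\<Sum>k\<in>F. a n k) = measure (abs_measure M (f n)) (\<Union>k\<in>F. D k)"
      unfolding a_def
      by (rule N.finite_measure_finite_Union[OF F, symmetric])
        (use D disj in \<open>auto intro: disjoint_family_on_mono\<close>)
    also have "\<dots> \<le> real L * (\<delta> / 2)"
      using measure_abs_measure_le[OF f(1), of n "\<Union>k\<in>F. D k"] C[OF fB, of n] L by linarith
    finally show "(\<Sum>k\<in>F. a n k) \<le> real L * (\<delta> / 2)" .
  qed (use \<delta> in \<open>auto simp: a_def\<close>)
  then obtain J where "infinite J"
    "\<forall>n\<in>J. \<forall>F. finite F \<longrightarrow> F \<subseteq> J - {n} \<longrightarrow> (\<Sum>k\<in>F. a n k) \<le> \<delta> / 2"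
    by (elim exE conjE)
  note J = this(1) this(2)[rule_format]
  define H where "H m k = (if k \<in> J \<and> m \<le> k then D k else {})" for m k
  have H: "H m k \<in> sets M" for m k using D by (simp add: H_def)
  have HD: "j = k" if "x \<in> H m j" "x \<in> D k" for m j k x
    using that disjoint_family_onD[OF disj, of j k] by (auto simp: H_def split: if_splits)
  define E where "E m = (\<Union>k. H m k)" for m
  have E: "E m \<in> sets M" for m unfolding E_def using H by blast
  \<comment> \<open>For fixed \<open>m\<close> the sets \<open>H m k\<close> are disjoint, so at
    each point the series has at most one nonzero term.\<close>
  define w where "w m x = (\<Sum>k. indicator (H m k) x * conj_phase (f k x))" for m x
  have w_in: "w m x = conj_phase (f k x)" if "x \<in> H m k" for m k x
  proof -
    have "x \<in> D k" using that by (auto simp: H_def split: if_splits)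
    then have "indicator (H m j) x * conj_phase (f j x) = 0" if "j \<notin> {k}" for j
      using HD[of x m j k] that by (auto simp: indicator_def)
    then have "w m x = (\<Sum>j\<in>{k}. indicator (H m j) x * conj_phase (f j x))"
      unfolding w_def by (intro suminf_finite) auto
    then show ?thesis using that by simp
  qed
  have w_out: "w m x = 0" if "x \<notin> E m" for m x
  proof -
    have "indicator (H m j) x = (0::complex)" for j using that by (auto simp: E_def)
    then show ?thesis by (simp add: w_def)
  qed
  have w_le: "cmod (w m x) \<le> indicator (E m) x" for m x
  proof (cases "x \<in> E m")
    case True
    then obtain k where "x \<in> H m k" by (auto simp: E_def)
    with True show ?thesis using w_in norm_conj_phase_le by simp
  qed (simp add: w_out)
  have w: "bounded_measurable M (w m) 1" for m
    unfolding bounded_measurable_def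
  proof (intro conjI ballI)
    show "w m \<in> borel_measurable M"
      unfolding w_def[abs_def]
    proof (rule borel_measurable_suminf)
      fix k
      have [measurable]: "H m k \<in> sets M" "f k \<in> borel_measurable M" using H f(1) by auto
      show "(\<lambda>x. indicator (H m k) x * conj_phase (f k x)) \<in> borel_measurable M"
        by measurable
    qed
    show "norm (w m x) \<le> 1" for x
      using w_le[of m x] by (auto simp: indicator_def split: if_splits intro: order_trans)
  qed
  have cover: "\<exists>m. mult_functional M (w m) X \<in> {z. Re z < \<delta> / 2}" if X: "X \<in> vecs (L1 M)" for X
  proof -
    obtain h where h: "integrable M h" "X = cls M h" using X by (rule vecs_L1_cases)
    interpret N: finite_measure "abs_measure M h" by (rule finite_measure_abs_measure[OF h(1)])
    \<comment> \<open>A point lies in at most one \<open>D k\<close> and leaves the tails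
      \<open>E m\<close> as soon as \<open>m > k\<close>, so the mass of \<open>h\<close> on them
      tends to 0.\<close>
    have "decseq E"
      unfolding E_def H_def by (rule decseq_SucI) (auto split: if_splits)
    moreover have "(\<Inter>m. E m) = {}"
    proof -
      have False if x: "\<And>m. x \<in> E m" for x
      proof -
        obtain k where k: "x \<in> H 0 k" using x[of 0] by (auto simp: E_def)
        obtain j where j: "x \<in> H (Suc k) j" using x[of "Suc k"] by (auto simp: E_def)
        have "x \<in> D k" "Suc k \<le> j" using k j by (auto simp: H_def split: if_splits)
        then show False using HD[OF j] by auto
      qed
      then show ?thesis by blast
    qed
    ultimately have "(\<lambda>m. measure (abs_measure M h) (E m)) \<longlonglongrightarrow> 0"
      using N.finite_Lim_measure_decseq[of E] E by auto
    then have "\<forall>\<^sub>F m in sequentially. measure (abs_measure M h) (E m) < \<delta> / 2"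
      using \<delta> by (intro order_tendstoD(2)) auto
    then obtain m where m: "measure (abs_measure M h) (E m) < \<delta> / 2"
      by (auto simp: eventually_sequentially)
    have "cmod (mult_functional M (w m) X) = cmod (LINT x|M. w m x * h x)"
      by (simp add: h mult_functional_cls[OF w])
    also have "\<dots> \<le> (LINT x|M. cmod (w m x * h x))"
      by (rule integral_norm_bound)
    also have "\<dots> \<le> (LINT x|M. indicator (E m) x * cmod (h x))"
    proof (rule integral_mono)
      show "integrable M (\<lambda>x. cmod (w m x * h x))"
        using integrable_bounded_mult[OF w h(1)] by (rule integrable_norm)
      show "integrable M (\<lambda>x. indicator (E m) x * cmod (h x))"
        using h E by (intro integrable_indicator_mult) auto
      show "cmod (w m x * h x) \<le> indicator (E m) x * cmod (h x)" for x
        unfolding norm_mult by (intro mult_right_mono w_le) simp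
    qed
    also have "\<dots> < \<delta> / 2" using m by (simp add: measure_abs_measure h E)
    finally have "cmod (mult_functional M (w m) X) < \<delta> / 2" .
    then have "Re (mult_functional M (w m) X) < \<delta> / 2"
      using complex_Re_le_cmod[of "mult_functional M (w m) X"] by linarith
    then show ?thesis by blast
  qed
  obtain N where N: "\<And>X. X \<in> B \<Longrightarrow> \<exists>m<N. mult_functional M (w m) X \<in> {z. Re z < \<delta> / 2}"
  proof (rule relatively_weakly_compact_countable_cover[OF complex_normed_space_L1 B rwc,
        of "\<lambda>m. mult_functional M (w m)" "\<lambda>m. {z. Re z < \<delta> / 2}"])
    show "open {z. Re z < \<delta> / 2}" by (rule open_halfspace_Re_lt)
  qed (use cover in \<open>auto intro: mult_functional_mem[OF w]\<close>)
  \<comment> \<open>From \<open>N\<close> on, \<open>D n\<close> with \<open>n \<in> J\<close> lies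
    in every tail \<open>E m\<close> with \<open>m < N\<close>, so each functional of the finite
    cover sees the diagonal mass of \<open>f n\<close>.\<close>
  obtain n where n: "n \<in> J" "N \<le> n"
    using J(1) by (meson infinite_nat_iff_unbounded_le)
  obtain m where m: "m < N" "Re (mult_functional M (w m) (cls M (f n))) < \<delta> / 2"
    using N[OF f(2)] by blast
  interpret N: finite_measure "abs_measure M (f n)" by (rule finite_measure_abs_measure[OF f(1)])
  define H' where "H' k = (if k = n then {} else H m k)" for k
  have H': "H' k \<in> sets M" for k using H by (simp add: H'_def)
  have "disjoint_family H'"
    unfolding disjoint_family_on_def H'_def using HD[of _ m] by (auto simp: H_def split: if_splits)
  then have sums: "(\<lambda>k. measure (abs_measure M (f n)) (H' k)) sums measure (abs_measure M (f n)) (\<Union>k. H' k)"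
    using H' by (intro N.finite_measure_UNION) auto
  \<comment> \<open>Rosenthal's bound concerns finite sets of indices; it passes to the whole
    off-diagonal union in the limit of partial sums.\<close>
  have rest: "measure (abs_measure M (f n)) (\<Union>k. H' k) \<le> \<delta> / 2"
  proof (rule LIMSEQ_le_const2[OF sums[unfolded sums_def]], intro exI allI impI)
    fix i :: nat
    let ?F = "{k. k < i \<and> k \<in> J \<and> m \<le> k \<and> k \<noteq> n}"
    have "(\<Sum>k<i. measure (abs_measure M (f n)) (H' k)) = (\<Sum>k<i. if k \<in> ?F then a n k else 0)"
      by (intro sum.cong) (auto simp: H'_def H_def a_def)
    also have "\<dots> = (\<Sum>k\<in>?F. a n k)"
      unfolding sum.inter_restrict[OF finite_lessThan, symmetric] by (intro sum.cong) auto
    also have "\<dots> \<le> \<delta> / 2"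
      by (rule J(2)[OF n(1)]) auto
    finally show "(\<Sum>k<i. measure (abs_measure M (f n)) (H' k)) \<le> \<delta> / 2" .
  qed
  have U: "(\<Union>k. H' k) \<in> sets M" using H' by blast
  \<comment> \<open>On \<open>D n\<close> the phase gives exactly \<open>\<bar>f n\<bar>\<close>; on
    the other pieces the real part is at worst the negative of
    \<open>\<bar>f n\<bar>\<close>.\<close>
  let ?l = "\<lambda>x. indicator (D n) x * cmod (f n x) - indicator (\<Union>k. H' k) x * cmod (f n x)"
  have wf: "integrable M (\<lambda>x. w m x * f n x)" by (rule integrable_bounded_mult[OF w f(1)])
  have "measure (abs_measure M (f n)) (D n) - measure (abs_measure M (f n)) (\<Union>k. H' k) = (LINT x|M. ?l x)"
    using f(1) D U by (simp add: measure_abs_measure integrable_indicator_mult del: UN_iff)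
  also have "\<dots> \<le> (LINT x|M. Re (w m x * f n x))"
  proof (rule integral_mono)
    show "integrable M ?l"
      using f(1) D U by (intro Bochner_Integration.integrable_diff integrable_indicator_mult) auto
    show "integrable M (\<lambda>x. Re (w m x * f n x))" by (rule integrable_Re[OF wf])
    show "?l x \<le> Re (w m x * f n x)" for x
    proof -
      have Hn: "H m n = D n" using n m by (simp add: H_def)
      consider "x \<in> D n" | "x \<notin> D n" "x \<in> (\<Union>k. H' k)" | "x \<notin> E m"
      proof (cases "x \<in> E m")
        case True
        then obtain k where "x \<in> H m k" by (auto simp: E_def)
        then show ?thesis using that Hn by (cases "k = n") (auto simp: H'_def)
      qed (use that in blast)
      then show ?thesis
      proof cases
        case 1
        then have "w m x * f n x = complex_of_real (cmod (f n x))"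
          using w_in[of x m n] Hn by (simp add: conj_phase_mult)
        with 1 show ?thesis by (simp add: indicator_def)
      next
        case 2
        have "cmod (w m x * f n x) \<le> 1 * cmod (f n x)"
          unfolding norm_mult
          by (intro mult_right_mono order_trans[OF w_le indicator_le_1]) simp
        then have "- cmod (f n x) \<le> Re (w m x * f n x)"
          using abs_Re_le_cmod[of "w m x * f n x"] by linarith
        with 2 show ?thesis by (simp add: indicator_def)
      next
        case 3
        then have "x \<notin> D n" using Hn by (auto simp: E_def)
        then show ?thesis by (simp add: indicator_def w_out[OF 3])
      qed
    qed
  qed
  also have "\<dots> = Re (mult_functional M (w m) (cls M (f n)))"
    by (simp only: integral_Re[OF wf] mult_functional_cls[OF w f(1)])
  finally show False using m(2) mass[of n] rest by linarith
qed

section \<open>Generalized limits and weak compactness\<close>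

text \<open>A generalized limit is a point of the closure of \<open>B\<close> in the product of all bounded real
  functions on \<open>B\<close>; it behaves like the limit along an ultrafilter on \<open>B\<close>.\<close>

definition bounded_functions :: "'v set \<Rightarrow> ('v \<Rightarrow> real) set" where
  "bounded_functions B = {c. \<exists>K. \<forall>x\<in>B. \<bar>c x\<bar> \<le> K}"

definition generalized_limit :: "'v set \<Rightarrow> (('v \<Rightarrow> real) \<Rightarrow> real) \<Rightarrow> bool" where
  "generalized_limit B \<Lambda> \<longleftrightarrow> (\<forall>C \<epsilon>. finite C \<longrightarrow> C \<subseteq> bounded_functions B \<longrightarrow> 0 < \<epsilon> \<longrightarrow>
     (\<exists>x\<in>B. \<forall>c\<in>C. \<bar>c x - \<Lambda> c\<bar> < \<epsilon>))"

section \<open>Rules of calculation for generalized limits\<close>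

lemma bounded_functionsI: "(\<And>x. x \<in> B \<Longrightarrow> \<bar>c x\<bar> \<le> K) \<Longrightarrow> c \<in> bounded_functions B"
  unfolding bounded_functions_def by blast

lemma bounded_functions_add:
  assumes "c \<in> bounded_functions B" "d \<in> bounded_functions B"
  shows "(\<lambda>x. c x + d x) \<in> bounded_functions B"
proof -
  obtain K where K: "\<forall>x\<in>B. \<bar>c x\<bar> \<le> K" using assms(1) by (auto simp: bounded_functions_def)
  obtain L where L: "\<forall>x\<in>B. \<bar>d x\<bar> \<le> L" using assms(2) by (auto simp: bounded_functions_def)
  show ?thesis using K L by (intro bounded_functionsI[of _ _ "K + L"]) force
qed

lemma bounded_functions_scale:
  assumes "c \<in> bounded_functions B"
  shows "(\<lambda>x. a * c x) \<in> bounded_functions B"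
proof -
  obtain K where K: "\<forall>x\<in>B. \<bar>c x\<bar> \<le> K" using assms(1) by (auto simp: bounded_functions_def)
  then show ?thesis
    by (intro bounded_functionsI[of _ _ "\<bar>a\<bar> * K"]) (simp add: abs_mult mult_left_mono)
qed

text \<open>The device here recurs below: some point of \<open>B\<close> brings the finitely many
  functions involved simultaneously close to their generalized limits. The slack \<epsilon> makes
  the rule fit for uniform approximation.\<close>

lemma generalized_limit_le:
  assumes \<Lambda>: "generalized_limit B \<Lambda>" and c: "c \<in> bounded_functions B"
    and d: "d \<in> bounded_functions B" and le: "\<And>x. x \<in> B \<Longrightarrow> c x \<le> d x + \<epsilon>"
  shows "\<Lambda> c \<le> \<Lambda> d + \<epsilon>"
proof (rule field_le_epsilon)
  fix e :: real assume "0 < e"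
  then obtain x where x: "x \<in> B" "\<forall>f\<in>{c, d}. \<bar>f x - \<Lambda> f\<bar> < e / 2"
    using \<Lambda>[unfolded generalized_limit_def, rule_format, of "{c, d}" "e / 2"] c d by auto
  then have "\<bar>c x - \<Lambda> c\<bar> < e / 2" "\<bar>d x - \<Lambda> d\<bar> < e / 2" by auto
  then show "\<Lambda> c \<le> \<Lambda> d + \<epsilon> + e" using le[OF x(1)] by linarith
qed

lemma generalized_limit_abs_diff_le:
  assumes "generalized_limit B \<Lambda>" "c \<in> bounded_functions B" "d \<in> bounded_functions B"
    and "\<And>x. x \<in> B \<Longrightarrow> \<bar>c x - d x\<bar> \<le> \<epsilon>"
  shows "\<bar>\<Lambda> c - \<Lambda> d\<bar> \<le> \<epsilon>"
proof -
  have "c x \<le> d x + \<epsilon>" "d x \<le> c x + \<epsilon>" if "x \<in> B" for x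
    using assms(4)[OF that] by (auto simp: abs_le_iff)
  then show ?thesis
    using generalized_limit_le[OF assms(1-3), of \<epsilon>] generalized_limit_le[OF assms(1,3,2), of \<epsilon>]
    by (simp add: abs_le_iff)
qed

text \<open>\<open>\<Lambda>\<close> takes functions on the whole type as arguments, so changing a
  function off \<open>B\<close> gives a different argument; the value is nevertheless determined by
  \<open>B\<close>.\<close>

lemma generalized_limit_cong:
  assumes "generalized_limit B \<Lambda>" "c \<in> bounded_functions B" "\<And>x. x \<in> B \<Longrightarrow> c x = d x"
  shows "\<Lambda> c = \<Lambda> d"
proof -
  have d: "d \<in> bounded_functions B" using assms(2,3) by (auto simp: bounded_functions_def)
  have "\<bar>\<Lambda> c - \<Lambda> d\<bar> \<le> 0"
    by (rule generalized_limit_abs_diff_le[OF assms(1,2) d]) (simp add: assms(3))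
  then show ?thesis by simp
qed

lemma generalized_limit_add:
  assumes \<Lambda>: "generalized_limit B \<Lambda>" and c: "c \<in> bounded_functions B"
    and d: "d \<in> bounded_functions B"
  shows "\<Lambda> (\<lambda>x. c x + d x) = \<Lambda> c + \<Lambda> d"
proof -
  have "\<bar>\<Lambda> (\<lambda>x. c x + d x) - (\<Lambda> c + \<Lambda> d)\<bar> \<le> 0 + e" if e: "0 < e" for e
  proof -
    obtain x where x: "x \<in> B" "\<forall>f\<in>{c, d, \<lambda>x. c x + d x}. \<bar>f x - \<Lambda> f\<bar> < e / 3"
      using \<Lambda>[unfolded generalized_limit_def, rule_format, of "{c, d, \<lambda>x. c x + d x}" "e / 3"] c d
        bounded_functions_add[OF c d] e by auto
    then have "\<bar>c x - \<Lambda> c\<bar> < e / 3" "\<bar>d x - \<Lambda> d\<bar> < e / 3"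
      "\<bar>c x + d x - \<Lambda> (\<lambda>x. c x + d x)\<bar> < e / 3" by auto
    then show ?thesis by linarith
  qed
  then have "\<bar>\<Lambda> (\<lambda>x. c x + d x) - (\<Lambda> c + \<Lambda> d)\<bar> \<le> 0" by (rule field_le_epsilon)
  then show ?thesis by simp
qed

lemma generalized_limit_scale:
  assumes \<Lambda>: "generalized_limit B \<Lambda>" and c: "c \<in> bounded_functions B"
  shows "\<Lambda> (\<lambda>x. a * c x) = a * \<Lambda> c"
proof -
  have "\<bar>\<Lambda> (\<lambda>x. a * c x) - a * \<Lambda> c\<bar> \<le> 0 + e" if e: "0 < e" for e
  proof -
    define \<delta> where "\<delta> = e / (1 + \<bar>a\<bar>)"
    have "\<delta> * (1 + \<bar>a\<bar>) = e" by (simp add: \<delta>_def add_nonneg_eq_0_iff)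
    moreover have "0 < \<delta>" using e by (simp add: \<delta>_def add_pos_nonneg)
    ultimately have \<delta>: "0 < \<delta>" "\<delta> + \<bar>a\<bar> * \<delta> = e"
      by (simp_all add: algebra_simps)
    obtain x where x: "x \<in> B" "\<forall>f\<in>{c, \<lambda>x. a * c x}. \<bar>f x - \<Lambda> f\<bar> < \<delta>"
      using \<Lambda>[unfolded generalized_limit_def, rule_format, of "{c, \<lambda>x. a * c x}" \<delta>] c
        bounded_functions_scale[OF c] \<delta> by auto
    have "\<bar>a * c x - a * \<Lambda> c\<bar> \<le> \<bar>a\<bar> * \<delta>"
      using x(2) by (simp add: abs_mult mult_left_mono flip: right_diff_distrib)
    moreover have "\<bar>a * c x - \<Lambda> (\<lambda>x. a * c x)\<bar> < \<delta>" using x(2) by simp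
    ultimately show ?thesis using \<delta>(2) by linarith
  qed
  then have "\<bar>\<Lambda> (\<lambda>x. a * c x) - a * \<Lambda> c\<bar> \<le> 0" by (rule field_le_epsilon)
  then show ?thesis by simp
qed

lemma generalized_limit_const:
  assumes "generalized_limit B \<Lambda>"
  shows "\<Lambda> (\<lambda>x. k) = k"
proof -
  have b: "(\<lambda>x. k) \<in> bounded_functions B" by (rule bounded_functionsI[of _ _ "\<bar>k\<bar>"]) simp
  have "\<bar>\<Lambda> (\<lambda>x. k) - k\<bar> \<le> 0 + e" if e: "0 < e" for e
    using assms[unfolded generalized_limit_def, rule_format, of "{\<lambda>x. k}" e] b e
    by (auto simp: abs_minus_commute less_imp_le)
  then have "\<bar>\<Lambda> (\<lambda>x. k) - k\<bar> \<le> 0" by (rule field_le_epsilon)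
  then show ?thesis by simp
qed

lemma generalized_limit_sum:
  assumes \<Lambda>: "generalized_limit B \<Lambda>" and "finite I" and c: "\<And>i. i \<in> I \<Longrightarrow> c i \<in> bounded_functions B"
  shows "(\<lambda>x. \<Sum>i\<in>I. c i x) \<in> bounded_functions B \<and> \<Lambda> (\<lambda>x. \<Sum>i\<in>I. c i x) = (\<Sum>i\<in>I. \<Lambda> (c i))"
  using assms(2) c
proof (induction I)
  case empty
  show ?case using generalized_limit_const[OF \<Lambda>, of 0] by (simp add: bounded_functionsI[of _ _ 0])
next
  case (insert i I)
  then show ?case
    using bounded_functions_add[of "c i" B "\<lambda>x. \<Sum>i\<in>I. c i x"]
      generalized_limit_add[OF \<Lambda>, of "c i" "\<lambda>x. \<Sum>i\<in>I. c i x"] by simp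
qed

text \<open>The separation hypothesis is what Hahn-Banach yields in general; for \<open>L1\<close>
  it is checked with an explicit functional in \<open>L1_functionals_separate\<close>.\<close>

lemma Hausdorff_space_weak_topology:
  assumes E: "complex_normed_space E"
    and sep: "\<And>x y. x \<in> vecs E \<Longrightarrow> y \<in> vecs E \<Longrightarrow> x \<noteq> y \<Longrightarrow> \<exists>\<phi>\<in>vecs (dual E). \<phi> x \<noteq> \<phi> y"
  shows "Hausdorff_space (weak_topology E)"
  unfolding Hausdorff_space_def complex_normed_space.topspace_weak_topology[OF E]
proof (intro allI impI)
  fix x y assume xy: "x \<in> vecs E \<and> y \<in> vecs E \<and> x \<noteq> y"
  then obtain \<phi> where \<phi>: "\<phi> \<in> vecs (dual E)" "\<phi> x \<noteq> \<phi> y" using sep by blast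
  obtain U V where UV: "open U" "open V" "\<phi> x \<in> U" "\<phi> y \<in> V" "U \<inter> V = {}"
    using hausdorff[OF \<phi>(2)] by blast
  show "\<exists>U V. openin (weak_topology E) U \<and> openin (weak_topology E) V \<and> x \<in> U \<and> y \<in> V \<and> disjnt U V"
    using xy UV openin_weak_topology[OF \<phi>(1) UV(1)] openin_weak_topology[OF \<phi>(1) UV(2)]
    by (intro exI[of _ "{x \<in> vecs E. \<phi> x \<in> U}"] exI[of _ "{x \<in> vecs E. \<phi> x \<in> V}"])
      (auto simp: disjnt_def)
qed

text \<open>The imaginary part of a functional is the real part of another one, so generalized
  limits can be confined to real-valued functions.\<close>

lemma rotate_functional:
  assumes "complex_normed_space E" "\<phi> \<in> vecs (dual E)"
  shows "vscale (dual E) (- \<i>) \<phi> \<in> vecs (dual E)"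
    and "x \<in> vecs E \<Longrightarrow> Re (vscale (dual E) (- \<i>) \<phi> x) = Im (\<phi> x)"
proof -
  show "vscale (dual E) (- \<i>) \<phi> \<in> vecs (dual E)"
    by (rule complex_normed_space.scale_mem[OF complex_normed_space.complex_normed_space_dual[OF assms(1)] assms(2)])
  show "Re (vscale (dual E) (- \<i>) \<phi> x) = Im (\<phi> x)" if "x \<in> vecs E"
    using that by (simp add: dual_def)
qed

text \<open>By Tychonoff the closure \<open>Z\<close> of \<open>B\<close> in a product of intervals
  is compact, and its points are generalized limits. The hypothesis assigns a vector to each of
  them; this assignment is continuous into the weak topology and fixes \<open>B\<close>. Its image
  is compact, hence closed since the topology is Hausdorff, and so contains the closure of
  \<open>B\<close>.\<close>

lemma relatively_weakly_compact_if_generalized_limits: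
  fixes E :: "'v cnormed"
  assumes E: "complex_normed_space E" and B: "B \<subseteq> vecs E"
    and sep: "\<And>x y. x \<in> vecs E \<Longrightarrow> y \<in> vecs E \<Longrightarrow> x \<noteq> y \<Longrightarrow> \<exists>\<phi>\<in>vecs (dual E). \<phi> x \<noteq> \<phi> y"
    and bounded: "\<And>\<phi>. \<phi> \<in> vecs (dual E) \<Longrightarrow> (\<lambda>x. Re (\<phi> x)) \<in> bounded_functions B"
    and lim: "\<And>\<Lambda>. generalized_limit B \<Lambda> \<Longrightarrow>
      \<exists>h\<in>vecs E. \<forall>\<phi>\<in>vecs (dual E). \<Lambda> (\<lambda>x. Re (\<phi> x)) = Re (\<phi> h)"
  shows "relatively_weakly_compact E B"
proof -
  note top = complex_normed_space.topspace_weak_topology[OF E]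
  define I where "I = bounded_functions B"
  define r where "r c = (SOME K. \<forall>x\<in>B. \<bar>c x\<bar> \<le> K)" for c :: "'v \<Rightarrow> real"
  have r: "\<bar>c x\<bar> \<le> r c" if c: "c \<in> I" and x: "x \<in> B" for c x
  proof -
    have "\<exists>K. \<forall>x\<in>B. \<bar>c x\<bar> \<le> K" using c by (simp add: I_def bounded_functions_def)
    from someI_ex[OF this] show ?thesis using x by (simp add: r_def)
  qed
  define X where "X = product_topology (\<lambda>_. euclideanreal) I"
  define Q where "Q = (\<Pi>\<^sub>E c\<in>I. {- r c..r c})"
  define J where "J x = (\<lambda>c\<in>I. c x)" for x :: 'v
  define Z where "Z = X closure_of (J ` B)"
  have topX: "topspace X = extensional I" by (simp add: X_def PiE_UNIV_domain PiE_def)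
  have Q: "compactin X Q"
    unfolding X_def Q_def by (simp add: compactin_PiE)
  have "Hausdorff_space X" unfolding X_def by (simp add: Hausdorff_space_product_topology)
  then have "closedin X Q" using Q by (rule compactin_imp_closedin)
  moreover have "J ` B \<subseteq> Q"
  proof
    fix \<Lambda> assume "\<Lambda> \<in> J ` B"
    then obtain x where x: "x \<in> B" "\<Lambda> = J x" by blast
    have "c x \<in> {- r c..r c}" if "c \<in> I" for c
      using r[OF that x(1)] by (simp add: abs_le_iff)
    then show "\<Lambda> \<in> Q" by (simp add: x(2) J_def Q_def)
  qed
  ultimately have "Z \<subseteq> Q" unfolding Z_def by (intro closure_of_minimal)
  then have Zc: "compactin X Z"
    unfolding Z_def using Q by (intro closed_compactin[OF Q]) auto
  have Zlim: "generalized_limit B \<Lambda>" if \<Lambda>: "\<Lambda> \<in> Z" for \<Lambda>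
    unfolding generalized_limit_def
  proof (intro allI impI)
    fix C and \<epsilon> :: real assume C: "finite C" "C \<subseteq> bounded_functions B" "0 < \<epsilon>"
    \<comment> \<open>A basic neighbourhood in the product that constrains only the finitely many
      coordinates in \<open>C\<close>; as \<Lambda> is in the closure, some \<open>J x\<close> lies
      in it.\<close>
    define T where "T = (\<Pi>\<^sub>E c\<in>I. if c \<in> C then ball (\<Lambda> c) \<epsilon> else UNIV)"
    have "openin X T"
      unfolding X_def T_def
    proof (rule product_topology_basis)
      show "finite {c. (if c \<in> C then ball (\<Lambda> c) \<epsilon> else UNIV) \<noteq> topspace euclideanreal}"
        by (rule finite_subset[OF _ C(1)]) auto
    qed auto
    moreover have "\<Lambda> \<in> T"
      using \<Lambda> C(3) closure_of_subset_topspace[of X "J ` B"] topX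
      by (auto simp: T_def Z_def PiE_def)
    ultimately obtain x where x: "x \<in> B" "J x \<in> T"
      using \<Lambda> unfolding Z_def in_closure_of by blast
    have "\<bar>c x - \<Lambda> c\<bar> < \<epsilon>" if "c \<in> C" for c
    proof -
      have "c \<in> I" using C(2) that by (auto simp: I_def)
      with x(2) that have "J x c \<in> ball (\<Lambda> c) \<epsilon>" by (force simp: T_def PiE_iff)
      then show ?thesis using \<open>c \<in> I\<close> by (simp add: J_def dist_real_def abs_minus_commute)
    qed
    with x(1) show "\<exists>x\<in>B. \<forall>c\<in>C. \<bar>c x - \<Lambda> c\<bar> < \<epsilon>" by blast
  qed
  obtain P where P: "\<And>\<Lambda>. \<Lambda> \<in> Z \<Longrightarrow> P \<Lambda> \<in> vecs E"
    "\<And>\<Lambda> \<phi>. \<Lambda> \<in> Z \<Longrightarrow> \<phi> \<in> vecs (dual E) \<Longrightarrow> \<Lambda> (\<lambda>x. Re (\<phi> x)) = Re (\<phi> (P \<Lambda>))"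
    using lim[OF Zlim] by metis
  define rot where "rot \<phi> = vscale (dual E) (- \<i>) \<phi>" for \<phi> :: "'v \<Rightarrow> complex"
  note rot = rotate_functional[OF E, folded rot_def]
  have P_eq: "\<phi> (P \<Lambda>) = Complex (\<Lambda> (\<lambda>x. Re (\<phi> x))) (\<Lambda> (\<lambda>x. Re (rot \<phi> x)))"
    if "\<Lambda> \<in> Z" "\<phi> \<in> vecs (dual E)" for \<Lambda> \<phi>
    using P[OF that(1)] P(2)[OF that] P(2)[OF that(1) rot(1)[OF that(2)]] rot(2)[OF that(2)]
    by (simp add: complex_eq_iff)
  have topZ: "topspace (subtopology X Z) = Z"
    using closure_of_subset_topspace[of X "J ` B"] by (auto simp: Z_def)
  have "continuous_map (subtopology X Z) (weak_topology E) P"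
    unfolding weak_topology_def
  proof (rule continuous_on_generated_topo)
    fix A assume "A \<in> {{x \<in> vecs E. \<phi> x \<in> U} | \<phi> U. \<phi> \<in> vecs (dual E) \<and> open U}"
    then obtain \<phi> U where A: "A = {x \<in> vecs E. \<phi> x \<in> U}" and \<phi>: "\<phi> \<in> vecs (dual E)" and U: "open U"
      by blast
    \<comment> \<open>Two coordinates of \<Lambda> determine \<open>\<phi> (P \<Lambda>)\<close>,
      and coordinates are continuous on the product.\<close>
    let ?c = "\<lambda>x. Re (\<phi> x)" and ?d = "\<lambda>x. Re (rot \<phi> x)"
    have cd: "?c \<in> I" "?d \<in> I" unfolding I_def using bounded \<phi> rot(1)[OF \<phi>] by blast+
    have proj: "continuous_map (subtopology X Z) euclideanreal (\<lambda>\<Lambda>. \<Lambda> c)" if "c \<in> I" for c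
      unfolding X_def using that by (intro continuous_map_from_subtopology continuous_map_product_projection)
    have "continuous_map (subtopology X Z) (prod_topology euclideanreal euclideanreal) (\<lambda>\<Lambda>. (\<Lambda> ?c, \<Lambda> ?d))"
      by (intro continuous_map_pairedI proj cd)
    moreover have "continuous_map (prod_topology euclideanreal euclideanreal) euclidean (\<lambda>(a, b). Complex a b)"
    proof -
      have "continuous_on UNIV (\<lambda>p::real \<times> real. complex_of_real (fst p) + \<i> * complex_of_real (snd p))"
        by (intro continuous_intros)
      then show ?thesis
        by (simp add: euclidean_product_topology case_prod_unfold Complex_eq)
    qed
    ultimately have cont: "continuous_map (subtopology X Z) euclidean ((\<lambda>(a, b). Complex a b) \<circ> (\<lambda>\<Lambda>. (\<Lambda> ?c, \<Lambda> ?d)))"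
      by (rule continuous_map_compose)
    have "P -` A \<inter> topspace (subtopology X Z) =
        {\<Lambda> \<in> topspace (subtopology X Z). ((\<lambda>(a, b). Complex a b) \<circ> (\<lambda>\<Lambda>. (\<Lambda> ?c, \<Lambda> ?d))) \<Lambda> \<in> U}"
      unfolding topZ A using P(1) P_eq[OF _ \<phi>] by auto
    also have "openin (subtopology X Z) \<dots>"
      using U by (intro openin_continuous_map_preimage[OF cont]) simp
    finally show "openin (subtopology X Z) (P -` A \<inter> topspace (subtopology X Z))" .
  next
    show "P ` topspace (subtopology X Z) \<subseteq> \<Union>{{x \<in> vecs E. \<phi> x \<in> U} | \<phi> U. \<phi> \<in> vecs (dual E) \<and> open U}"
      using P(1) top unfolding topZ weak_topology_def topology_generated_by_topspace by blast
  qed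
  moreover have "compactin (subtopology X Z) Z"
    using Zc by (simp add: compactin_subtopology)
  ultimately have PZ: "compactin (weak_topology E) (P ` Z)"
    using image_compactin by blast
  have "B \<subseteq> P ` Z"
  proof
    fix x assume x: "x \<in> B"
    have JZ: "J x \<in> Z"
      using closure_of_subset[of "J ` B" X] x topX by (auto simp: Z_def J_def)
    have "P (J x) = x"
    proof (rule ccontr)
      assume "P (J x) \<noteq> x"
      then obtain \<phi> where \<phi>: "\<phi> \<in> vecs (dual E)" "\<phi> (P (J x)) \<noteq> \<phi> x"
        using sep[OF P(1)[OF JZ]] x B by blast
      have "\<phi> (P (J x)) = Complex (Re (\<phi> x)) (Re (rot \<phi> x))"
        using P_eq[OF JZ \<phi>(1)] bounded[OF \<phi>(1)] bounded[OF rot(1)[OF \<phi>(1)]]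
        by (simp add: J_def I_def)
      also have "\<dots> = \<phi> x" using rot(2)[OF \<phi>(1)] x B by (auto simp: complex_eq_iff)
      finally show False using \<phi>(2) by simp
    qed
    with JZ show "x \<in> P ` Z" by force
  qed
  moreover have "closedin (weak_topology E) (P ` Z)"
    by (rule compactin_imp_closedin[OF Hausdorff_space_weak_topology[OF E sep] PZ])
  ultimately have "weak_topology E closure_of B \<subseteq> P ` Z"
    by (rule closure_of_minimal)
  then show ?thesis
    unfolding relatively_weakly_compact_def by (intro closed_compactin[OF PZ]) auto
qed

section \<open>Densities\<close>

text \<open>Finite additivity and continuity at the empty set give countable additivity, and
  Radon-Nikodym supplies an extended density. As \<open>m\<close> is finite on the whole space, this
  density is finite almost everywhere and can be made real.\<close>

lemma finite_measure_set_function_density: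
  fixes m :: "'a set \<Rightarrow> real"
  assumes "finite_measure N"
    and nonneg: "\<And>A. A \<in> sets N \<Longrightarrow> 0 \<le> m A"
    and add: "\<And>A B. A \<in> sets N \<Longrightarrow> B \<in> sets N \<Longrightarrow> A \<inter> B = {} \<Longrightarrow> m (A \<union> B) = m A + m B"
    and cont: "\<And>A. range A \<subseteq> sets N \<Longrightarrow> decseq A \<Longrightarrow> (\<Inter>i. A i) = {} \<Longrightarrow> (\<lambda>i::nat. m (A i)) \<longlonglongrightarrow> 0"
    and null: "\<And>A. A \<in> null_sets N \<Longrightarrow> m A = 0"
  obtains h where "integrable N h" "\<And>x. 0 \<le> h x" "\<And>A. A \<in> sets N \<Longrightarrow> m A = (LINT x|N. indicator A x * h x)"
proof -
  interpret finite_measure N by fact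
  define \<mu> where "\<mu> A = ennreal (m A)" for A
  define N' where "N' = measure_of (space N) (sets N) \<mu>"
  have pos: "positive (sets N) \<mu>" unfolding positive_def \<mu>_def using null[of "{}"] by simp
  have "additive (sets N) \<mu>"
    unfolding additive_def \<mu>_def using add nonneg by (simp add: ennreal_plus)
  then have "countably_additive (sets N) \<mu>"
  proof (rule sets.empty_continuous_imp_countably_additive[OF pos])
    fix A :: "nat \<Rightarrow> 'a set" assume "range A \<subseteq> sets N" "decseq A" "(\<Inter>i. A i) = {}"
    from tendsto_ennrealI[OF cont[OF this]] show "(\<lambda>i. \<mu> (A i)) \<longlonglongrightarrow> 0" by (simp add: \<mu>_def)
  qed (simp add: \<mu>_def)
  then have em: "emeasure N' A = ennreal (m A)" if "A \<in> sets N" for A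
    unfolding N'_def using that pos by (subst emeasure_measure_of_sigma) (auto simp: sets.sigma_algebra_axioms \<mu>_def)
  have sN': "sets N' = sets N" by (simp add: N'_def)
  have "absolutely_continuous N N'"
    unfolding absolutely_continuous_def using null em sN' by (auto simp: null_sets_def)
  then obtain k where k: "k \<in> borel_measurable N" "density N k = N'"
    using Radon_Nikodym[OF _ sN'] by blast
  have kA: "(\<integral>\<^sup>+x. k x * indicator A x \<partial>N) = ennreal (m A)" if "A \<in> sets N" for A
    using em[OF that] emeasure_density[OF k(1) that] k(2) by simp
  have "(\<integral>\<^sup>+x. k x \<partial>N) = (\<integral>\<^sup>+x. k x * indicator (space N) x \<partial>N)"
    by (intro nn_integral_cong) auto
  then have kfin: "(\<integral>\<^sup>+x. k x \<partial>N) < \<infinity>" using kA[OF sets.top] by simp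
  then have fin: "AE x in N. k x < \<infinity>"
    using nn_integral_PInf_AE[OF k(1)] by (auto simp: less_top elim: eventually_mono)
  define h where "h x = enn2real (k x)" for x
  have hk: "AE x in N. ennreal (h x) = k x"
    using fin by eventually_elim (simp add: h_def)
  have h: "integrable N h"
  proof (rule integrableI_nonneg)
    show "h \<in> borel_measurable N" unfolding h_def[abs_def] using k(1) by measurable
    show "(\<integral>\<^sup>+x. ennreal (h x) \<partial>N) < \<infinity>"
      using kfin nn_integral_cong_AE[OF hk] by simp
  qed (simp add: h_def)
  moreover have "m A = (LINT x|N. indicator A x * h x)" if A: "A \<in> sets N" for A
  proof -
    have i: "integrable N (\<lambda>x. indicator A x * h x)" by (rule integrable_indicator_mult[OF h A])
    have "ennreal (LINT x|N. indicator A x * h x) = (\<integral>\<^sup>+x. ennreal (indicator A x * h x) \<partial>N)"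
      by (rule nn_integral_eq_integral[symmetric, OF i]) (simp add: h_def)
    also have "\<dots> = (\<integral>\<^sup>+x. k x * indicator A x \<partial>N)"
      by (rule nn_integral_cong_AE, use hk in eventually_elim) (auto simp: indicator_def)
    also have "\<dots> = ennreal (m A)" by (rule kA[OF A])
    finally have "ennreal (LINT x|N. indicator A x * h x) = ennreal (m A)" .
    then show ?thesis
      using nonneg[OF A] by (subst (asm) ennreal_inj) (auto simp: h_def intro!: integral_nonneg_AE)
  qed
  ultimately show thesis by (intro that[of h]) (auto simp: h_def)
qed

lemma integral_indicator_decseq_tendsto_0:
  fixes g :: "'a \<Rightarrow> real"
  assumes "integrable M g" "range A \<subseteq> sets M" "decseq A" "(\<Inter>i. A i) = {}"
  shows "(\<lambda>i::nat. LINT x|M. indicator (A i) x * g x) \<longlonglongrightarrow> 0"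
proof -
  have "(\<lambda>i. LINT x|M. indicator (A i) x * g x) \<longlonglongrightarrow> (LINT x|M. 0)"
  proof (rule integral_dominated_convergence)
    show "integrable M (\<lambda>x. \<bar>g x\<bar>)" using assms(1) by simp
    show "(\<lambda>x. indicator (A i) x * g x) \<in> borel_measurable M" for i
      using integrable_indicator_mult[OF assms(1)] assms(2) by blast
    show "AE x in M. (\<lambda>i. indicator (A i) x * g x) \<longlonglongrightarrow> 0"
    proof (rule AE_I2)
      fix x
      obtain i where "x \<notin> A i" using assms(4) by blast
      then have "indicator (A j) x * g x = 0" if "i \<le> j" for j
        using decseqD[OF assms(3) that] by (auto simp: indicator_def)
      then show "(\<lambda>i. indicator (A i) x * g x) \<longlonglongrightarrow> 0"
        by (intro tendsto_eventually) (auto simp: eventually_sequentially)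
    qed
  qed (auto simp: indicator_def)
  then show ?thesis by simp
qed

text \<open>One step function serves all densities \<open>k\<close> at once, because the error
  depends on \<open>k\<close> only through its integral. This uniformity lets a generalized limit
  pass from indicators to bounded multipliers.\<close>

lemma bounded_measurable_step_approx:
  fixes v :: "'a \<Rightarrow> real"
  assumes v: "bounded_measurable M v K" and \<delta>: "0 < \<delta>"
  obtains P a where "finite P" "P \<subseteq> sets M"
    "\<And>k. integrable M k \<Longrightarrow> (\<forall>x. 0 \<le> k x) \<Longrightarrow>
      \<bar>(LINT x|M. v x * k x) - (\<Sum>A\<in>P. a A * (LINT x|M. indicator A x * k x))\<bar> \<le> \<delta> * (LINT x|M. k x)"
proof -
  obtain P where P: "finite P" "P \<subseteq> sets M" "disjoint P" "\<Union>P = space M" "{} \<notin> P"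
    and Pv: "\<And>A j x y. A \<in> P \<Longrightarrow> j \<in> {()} \<Longrightarrow> x \<in> A \<Longrightarrow> y \<in> A \<Longrightarrow> \<bar>v x - v y\<bar> \<le> \<delta>"
    by (rule finite_partition_approx[of "{()}" M "\<lambda>_. v" K \<delta>]) (use v \<delta> in auto)
  define a where "a A = v (SOME x. x \<in> A)" for A
  have some: "(SOME x. x \<in> A) \<in> A" if "A \<in> P" for A
    using that P(5) by (intro some_in_eq[THEN iffD2]) auto
  define s where "s x = (\<Sum>A\<in>P. a A * indicator A x)" for x
  have vs: "bounded_measurable M (\<lambda>x. v x - s x) \<delta>"
    unfolding bounded_measurable_def
  proof (intro conjI ballI)
    show "(\<lambda>x. v x - s x) \<in> borel_measurable M"
      unfolding s_def using P(2) bounded_measurableD[OF v]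
      by (intro borel_measurable_diff borel_measurable_sum borel_measurable_times) auto
    fix x assume "x \<in> space M"
    then obtain A where A: "A \<in> P" "x \<in> A" using P(4) by blast
    show "norm (v x - s x) \<le> \<delta>"
      using Pv[OF A(1) _ A(2) some[OF A(1)]] sum_disjoint_indicator[OF P(1,3) A, of a]
      by (simp add: s_def a_def)
  qed
  show thesis
  proof (rule that[OF P(1,2), of a])
    fix k :: "'a \<Rightarrow> real" assume k: "integrable M k" "\<forall>x. 0 \<le> k x"
    have ik: "integrable M (\<lambda>x. a A * (indicator A x * k x))" if "A \<in> P" for A
      using P(2) that by (intro integrable_mult_right integrable_indicator_mult k(1)) auto
    have "(\<Sum>A\<in>P. a A * (LINT x|M. indicator A x * k x)) = (LINT x|M. (\<Sum>A\<in>P. a A * (indicator A x * k x)))"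
      using ik by (subst Bochner_Integration.integral_sum) auto
    then have "(LINT x|M. v x * k x) - (\<Sum>A\<in>P. a A * (LINT x|M. indicator A x * k x)) =
        (LINT x|M. v x * k x - (\<Sum>A\<in>P. a A * (indicator A x * k x)))"
      using integrable_bounded_mult[OF v k(1)] ik
      by (subst Bochner_Integration.integral_diff) auto
    also have "\<dots> = (LINT x|M. (v x - s x) * k x)"
      by (simp add: s_def left_diff_distrib sum_distrib_right mult.assoc)
    finally have "(LINT x|M. v x * k x) - (\<Sum>A\<in>P. a A * (LINT x|M. indicator A x * k x)) =
        (LINT x|M. (v x - s x) * k x)" .
    then show "\<bar>(LINT x|M. v x * k x) - (\<Sum>A\<in>P. a A * (LINT x|M. indicator A x * k x))\<bar> \<le> \<delta> * (LINT x|M. k x)"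
      using integral_bounded_mult_le[OF vs k(1)] k(2) by simp
  qed
qed

lemma
  fixes g :: "'a \<Rightarrow> real"
  assumes g: "integrable M g" "\<And>x. 0 \<le> g x"
  shows emeasure_real_density:
      "A \<in> sets M \<Longrightarrow> emeasure (density M g) A = ennreal (LINT x|M. indicator A x * g x)"
    and finite_measure_real_density: "finite_measure (density M g)"
    and integral_indicator_real_density: "A \<in> sets M \<Longrightarrow> h \<in> borel_measurable M \<Longrightarrow>
      (LINT x|density M g. indicator A x * h x) = (LINT x|M. indicator A x * (g x * h x :: real))"
proof -
  have eq: "(\<lambda>x. ennreal (cmod (complex_of_real (g x)))) = (\<lambda>x. ennreal (g x))"
    using g(2) by simp
  have i: "integrable M (\<lambda>x. complex_of_real (g x))" using g(1) by (rule integrable_of_real)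
  show "emeasure (density M g) A = ennreal (LINT x|M. indicator A x * g x)" if "A \<in> sets M"
    using emeasure_abs_measure[OF i that] g(2) unfolding eq by simp
  show "finite_measure (density M g)"
    using finite_measure_abs_measure[OF i] unfolding eq .
  show "(LINT x|density M g. indicator A x * h x) = (LINT x|M. indicator A x * (g x * h x))"
    if "A \<in> sets M" "h \<in> borel_measurable M"
    using that g by (subst integral_density) (auto simp: mult.left_commute)
qed

text \<open>The generalized limits of the integrals over \<open>A\<close> form a set function
  \<open>m\<close>. Uniformly in \<open>X\<close>, the integral of \<open>u X\<close> over
  \<open>A\<close> exceeds that of \<open>g\<close> by at most \<epsilon>; this estimate passes to
  \<open>m\<close> and yields both continuity at the empty set and absolute continuity with respect
  to \<open>g0\<close>.\<close>

lemma generalized_limit_density: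
  fixes u :: "'v \<Rightarrow> 'a \<Rightarrow> real" and g0 :: "'a \<Rightarrow> real"
  assumes L: "generalized_limit B \<Lambda>"
    and u: "\<And>X. X \<in> B \<Longrightarrow> integrable M (u X)" "\<And>X x. 0 \<le> u X x"
    and g0: "integrable M g0" "\<And>x. 0 \<le> g0 x"
    and dom: "\<And>\<epsilon>. 0 < \<epsilon> \<Longrightarrow> \<exists>g. integrable M g \<and> (\<forall>x. 0 \<le> g x) \<and>
      (AE x in M. g0 x = 0 \<longrightarrow> g x = 0) \<and> (\<forall>X\<in>B. (LINT x|M. max 0 (u X x - g x)) \<le> \<epsilon>)"
  obtains h where "integrable M h" "\<And>x. g0 x = 0 \<Longrightarrow> h x = 0"
    "\<And>v K. bounded_measurable M v K \<Longrightarrow> (\<lambda>X. LINT x|M. v x * u X x) \<in> bounded_functions B"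
    "\<And>v K. bounded_measurable M v K \<Longrightarrow> \<Lambda> (\<lambda>X. LINT x|M. v x * u X x) = (LINT x|M. v x * h x)"
proof -
  define I where "I A X = (LINT x|M. indicator A x * u X x)" for A X
  define m where "m A = \<Lambda> (I A)" for A
  have est: "I A X \<le> (LINT x|M. indicator A x * g x) + \<epsilon>"
    if "integrable M g" "\<forall>x. 0 \<le> g x" "\<forall>X\<in>B. (LINT x|M. max 0 (u X x - g x)) \<le> \<epsilon>"
      "A \<in> sets M" "X \<in> B" for g \<epsilon> A X
  proof -
    have i: "integrable M (\<lambda>x. indicator A x * g x)" "integrable M (\<lambda>x. max 0 (u X x - g x))"
      using that u(1)[OF that(5)] by (auto intro: integrable_indicator_mult integrable_max)
    have "I A X \<le> (LINT x|M. indicator A x * g x + max 0 (u X x - g x))"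
      unfolding I_def using that u(1)[OF that(5)] i
      by (intro integral_mono integrable_indicator_mult Bochner_Integration.integrable_add) (auto simp: indicator_def)
    also have "\<dots> = (LINT x|M. indicator A x * g x) + (LINT x|M. max 0 (u X x - g x))"
      using i by (rule Bochner_Integration.integral_add)
    finally show ?thesis using that(3,5) by fastforce
  qed
  have I_nonneg: "0 \<le> I A X" for A X
    unfolding I_def using u(2) by (intro integral_nonneg_AE) auto
  obtain g1 where g1: "integrable M g1" "\<forall>x. 0 \<le> g1 x" "\<forall>X\<in>B. (LINT x|M. max 0 (u X x - g1 x)) \<le> 1"
    using dom[of 1] by auto
  define C where "C = (LINT x|M. g1 x) + 1"
  have uC: "(LINT x|M. u X x) \<le> C" if "X \<in> B" for X
  proof -
    have "(LINT x|M. indicator (space M) x * k x) = (LINT x|M. k x)" for k :: "'a \<Rightarrow> real"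
      by (intro Bochner_Integration.integral_cong) auto
    then show ?thesis using est[OF g1 sets.top that] by (simp add: I_def C_def)
  qed
  have C: "0 \<le> C" unfolding C_def using g1(2) by (intro add_nonneg_nonneg integral_nonneg_AE) auto
  have vb: "(\<lambda>X. LINT x|M. v x * u X x) \<in> bounded_functions B" if "bounded_measurable M v K"
    for v :: "'a \<Rightarrow> real" and K
  proof (rule bounded_functionsI)
    fix X assume X: "X \<in> B"
    have "\<bar>LINT x|M. v x * u X x\<bar> \<le> K * (LINT x|M. u X x)"
      using integral_bounded_mult_le[OF that u(1)[OF X]] u(2) by simp
    also have "\<dots> \<le> \<bar>K\<bar> * C"
      using uC[OF X] u(2) by (intro mult_mono) auto
    finally show "\<bar>LINT x|M. v x * u X x\<bar> \<le> \<bar>K\<bar> * C" .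
  qed
  have Ib: "I A \<in> bounded_functions B" if "A \<in> sets M" for A
    unfolding I_def[abs_def] by (rule vb[of _ 1]) (use that in \<open>auto simp: bounded_measurable_def\<close>)
  have constb: "(\<lambda>X. k) \<in> bounded_functions B" for k
    by (rule bounded_functionsI[of _ _ "\<bar>k\<bar>"]) simp
  have m_le: "m A \<le> (LINT x|M. indicator A x * g x) + \<epsilon>"
    if "integrable M g" "\<forall>x. 0 \<le> g x" "\<forall>X\<in>B. (LINT x|M. max 0 (u X x - g x)) \<le> \<epsilon>" "A \<in> sets M" for g \<epsilon> A
    using generalized_limit_le[OF L Ib[OF that(4)] constb, of "LINT x|M. indicator A x * g x" \<epsilon>]
      est[OF that] generalized_limit_const[OF L] by (simp add: m_def)
  have m_nonneg: "0 \<le> m A" if "A \<in> sets M" for A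
    using generalized_limit_le[OF L constb Ib[OF that], of 0 0] I_nonneg generalized_limit_const[OF L]
    by (simp add: m_def)
  \<comment> \<open>This reference measure is finite whatever \<open>M\<close> is, which makes
    Radon-Nikodym available.\<close>
  let ?N = "density M g0"
  obtain k where k: "integrable ?N k" "\<And>x. 0 \<le> k x"
    and mk: "\<And>A. A \<in> sets ?N \<Longrightarrow> m A = (LINT x|?N. indicator A x * k x)"
  proof (rule finite_measure_set_function_density[OF finite_measure_real_density[OF g0], of m])
    fix A assume A: "A \<in> sets ?N"
    then show "0 \<le> m A" using m_nonneg by simp
    fix A' assume A': "A' \<in> sets ?N" "A \<inter> A' = {}"
    have ind: "indicator (A \<union> A') x = indicator A x + (indicator A' x :: real)" for x
      using A'(2) by (auto simp: indicator_def)
    have "m (A \<union> A') = \<Lambda> (\<lambda>X. I A X + I A' X)"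
      unfolding m_def
    proof (rule generalized_limit_cong[OF L Ib])
      fix X assume "X \<in> B"
      then show "I (A \<union> A') X = I A X + I A' X"
        unfolding I_def ind distrib_right using A A' u(1)
        by (intro Bochner_Integration.integral_add integrable_indicator_mult) auto
    qed (use A A' in auto)
    also have "\<dots> = m A + m A'"
      unfolding m_def using A A' by (intro generalized_limit_add[OF L] Ib) auto
    finally show "m (A \<union> A') = m A + m A'" .
  next
    fix A :: "nat \<Rightarrow> 'a set" assume A: "range A \<subseteq> sets ?N" "decseq A" "(\<Inter>i. A i) = {}"
    show "(\<lambda>i. m (A i)) \<longlonglongrightarrow> 0"
    proof (rule LIMSEQ_I)
      fix e :: real assume "0 < e"
      then obtain g where g: "integrable M g" "\<forall>x. 0 \<le> g x" "\<forall>X\<in>B. (LINT x|M. max 0 (u X x - g x)) \<le> e / 2"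
        using dom[of "e / 2"] by auto
      have "(\<lambda>i. LINT x|M. indicator (A i) x * g x) \<longlonglongrightarrow> 0"
        using A by (intro integral_indicator_decseq_tendsto_0 g(1)) auto
      then have "\<forall>\<^sub>F i in sequentially. (LINT x|M. indicator (A i) x * g x) < e / 2"
        using \<open>0 < e\<close> by (intro order_tendstoD(2)) auto
      then obtain n where n: "\<And>i. i \<ge> n \<Longrightarrow> (LINT x|M. indicator (A i) x * g x) < e / 2"
        by (auto simp: eventually_sequentially)
      have "norm (m (A i) - 0) < e" if "i \<ge> n" for i
      proof -
        have "A i \<in> sets M" using A(1) by auto
        then show ?thesis using n[OF that] m_le[OF g] m_nonneg by fastforce
      qed
      then show "\<exists>n. \<forall>i\<ge>n. norm (m (A i) - 0) < e" by blast
    qed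
  next
    fix A assume A: "A \<in> null_sets ?N"
    then have AM: "A \<in> sets M" by auto
    have "AE x in M. x \<in> A \<longrightarrow> g0 x = 0"
      using A g0 by (subst (asm) null_sets_density_iff) (auto simp: ennreal_eq_0_iff antisym elim: eventually_mono)
    have "m A \<le> 0 + e" if e: "0 < e" for e
    proof -
      obtain g where g: "integrable M g" "\<forall>x. 0 \<le> g x" "AE x in M. g0 x = 0 \<longrightarrow> g x = 0"
        "\<forall>X\<in>B. (LINT x|M. max 0 (u X x - g x)) \<le> e" using dom[OF e] by blast
      have "(LINT x|M. indicator A x * g x) = (LINT x|M. 0)"
      proof (rule integral_cong_AE)
        show "AE x in M. indicator A x * g x = 0"
          using \<open>AE x in M. x \<in> A \<longrightarrow> g0 x = 0\<close> g(3) by eventually_elim (auto simp: indicator_def)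
      qed (use AM g(1) in auto)
      then show ?thesis using m_le[OF g(1,2,4) AM] by simp
    qed
    then have "m A \<le> 0" by (rule field_le_epsilon)
    then show "m A = 0" using m_nonneg[OF AM] by simp
  qed blast
  have kM: "k \<in> borel_measurable M" using k(1) by auto
  define h where "h x = g0 x * k x" for x
  have h: "integrable M h" "\<forall>x. 0 \<le> h x"
    unfolding h_def using k g0 kM by (auto simp: integrable_real_density)
  have mh: "m A = (LINT x|M. indicator A x * h x)" if "A \<in> sets M" for A
    using mk[of A] that by (simp add: integral_indicator_real_density g0 kM h_def)
  have "\<Lambda> (\<lambda>X. LINT x|M. v x * u X x) = (LINT x|M. v x * h x)" if v: "bounded_measurable M v K"
    for v :: "'a \<Rightarrow> real" and K
  proof -
    define H where "H = (LINT x|M. h x)"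
    have H: "0 \<le> H" unfolding H_def using h(2) by (intro integral_nonneg_AE) auto
    have "\<bar>\<Lambda> (\<lambda>X. LINT x|M. v x * u X x) - (LINT x|M. v x * h x)\<bar> \<le> 0 + e" if e: "0 < e" for e
    proof -
      \<comment> \<open>\<open>C\<close> bounds the integrals of the \<open>u X\<close> and
        \<open>H\<close> is that of \<open>h\<close>: these are the densities against which
        \<open>v\<close> gets replaced by a step function. The 1 keeps the denominator
        positive.\<close>
      define \<delta> where "\<delta> = e / (C + H + 1)"
      have \<delta>: "0 < \<delta>" "\<delta> * C + \<delta> * H \<le> e"
      proof -
        have "\<delta> * (C + H + 1) = e" using C H by (simp add: \<delta>_def)
        moreover show "0 < \<delta>" using e C H by (simp add: \<delta>_def)
        ultimately show "\<delta> * C + \<delta> * H \<le> e" by (simp add: algebra_simps)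
      qed
      obtain P a where P: "finite P" "P \<subseteq> sets M"
        and Pk: "\<And>k. integrable M k \<Longrightarrow> (\<forall>x. 0 \<le> k x) \<Longrightarrow>
          \<bar>(LINT x|M. v x * k x) - (\<Sum>A\<in>P. a A * (LINT x|M. indicator A x * k x))\<bar> \<le> \<delta> * (LINT x|M. k x)"
        using bounded_measurable_step_approx[OF v \<delta>(1)] by blast
      have sum: "(\<lambda>X. \<Sum>A\<in>P. a A * I A X) \<in> bounded_functions B \<and>
          \<Lambda> (\<lambda>X. \<Sum>A\<in>P. a A * I A X) = (\<Sum>A\<in>P. \<Lambda> (\<lambda>X. a A * I A X))"
        using P by (intro generalized_limit_sum[OF L] bounded_functions_scale Ib) auto
      have "(\<Sum>A\<in>P. \<Lambda> (\<lambda>X. a A * I A X)) = (\<Sum>A\<in>P. a A * (LINT x|M. indicator A x * h x))"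
        using P(2) by (intro sum.cong refl) (simp add: generalized_limit_scale[OF L Ib] subset_iff mh flip: m_def)
      moreover have "\<bar>\<Lambda> (\<lambda>X. LINT x|M. v x * u X x) - \<Lambda> (\<lambda>X. \<Sum>A\<in>P. a A * I A X)\<bar> \<le> \<delta> * C"
      proof (rule generalized_limit_abs_diff_le[OF L vb[OF v] conjunct1[OF sum]])
        fix X assume X: "X \<in> B"
        have "\<bar>(LINT x|M. v x * u X x) - (\<Sum>A\<in>P. a A * I A X)\<bar> \<le> \<delta> * (LINT x|M. u X x)"
          unfolding I_def by (rule Pk[OF u(1)[OF X]]) (simp add: u(2))
        also have "\<dots> \<le> \<delta> * C" using \<delta>(1) uC[OF X] by (intro mult_left_mono) auto
        finally show "\<bar>(LINT x|M. v x * u X x) - (\<Sum>A\<in>P. a A * I A X)\<bar> \<le> \<delta> * C" .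
      qed
      moreover have "\<bar>(LINT x|M. v x * h x) - (\<Sum>A\<in>P. a A * (LINT x|M. indicator A x * h x))\<bar> \<le> \<delta> * H"
        unfolding H_def by (rule Pk[OF h])
      ultimately show ?thesis using \<delta>(2) conjunct2[OF sum] by linarith
    qed
    then have "\<bar>\<Lambda> (\<lambda>X. LINT x|M. v x * u X x) - (LINT x|M. v x * h x)\<bar> \<le> 0"
      by (rule field_le_epsilon)
    then show ?thesis by simp
  qed
  with h(1) vb show thesis by (intro that[of h]) (auto simp: h_def)
qed

section \<open>Functionals on \<open>\<sigma>\<close>-finite parts\<close>

text \<open>Adding a multiple of \<open>g\<close> makes the real part of the set function \<open>A \<mapsto> \<psi> (1\<^sub>A g)\<close> positive.\<close>

lemma functional_Re_density:
  fixes g :: "'a \<Rightarrow> real"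
  assumes \<psi>: "\<psi> \<in> vecs (dual (L1 M))" and g: "integrable M g" "\<And>x. 0 \<le> g x"
  obtains r K where "bounded_measurable M r K"
    "\<And>A. A \<in> sets M \<Longrightarrow> Re (\<psi> (cls M (\<lambda>x. complex_of_real (indicator A x * g x)))) =
      (LINT x|M. r x * (indicator A x * g x))"
proof -
  let ?N = "density M g"
  interpret N: finite_measure ?N by (rule finite_measure_real_density[OF g])
  define C where "C = vnorm (dual (L1 M)) \<psi>"
  have C: "0 \<le> C" unfolding C_def by (rule dual_norm_nonneg[OF complex_normed_space_L1 \<psi>])
  define G where "G A x = complex_of_real (indicator A x * g x)" for A x
  define \<nu> where "\<nu> A = (LINT x|M. indicator A x * g x)" for A
  have ig: "integrable M (\<lambda>x. indicator A x * g x)" if "A \<in> sets M" for A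
    by (rule integrable_indicator_mult[OF g(1) that])
  have G: "integrable M (G A)" if "A \<in> sets M" for A
    unfolding G_def[abs_def] using ig[OF that] by (rule integrable_of_real)
  have le: "\<bar>Re (\<psi> (cls M (G A)))\<bar> \<le> C * \<nu> A" if "A \<in> sets M" for A
  proof -
    have "(LINT x|M. cmod (G A x)) = \<nu> A"
      unfolding G_def \<nu>_def norm_of_real using g(2)
      by (intro Bochner_Integration.integral_cong) (auto simp: indicator_def)
    then show ?thesis
      using functional_bound[OF \<psi> G[OF that]] abs_Re_le_cmod[of "\<psi> (cls M (G A))"] by (simp add: C_def)
  qed
  define m where "m A = Re (\<psi> (cls M (G A))) + C * \<nu> A" for A
  have m: "0 \<le> m A" "m A \<le> 2 * C * \<nu> A" if "A \<in> sets M" for A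
    using le[OF that] by (auto simp: m_def abs_le_iff)
  obtain h where h: "integrable ?N h" "\<And>x. 0 \<le> h x"
    and mh: "\<And>A. A \<in> sets ?N \<Longrightarrow> m A = (LINT x|?N. indicator A x * h x)"
  proof (rule finite_measure_set_function_density[OF N.finite_measure_axioms, of m])
    fix A assume A: "A \<in> sets ?N"
    then show "0 \<le> m A" using m by simp
    fix A' assume A': "A' \<in> sets ?N" "A \<inter> A' = {}"
    have ind: "indicator (A \<union> A') x = indicator A x + (indicator A' x :: real)" for x
      using A'(2) by (auto simp: indicator_def)
    have "G (A \<union> A') = (\<lambda>x. G A x + G A' x)"
      by (simp add: G_def fun_eq_iff ind distrib_right)
    moreover have "\<nu> (A \<union> A') = \<nu> A + \<nu> A'"
      unfolding \<nu>_def ind distrib_right using A A' ig by (intro Bochner_Integration.integral_add) auto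
    ultimately show "m (A \<union> A') = m A + m A'"
      using functional_add[OF \<psi>, of "G A" "G A'"] G A A' by (simp add: m_def distrib_left)
  next
    fix A :: "nat \<Rightarrow> 'a set" assume A: "range A \<subseteq> sets ?N" "decseq A" "(\<Inter>i. A i) = {}"
    have "(\<lambda>i. 2 * C * \<nu> (A i)) \<longlonglongrightarrow> 2 * C * 0"
      unfolding \<nu>_def using A
      by (intro tendsto_mult_left integral_indicator_decseq_tendsto_0 g(1)) auto
    then have lim: "(\<lambda>i. 2 * C * \<nu> (A i)) \<longlonglongrightarrow> 0" by simp
    have "A i \<in> sets M" for i using A(1) by auto
    then show "(\<lambda>i. m (A i)) \<longlonglongrightarrow> 0"
      using m by (intro tendsto_sandwich[OF _ _ tendsto_const lim]) auto
  next
    fix A assume A: "A \<in> null_sets ?N"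
    then have AM: "A \<in> sets M" by auto
    have "\<nu> A \<le> 0"
      using A emeasure_real_density[OF g AM] by (auto simp: \<nu>_def ennreal_eq_0_iff)
    then have "2 * C * \<nu> A \<le> 0" using C by (simp add: mult_nonneg_nonpos)
    then show "m A = 0" using m[OF AM] by simp
  qed blast
  have hM: "h \<in> borel_measurable M" using h(1) by auto
  \<comment> \<open>The density exceeds \<open>2 * C\<close> exactly on \<open>S\<close>, yet
    \<open>m \<le> 2 * C * \<nu>\<close> prevents its integral over \<open>S\<close> from exceeding
    that of the constant; so \<open>S\<close> is null for \<open>?N\<close>.\<close>
  define S where "S = {x\<in>space M. 2 * C < h x}"
  have S: "S \<in> sets M" unfolding S_def using hM by measurable
  have \<nu>N: "\<nu> A = (LINT x|?N. indicator A x)" if "A \<in> sets M" for A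
    using integral_indicator_real_density[OF g that, of "\<lambda>_. 1"] by (simp add: \<nu>_def)
  have iN: "integrable ?N (\<lambda>x. indicator A x * h x)" "integrable ?N (\<lambda>x. indicator A x :: real)"
    if "A \<in> sets M" for A
    using that h(1) by (auto intro!: integrable_indicator_mult integrable_real_indicator simp: N.emeasure_finite less_top[symmetric])
  have AE: "AE x in ?N. h x \<le> 2 * C"
  proof -
    have i: "integrable ?N (\<lambda>x. indicator S x * h x - 2 * C * indicator S x)"
      using iN[OF S] by simp
    have nn: "0 \<le> indicator S x * h x - 2 * C * indicator S x" for x
      by (auto simp: S_def indicator_def)
    have "(LINT x|?N. indicator S x * h x - 2 * C * indicator S x) = m S - 2 * C * \<nu> S"
      using iN[OF S] mh[of S] S by (simp add: \<nu>N[OF S])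
    also have "\<dots> \<le> 0" using m(2)[OF S] by simp
    finally have "(LINT x|?N. indicator S x * h x - 2 * C * indicator S x) = 0"
      using integral_nonneg_AE[of "\<lambda>x. indicator S x * h x - 2 * C * indicator S x" ?N] nn by auto
    then have "AE x in ?N. indicator S x * h x - 2 * C * indicator S x = 0"
      using integral_nonneg_eq_0_iff_AE[OF i] nn by auto
    then show ?thesis
    proof (rule AE_mp, intro AE_I2 impI)
      fix x assume "x \<in> space ?N" "indicator S x * h x - 2 * C * indicator S x = 0"
      then show "h x \<le> 2 * C" by (cases "x \<in> S") (auto simp: S_def)
    qed
  qed
  \<comment> \<open>The minimum makes the bound hold at every point, as
    \<open>bounded_measurable\<close> demands; subtracting \<open>C\<close> undoes the shift that
    made \<open>m\<close> nonnegative.\<close>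
  define r where "r x = min (h x) (2 * C) - C" for x
  have rM: "r \<in> borel_measurable M" unfolding r_def[abs_def] using hM by measurable
  have "bounded_measurable M r C"
    unfolding bounded_measurable_def using rM h(2) C by (auto simp: r_def abs_le_iff)
  moreover have "Re (\<psi> (cls M (G A))) = (LINT x|M. r x * (indicator A x * g x))" if A: "A \<in> sets M" for A
  proof -
    have "Re (\<psi> (cls M (G A))) = (LINT x|?N. indicator A x * h x) - C * (LINT x|?N. indicator A x)"
      using mh[of A] A \<nu>N[OF A] by (simp add: m_def)
    also have "\<dots> = (LINT x|?N. indicator A x * h x - C * indicator A x)"
      using iN[OF A] by simp
    also have "\<dots> = (LINT x|?N. indicator A x * r x)"
    proof (rule integral_cong_AE)
      show "AE x in ?N. indicator A x * h x - C * indicator A x = indicator A x * r x"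
        using AE by eventually_elim (auto simp: r_def indicator_def)
    qed (use A hM rM in auto)
    also have "\<dots> = (LINT x|M. indicator A x * (g x * r x))"
      by (rule integral_indicator_real_density[OF g A rM])
    finally show ?thesis by (simp add: mult.commute mult.left_commute)
  qed
  ultimately show thesis by (intro that[of r C]) (simp_all add: G_def[abs_def])
qed

text \<open>A function that vanishes where \<open>g\<close> does is almost everywhere
  \<open>g\<close> times a quotient \<open>u\<close> integrable for \<open>density M g\<close>. Both
  sides are linear and \<open>L1\<close>-continuous in \<open>u\<close>, so indicators suffice, and
  for them \<open>functional_Re_density\<close> gives the real and, after rotation, the imaginary
  part.\<close>

lemma functional_density:
  fixes g :: "'a \<Rightarrow> real"
  assumes \<phi>: "\<phi> \<in> vecs (dual (L1 M))" and g: "integrable M g" "\<And>x. 0 \<le> g x"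
  obtains w K where "bounded_measurable M w K"
    "\<And>f. integrable M f \<Longrightarrow> (AE x in M. g x = 0 \<longrightarrow> f x = 0) \<Longrightarrow> \<phi> (cls M f) = (LINT x|M. w x * f x)"
proof -
  note rot = rotate_functional[OF complex_normed_space_L1 \<phi>]
  obtain r K where r: "bounded_measurable M r K"
    "\<And>A. A \<in> sets M \<Longrightarrow> Re (\<phi> (cls M (\<lambda>x. complex_of_real (indicator A x * g x)))) =
      (LINT x|M. r x * (indicator A x * g x))"
    using functional_Re_density[OF \<phi> g] by blast
  obtain s L where s: "bounded_measurable M s L"
    "\<And>A. A \<in> sets M \<Longrightarrow> Re (vscale (dual (L1 M)) (- \<i>) \<phi> (cls M (\<lambda>x. complex_of_real (indicator A x * g x)))) =
      (LINT x|M. s x * (indicator A x * g x))"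
    using functional_Re_density[OF rot(1) g] by blast
  define w where "w x = complex_of_real (r x) + \<i> * complex_of_real (s x)" for x
  have w: "bounded_measurable M w (K + L)"
    unfolding bounded_measurable_def
  proof (intro conjI ballI)
    have [measurable]: "r \<in> borel_measurable M" "s \<in> borel_measurable M"
      using r(1) s(1) by (auto simp: bounded_measurable_def)
    show "w \<in> borel_measurable M" unfolding w_def[abs_def] by measurable
    fix x assume x: "x \<in> space M"
    show "norm (w x) \<le> K + L"
      unfolding w_def using bounded_measurable_bound[OF r(1) x] bounded_measurable_bound[OF s(1) x]
      by (intro norm_triangle_mono) (auto simp: norm_mult)
  qed
  have ind: "\<phi> (cls M (\<lambda>x. complex_of_real (indicator A x * g x))) =
      (LINT x|M. w x * complex_of_real (indicator A x * g x))" if A: "A \<in> sets M" for A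
  proof -
    let ?k = "\<lambda>x. indicator A x * g x"
    have k: "integrable M ?k" by (rule integrable_indicator_mult[OF g(1) A])
    have ck: "cls M (\<lambda>x. complex_of_real (?k x)) \<in> vecs (L1 M)"
      by (intro class_mem_L1 integrable_of_real k)
    have int_r: "integrable M (\<lambda>x. complex_of_real (r x * ?k x))"
      by (intro integrable_of_real integrable_bounded_mult[OF r(1) k])
    have int_s: "integrable M (\<lambda>x. complex_of_real (s x * ?k x))"
      by (intro integrable_of_real integrable_bounded_mult[OF s(1) k])
    have "(LINT x|M. w x * complex_of_real (?k x)) =
        (LINT x|M. complex_of_real (r x * ?k x) + \<i> * complex_of_real (s x * ?k x))"
      by (simp add: w_def distrib_right mult.assoc)
    also have "\<dots> = (LINT x|M. complex_of_real (r x * ?k x)) + (LINT x|M. \<i> * complex_of_real (s x * ?k x))"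
      by (intro Bochner_Integration.integral_add int_r integrable_mult_right int_s)
    also have "\<dots> = complex_of_real (LINT x|M. r x * ?k x) + \<i> * complex_of_real (LINT x|M. s x * ?k x)"
      by (simp only: integral_mult_right_zero integral_complex_of_real)
    also have "\<dots> = \<phi> (cls M (\<lambda>x. complex_of_real (?k x)))"
      using r(2)[OF A] s(2)[OF A] rot(2)[OF ck] by (simp add: complex_eq_iff)
    finally show ?thesis ..
  qed
  let ?N = "density M g"
  have N: "integrable M (\<lambda>x. complex_of_real (g x) * u x)" if "integrable ?N u" for u
  proof -
    have "u \<in> borel_measurable M" using borel_measurable_integrable[OF that] by simp
    then have "integrable M (\<lambda>x. g x *\<^sub>R u x)"
      using that g by (subst (asm) integrable_density) auto
    then show ?thesis by (simp add: scaleR_conv_of_real)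
  qed
  have rep: "\<phi> (cls M (\<lambda>x. complex_of_real (g x) * u x)) = (LINT x|M. w x * (complex_of_real (g x) * u x))"
    if "integrable ?N u" for u
    using that
  proof (induct rule: integrable_induct)
    case (base A c)
    then have A: "A \<in> sets M" by simp
    have i: "integrable M (\<lambda>x. complex_of_real (indicator A x * g x))"
      by (intro integrable_of_real integrable_indicator_mult[OF g(1) A])
    have eq: "(\<lambda>x. complex_of_real (g x) * (indicator A x *\<^sub>R c)) = (\<lambda>x. c * complex_of_real (indicator A x * g x))"
      by (auto simp: indicator_def fun_eq_iff)
    have "(LINT x|M. w x * (c * complex_of_real (indicator A x * g x))) =
        c * (LINT x|M. w x * complex_of_real (indicator A x * g x))"
      unfolding integral_mult_right_zero[symmetric] by (simp only: mult.left_commute)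
    then show ?case
      unfolding eq functional_scale[OF \<phi> i] ind[OF A] by (simp only: fun_cong[OF eq])
  next
    case (add u v)
    have "\<phi> (cls M (\<lambda>x. complex_of_real (g x) * (u x + v x))) =
        \<phi> (cls M (\<lambda>x. complex_of_real (g x) * u x)) + \<phi> (cls M (\<lambda>x. complex_of_real (g x) * v x))"
      using functional_add[OF \<phi> N[OF add(1)] N[OF add(3)]] by (simp add: distrib_left)
    also have "\<dots> = (LINT x|M. w x * (complex_of_real (g x) * u x) + w x * (complex_of_real (g x) * v x))"
      unfolding add(2,4)
      by (intro Bochner_Integration.integral_add[symmetric] integrable_bounded_mult[OF w] N add(1,3))
    finally show ?case by (simp add: distrib_left)
  next
    case (lim u t)
    define d where "d i x = complex_of_real (g x) * t i x - complex_of_real (g x) * u x" for i x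
    have d: "integrable M (d i)" for i
      unfolding d_def[abs_def] by (intro Bochner_Integration.integrable_diff N lim)
    have "(\<lambda>i. LINT x|M. cmod (d i x)) \<longlonglongrightarrow> (LINT x|M. 0)"
    proof (rule integral_dominated_convergence)
      \<comment> \<open>The approximants are bounded by twice the modulus of \<open>u\<close>, and
        subtracting the limit adds one more.\<close>
      show "integrable M (\<lambda>x. 3 * cmod (complex_of_real (g x) * u x))"
        by (intro integrable_mult_right integrable_norm N lim)
      show "(\<lambda>x. cmod (d i x)) \<in> borel_measurable M" for i using d[of i] by auto
      show "AE x in M. (\<lambda>i. cmod (d i x)) \<longlonglongrightarrow> 0"
      proof (rule AE_I2)
        fix x assume "x \<in> space M"
        then have "(\<lambda>i. t i x) \<longlonglongrightarrow> u x" using lim(3) by simp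
        then have "(\<lambda>i. d i x) \<longlonglongrightarrow> complex_of_real (g x) * u x - complex_of_real (g x) * u x"
          unfolding d_def by (intro tendsto_intros)
        then show "(\<lambda>i. cmod (d i x)) \<longlonglongrightarrow> 0" by (simp add: tendsto_norm_zero)
      qed
      show "AE x in M. norm (cmod (d i x)) \<le> 3 * cmod (complex_of_real (g x) * u x)" for i
      proof (rule AE_I2)
        fix x assume "x \<in> space M"
        then have "cmod (t i x) \<le> 2 * cmod (u x)" using lim(4) by simp
        then have "cmod (complex_of_real (g x) * t i x) \<le> 2 * cmod (complex_of_real (g x) * u x)"
          unfolding norm_mult by (simp add: mult_left_mono mult.left_commute)
        then have "cmod (d i x) \<le> 3 * cmod (complex_of_real (g x) * u x)"
          unfolding d_def using norm_triangle_ineq4[of "complex_of_real (g x) * t i x" "complex_of_real (g x) * u x"]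
          by linarith
        then show "norm (cmod (d i x)) \<le> 3 * cmod (complex_of_real (g x) * u x)"
          by (simp only: real_norm_def abs_norm_cancel)
      qed
    qed simp
    then have d0: "(\<lambda>i. LINT x|M. cmod (d i x)) \<longlonglongrightarrow> 0" by simp
    have A: "(\<lambda>i. \<phi> (cls M (\<lambda>x. complex_of_real (g x) * t i x))) \<longlonglongrightarrow> \<phi> (cls M (\<lambda>x. complex_of_real (g x) * u x))"
    proof (rule Lim_null_comparison[THEN LIM_zero_cancel])
      show "(\<lambda>i. vnorm (dual (L1 M)) \<phi> * (LINT x|M. cmod (d i x))) \<longlonglongrightarrow> 0"
        using tendsto_mult_left[OF d0] by simp
      show "\<forall>\<^sub>F i in sequentially. norm (\<phi> (cls M (\<lambda>x. complex_of_real (g x) * t i x)) -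
          \<phi> (cls M (\<lambda>x. complex_of_real (g x) * u x))) \<le> vnorm (dual (L1 M)) \<phi> * (LINT x|M. cmod (d i x))"
        using functional_bound[OF \<phi> d] functional_diff[OF \<phi> N[OF lim(1)] N[OF lim(5)]]
        by (intro always_eventually allI) (simp add: d_def[abs_def])
    qed
    have B: "(\<lambda>i. LINT x|M. w x * (complex_of_real (g x) * t i x)) \<longlonglongrightarrow> (LINT x|M. w x * (complex_of_real (g x) * u x))"
    proof (rule Lim_null_comparison[THEN LIM_zero_cancel])
      show "(\<lambda>i. (K + L) * (LINT x|M. cmod (d i x))) \<longlonglongrightarrow> 0"
        using tendsto_mult_left[OF d0] by simp
      have "(LINT x|M. w x * d i x) = (LINT x|M. w x * (complex_of_real (g x) * t i x)) -
          (LINT x|M. w x * (complex_of_real (g x) * u x))" for i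
        unfolding d_def right_diff_distrib
        by (intro Bochner_Integration.integral_diff integrable_bounded_mult[OF w] N lim)
      then show "\<forall>\<^sub>F i in sequentially. norm ((LINT x|M. w x * (complex_of_real (g x) * t i x)) -
          (LINT x|M. w x * (complex_of_real (g x) * u x))) \<le> (K + L) * (LINT x|M. cmod (d i x))"
        using integral_bounded_mult_le[OF w d] by (intro always_eventually allI) simp
    qed
    show ?case
      using LIMSEQ_unique[OF A] B unfolding lim(2) by blast
  qed
  have "\<phi> (cls M f) = (LINT x|M. w x * f x)"
    if f: "integrable M f" and f0: "AE x in M. g x = 0 \<longrightarrow> f x = 0" for f
  proof -
    define u where "u x = f x / complex_of_real (g x)" for x
    have uM: "u \<in> borel_measurable M"
      unfolding u_def[abs_def] using f g(1) by (intro borel_measurable_divide) auto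
    have eq: "AE x in M. complex_of_real (g x) * u x = f x"
      using f0 by eventually_elim (auto simp: u_def)
    have guM: "(\<lambda>x. complex_of_real (g x) * u x) \<in> borel_measurable M"
      using uM g(1) by (intro borel_measurable_times borel_measurable_of_real) auto
    have i: "integrable M (\<lambda>x. complex_of_real (g x) * u x)"
      using f eq by (subst integrable_cong_AE[OF guM]) auto
    have uN: "integrable ?N u"
      using i g uM by (subst integrable_density) (auto simp: scaleR_conv_of_real)
    have "\<phi> (cls M f) = \<phi> (cls M (\<lambda>x. complex_of_real (g x) * u x))"
      using cls_eqI[OF i f eq] by simp
    also have "\<dots> = (LINT x|M. w x * (complex_of_real (g x) * u x))" by (rule rep[OF uN])
    also have "\<dots> = (LINT x|M. w x * f x)"
    proof (rule integral_cong_AE)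
      show "AE x in M. w x * (complex_of_real (g x) * u x) = w x * f x"
        using eq by eventually_elim simp
    qed (intro borel_measurable_integrable integrable_bounded_mult[OF w] i f)+
    finally show ?thesis .
  qed
  with w show thesis by (rule that)
qed

section \<open>Almost order bounded sets are relatively weakly compact\<close>

text \<open>A series of positive multiples of the \<open>g n\<close>, with weights that make its
  integral at most 1, vanishes only where every term does. It is summed in \<open>ennreal\<close>;
  where it is infinite \<open>enn2real\<close> returns 0, hence the almost everywhere in the
  conclusion.\<close>

lemma dominating_integrable:
  fixes g :: "nat \<Rightarrow> 'a \<Rightarrow> real"
  assumes g: "\<And>n. integrable M (g n)" "\<And>n x. 0 \<le> g n x"
  obtains g0 :: "'a \<Rightarrow> real" where "integrable M g0" "\<And>x. 0 \<le> g0 x" "\<And>n. AE x in M. g0 x = 0 \<longrightarrow> g n x = 0"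
proof -
  define I where "I n = (LINT x|M. g n x)" for n
  have I: "0 \<le> I n" for n unfolding I_def using g(2) by (intro integral_nonneg_AE) auto
  define c where "c n = (1 / 2) ^ Suc n / (1 + I n)" for n
  have c: "0 < c n" for n using I[of n] by (simp add: c_def add_pos_nonneg)
  have cI: "c n * I n \<le> (1 / 2) ^ Suc n" for n
  proof -
    have "c n * I n = (1 / 2) ^ Suc n * (I n / (1 + I n))" by (simp add: c_def)
    also have "\<dots> \<le> (1 / 2) ^ Suc n * 1" using I[of n] by (intro mult_left_mono) (auto simp: divide_le_eq)
    finally show ?thesis by simp
  qed
  define G where "G x = (\<Sum>n. ennreal (c n * g n x))" for x
  have [measurable]: "g n \<in> borel_measurable M" for n using g(1)[of n] by auto
  have GM: "G \<in> borel_measurable M" unfolding G_def[abs_def] by measurable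
  have "(\<integral>\<^sup>+x. G x \<partial>M) = (\<Sum>n. \<integral>\<^sup>+x. ennreal (c n * g n x) \<partial>M)"
    unfolding G_def by (intro nn_integral_suminf) measurable
  also have "\<dots> = (\<Sum>n. ennreal (c n * I n))"
  proof (intro suminf_cong)
    fix n
    have "(\<integral>\<^sup>+x. ennreal (c n * g n x) \<partial>M) = ennreal (LINT x|M. c n * g n x)"
      using g c[of n] by (intro nn_integral_eq_integral) auto
    then show "(\<integral>\<^sup>+x. ennreal (c n * g n x) \<partial>M) = ennreal (c n * I n)" by (simp add: I_def)
  qed
  also have "\<dots> \<le> (\<Sum>n. ennreal ((1 / 2) ^ Suc n))"
    using cI by (intro suminf_le ennreal_leI) auto
  also have "\<dots> = ennreal 1"
    using power_half_series by (intro suminf_ennreal_eq) auto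
  finally have Gfin: "(\<integral>\<^sup>+x. G x \<partial>M) < \<infinity>" by (simp add: order_le_less_trans)
  then have AE: "AE x in M. G x \<noteq> \<infinity>"
    using nn_integral_PInf_AE[OF GM] by simp
  define g0 where "g0 x = enn2real (G x)" for x
  have "integrable M g0"
  proof (rule integrableI_nonneg)
    show "g0 \<in> borel_measurable M" unfolding g0_def[abs_def] using GM by measurable
    have "(\<integral>\<^sup>+x. ennreal (g0 x) \<partial>M) = (\<integral>\<^sup>+x. G x \<partial>M)"
      by (rule nn_integral_cong_AE, use AE in eventually_elim) (simp add: g0_def less_top)
    then show "(\<integral>\<^sup>+x. ennreal (g0 x) \<partial>M) < \<infinity>" using Gfin by simp
  qed (simp add: g0_def)
  moreover have "AE x in M. g0 x = 0 \<longrightarrow> g n x = 0" for n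
    using AE
  proof eventually_elim
    case (elim x)
    show ?case
    proof
      assume "g0 x = 0"
      then have "G x = 0" using elim by (simp add: g0_def enn2real_eq_0_iff)
      moreover have "ennreal (c n * g n x) \<le> G x"
        unfolding G_def using sum_le_suminf[of "\<lambda>n. ennreal (c n * g n x)" "{n}"] by simp
      ultimately have "c n * g n x \<le> 0" by (simp add: ennreal_eq_0_iff)
      then show "g n x = 0" using c[of n] g(2)[of n x] by (simp add: mult_le_0_iff)
    qed
  qed
  ultimately show thesis by (intro that[of g0]) (auto simp: g0_def)
qed

text \<open>The conjugate phase of the difference of two representatives is a multiplier whose
  functional takes the norm of that difference as value.\<close>

lemma L1_functionals_separate:
  assumes "X \<in> vecs (L1 M)" "Y \<in> vecs (L1 M)" "X \<noteq> Y"
  shows "\<exists>\<phi>\<in>vecs (dual (L1 M)). \<phi> X \<noteq> \<phi> Y"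
proof -
  obtain f where f: "integrable M f" "X = cls M f" using assms(1) by (rule vecs_L1_cases)
  obtain g where g: "integrable M g" "Y = cls M g" using assms(2) by (rule vecs_L1_cases)
  define w where "w x = conj_phase (f x - g x)" for x
  have w: "bounded_measurable M w 1"
    unfolding bounded_measurable_def
  proof (intro conjI ballI)
    have [measurable]: "f \<in> borel_measurable M" "g \<in> borel_measurable M" using f g by auto
    show "w \<in> borel_measurable M" unfolding w_def[abs_def] by measurable
  qed (simp add: w_def norm_conj_phase_le)
  have d: "integrable M (\<lambda>x. f x - g x)" using f g by simp
  have "mult_functional M w X - mult_functional M w Y = mult_functional M w (cls M (\<lambda>x. f x - g x))"
    using functional_diff[OF mult_functional_mem[OF w] f(1) g(1)] f g by simp
  also have "\<dots> = complex_of_real (LINT x|M. cmod (f x - g x))"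
    using mult_functional_cls[OF w d] by (simp add: w_def conj_phase_mult)
  also have "\<dots> \<noteq> 0"
  proof
    assume "complex_of_real (LINT x|M. cmod (f x - g x)) = 0"
    then have "AE x in M. cmod (f x - g x) = 0"
      using integral_nonneg_eq_0_iff_AE[OF integrable_norm[OF d]] by simp
    then have "AE x in M. f x = g x" by eventually_elim simp
    then show False using assms(3) f g by (simp add: class_eq_iff)
  qed
  finally show ?thesis using mult_functional_mem[OF w] by (intro bexI[of _ "mult_functional M w"]) auto
qed

text \<open>The bounds for the tolerances \<open>1 / Suc n\<close> all vanish almost everywhere
  where one \<open>g0\<close> does, and with them all of \<open>B\<close> and the limit. On the
  support of \<open>g0\<close> every functional is multiplication by a bounded \<open>w\<close>, so
  generalized limits of integrals against bounded multipliers decide everything.\<close>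

lemma almost_order_bounded_imp_relatively_weakly_compact:
  assumes B: "B \<subseteq> vecs (L1 M)" and aob: "almost_order_bounded M (\<Union>B)"
  shows "relatively_weakly_compact (L1 M) B"
proof (rule relatively_weakly_compact_if_generalized_limits[OF complex_normed_space_L1 B L1_functionals_separate])
  note int = Union_L1D(1)[OF B]
  obtain C where C: "C > 0" "\<And>f. f \<in> \<Union>B \<Longrightarrow> (LINT x|M. cmod (f x)) \<le> C"
    using almost_order_bounded_imp_bounded[OF aob int] by blast
  define rep where "rep X = (SOME f. f \<in> X)" for X :: "('a \<Rightarrow> complex) set"
  have rep: "rep X \<in> \<Union>B" "X = cls M (rep X)" if X: "X \<in> B" for X
  proof -
    have XL: "X \<in> vecs (L1 M)" using B X by blast
    then have "\<exists>f. f \<in> X" using vecs_L1_cases mem_cls by metis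
    then have r: "rep X \<in> X" unfolding rep_def by (rule someI_ex)
    with X show "rep X \<in> \<Union>B" by blast
    show "X = cls M (rep X)" by (rule L1_rep(2)[OF XL r])
  qed
  note irep = int[OF rep(1)]
  show "(\<lambda>X. Re (\<phi> X)) \<in> bounded_functions B" if \<phi>: "\<phi> \<in> vecs (dual (L1 M))" for \<phi>
  proof (rule bounded_functionsI)
    fix X assume X: "X \<in> B"
    have "\<bar>Re (\<phi> X)\<bar> \<le> cmod (\<phi> (cls M (rep X)))"
      using abs_Re_le_cmod rep(2)[OF X] by metis
    also have "\<dots> \<le> vnorm (dual (L1 M)) \<phi> * (LINT x|M. cmod (rep X x))"
      by (rule functional_bound[OF \<phi> irep[OF X]])
    also have "\<dots> \<le> vnorm (dual (L1 M)) \<phi> * C"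
      by (intro mult_left_mono C rep X dual_norm_nonneg[OF complex_normed_space_L1 \<phi>])
    finally show "\<bar>Re (\<phi> X)\<bar> \<le> vnorm (dual (L1 M)) \<phi> * C" .
  qed
  fix \<Lambda> assume \<Lambda>: "generalized_limit B \<Lambda>"
  have "\<exists>g. integrable M g \<and> (\<forall>x. 0 \<le> g x) \<and>
      (\<forall>f\<in>\<Union>B. (LINT x|M. max 0 (cmod (f x) - g x)) \<le> 1 / real (Suc n))" for n
    using aob unfolding almost_order_bounded_def by (elim allE[of _ "1 / real (Suc n)"]) simp
  then obtain g where g: "\<And>n. integrable M (g n)" "\<And>n x. 0 \<le> g n x"
    "\<And>n f. f \<in> \<Union>B \<Longrightarrow> (LINT x|M. max 0 (cmod (f x) - g n x)) \<le> 1 / real (Suc n)"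
    by metis
  obtain g0 :: "'a \<Rightarrow> real" where g0: "integrable M g0" "\<And>x. 0 \<le> g0 x" "\<And>n. AE x in M. g0 x = 0 \<longrightarrow> g n x = 0"
    using dominating_integrable[of M g] g(1,2) by blast
  have dom: "\<exists>g. integrable M g \<and> (\<forall>x. 0 \<le> g x) \<and> (AE x in M. g0 x = 0 \<longrightarrow> g x = 0) \<and>
      (\<forall>X\<in>B. (LINT x|M. max 0 (cmod (rep X x) - g x)) \<le> \<epsilon>)" if \<epsilon>: "0 < \<epsilon>" for \<epsilon>
  proof -
    obtain n where n: "1 / real (Suc n) < \<epsilon>" using nat_approx_posE[OF \<epsilon>] by blast
    have "(LINT x|M. max 0 (cmod (rep X x) - g n x)) \<le> \<epsilon>" if "X \<in> B" for X
      using g(3)[OF rep(1)[OF that], of n] n by linarith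
    then show ?thesis
      using g(1,2) g0(3) by (intro exI[of _ "g n"]) blast
  qed
  have part: "\<exists>h. integrable M h \<and> (\<forall>x. g0 x = 0 \<longrightarrow> h x = 0) \<and> (\<forall>v K. bounded_measurable M v K \<longrightarrow>
      (\<lambda>X. LINT x|M. v x * \<pi> (rep X x)) \<in> bounded_functions B \<and>
      \<Lambda> (\<lambda>X. LINT x|M. v x * \<pi> (rep X x)) = (LINT x|M. v x * h x))"
    and ipart: "\<And>X. X \<in> B \<Longrightarrow> integrable M (\<lambda>x. \<pi> (rep X x))"
    if \<pi>: "\<pi> \<in> borel_measurable borel" "\<And>z. 0 \<le> \<pi> z" "\<And>z. \<pi> z \<le> cmod z" for \<pi> :: "complex \<Rightarrow> real"
  proof -
    show i: "integrable M (\<lambda>x. \<pi> (rep X x))" if X: "X \<in> B" for X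
    proof (rule Bochner_Integration.integrable_bound[OF integrable_norm[OF irep[OF X]]])
      show "(\<lambda>x. \<pi> (rep X x)) \<in> borel_measurable M"
        using \<pi>(1) irep[OF X] by (auto intro: measurable_compose)
    qed (use \<pi>(2,3) in auto)
    show "\<exists>h. integrable M h \<and> (\<forall>x. g0 x = 0 \<longrightarrow> h x = 0) \<and> (\<forall>v K. bounded_measurable M v K \<longrightarrow>
        (\<lambda>X. LINT x|M. v x * \<pi> (rep X x)) \<in> bounded_functions B \<and>
        \<Lambda> (\<lambda>X. LINT x|M. v x * \<pi> (rep X x)) = (LINT x|M. v x * h x))"
    proof (rule generalized_limit_density[OF \<Lambda>, of M "\<lambda>X x. \<pi> (rep X x)" g0])
      fix \<epsilon> :: real assume "0 < \<epsilon>"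
      from dom[OF this] obtain k where k: "integrable M k" "\<forall>x. 0 \<le> k x" "AE x in M. g0 x = 0 \<longrightarrow> k x = 0"
        "\<forall>X\<in>B. (LINT x|M. max 0 (cmod (rep X x) - k x)) \<le> \<epsilon>" by blast
      have "(LINT x|M. max 0 (\<pi> (rep X x) - k x)) \<le> \<epsilon>" if X: "X \<in> B" for X
      proof -
        have "(LINT x|M. max 0 (\<pi> (rep X x) - k x)) \<le> (LINT x|M. max 0 (cmod (rep X x) - k x))"
        proof (rule integral_mono)
          show "max 0 (\<pi> (rep X x) - k x) \<le> max 0 (cmod (rep X x) - k x)" for x
            using \<pi>(3)[of "rep X x"] by auto
        qed (use i[OF X] k(1) irep[OF X] in \<open>auto intro!: integrable_max\<close>)
        with k(4) X show ?thesis by fastforce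
      qed
      with k show "\<exists>g. integrable M g \<and> (\<forall>x. 0 \<le> g x) \<and> (AE x in M. g0 x = 0 \<longrightarrow> g x = 0) \<and>
          (\<forall>X\<in>B. (LINT x|M. max 0 (\<pi> (rep X x) - g x)) \<le> \<epsilon>)" by blast
    qed (use i \<pi>(2) g0 in blast)+
  qed
  \<comment> \<open>\<open>generalized_limit_density\<close> asks for nonnegative functions. The
    four parts are nonnegative and at most the modulus, so they inherit its bounds.\<close>
  let ?p1 = "\<lambda>z. max 0 (Re z)" and ?p2 = "\<lambda>z. max 0 (- Re z)"
    and ?p3 = "\<lambda>z. max 0 (Im z)" and ?p4 = "\<lambda>z. max 0 (- Im z)"
  have p: "?p1 \<in> borel_measurable borel" "?p2 \<in> borel_measurable borel"
    "?p3 \<in> borel_measurable borel" "?p4 \<in> borel_measurable borel" by measurable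
  have ple: "?p1 z \<le> cmod z" "?p2 z \<le> cmod z" "?p3 z \<le> cmod z" "?p4 z \<le> cmod z" for z
    using abs_Re_le_cmod[of z] abs_Im_le_cmod[of z] by auto
  obtain h1 where h1: "integrable M h1" "\<And>x. g0 x = 0 \<Longrightarrow> h1 x = 0" "\<And>v K. bounded_measurable M v K \<Longrightarrow>
      (\<lambda>X. LINT x|M. v x * ?p1 (rep X x)) \<in> bounded_functions B \<and>
      \<Lambda> (\<lambda>X. LINT x|M. v x * ?p1 (rep X x)) = (LINT x|M. v x * h1 x)"
    using part[OF p(1) _ ple(1)] by auto
  obtain h2 where h2: "integrable M h2" "\<And>x. g0 x = 0 \<Longrightarrow> h2 x = 0" "\<And>v K. bounded_measurable M v K \<Longrightarrow>
      (\<lambda>X. LINT x|M. v x * ?p2 (rep X x)) \<in> bounded_functions B \<and>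
      \<Lambda> (\<lambda>X. LINT x|M. v x * ?p2 (rep X x)) = (LINT x|M. v x * h2 x)"
    using part[OF p(2) _ ple(2)] by auto
  obtain h3 where h3: "integrable M h3" "\<And>x. g0 x = 0 \<Longrightarrow> h3 x = 0" "\<And>v K. bounded_measurable M v K \<Longrightarrow>
      (\<lambda>X. LINT x|M. v x * ?p3 (rep X x)) \<in> bounded_functions B \<and>
      \<Lambda> (\<lambda>X. LINT x|M. v x * ?p3 (rep X x)) = (LINT x|M. v x * h3 x)"
    using part[OF p(3) _ ple(3)] by auto
  obtain h4 where h4: "integrable M h4" "\<And>x. g0 x = 0 \<Longrightarrow> h4 x = 0" "\<And>v K. bounded_measurable M v K \<Longrightarrow>
      (\<lambda>X. LINT x|M. v x * ?p4 (rep X x)) \<in> bounded_functions B \<and>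
      \<Lambda> (\<lambda>X. LINT x|M. v x * ?p4 (rep X x)) = (LINT x|M. v x * h4 x)"
    using part[OF p(4) _ ple(4)] by auto
  have ip: "integrable M (\<lambda>x. ?p1 (rep X x))" "integrable M (\<lambda>x. ?p2 (rep X x))"
    "integrable M (\<lambda>x. ?p3 (rep X x))" "integrable M (\<lambda>x. ?p4 (rep X x))" if "X \<in> B" for X
    using ipart[OF p(1) _ ple(1) that] ipart[OF p(2) _ ple(2) that] ipart[OF p(3) _ ple(3) that]
      ipart[OF p(4) _ ple(4) that] by auto
  define h where "h x = Complex (h1 x - h2 x) (h3 x - h4 x)" for x
  have h: "integrable M h"
  proof -
    have "integrable M (\<lambda>x. complex_of_real (h1 x - h2 x) + \<i> * complex_of_real (h3 x - h4 x))"
      using h1(1) h2(1) h3(1) h4(1)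
      by (intro Bochner_Integration.integrable_add integrable_mult_right integrable_of_real
          Bochner_Integration.integrable_diff)
    then show ?thesis by (simp add: h_def[abs_def] Complex_eq)
  qed
  have h0: "AE x in M. g0 x = 0 \<longrightarrow> h x = 0"
    by (intro AE_I2) (simp add: h_def h1(2) h2(2) h3(2) h4(2) complex_eq_iff)
  \<comment> \<open>Almost everywhere that \<open>g0\<close> vanishes so does each bound
    \<open>k\<close>, and the excess of the modulus over \<open>k\<close> is the modulus itself; its
    integral there is therefore below every \<epsilon>.\<close>
  have f0: "AE x in M. g0 x = 0 \<longrightarrow> rep X x = 0" if X: "X \<in> B" for X
  proof -
    define S where "S = {x\<in>space M. g0 x = 0}"
    have S: "S \<in> sets M" unfolding S_def using g0(1) by measurable
    have iS: "integrable M (\<lambda>x. indicator S x * cmod (rep X x))"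
      using irep[OF X] S by (intro integrable_indicator_mult) auto
    have "(LINT x|M. indicator S x * cmod (rep X x)) \<le> 0 + \<epsilon>" if \<epsilon>: "0 < \<epsilon>" for \<epsilon>
    proof -
      obtain k where k: "integrable M k" "AE x in M. g0 x = 0 \<longrightarrow> k x = 0"
        "(LINT x|M. max 0 (cmod (rep X x) - k x)) \<le> \<epsilon>" using dom[OF \<epsilon>] X by blast
      have "(LINT x|M. indicator S x * cmod (rep X x)) \<le> (LINT x|M. max 0 (cmod (rep X x) - k x))"
      proof (rule integral_mono_AE[OF iS])
        show "integrable M (\<lambda>x. max 0 (cmod (rep X x) - k x))"
          using irep[OF X] k(1) by (intro integrable_max) auto
        show "AE x in M. indicator S x * cmod (rep X x) \<le> max 0 (cmod (rep X x) - k x)"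
          using k(2) by eventually_elim (auto simp: S_def indicator_def)
      qed
      with k(3) show ?thesis by simp
    qed
    then have "(LINT x|M. indicator S x * cmod (rep X x)) \<le> 0" by (rule field_le_epsilon)
    moreover have "0 \<le> (LINT x|M. indicator S x * cmod (rep X x))" by (intro integral_nonneg_AE) auto
    ultimately have "AE x in M. indicator S x * cmod (rep X x) = 0"
      using integral_nonneg_eq_0_iff_AE[OF iS] by auto
    then show ?thesis
      by (rule AE_mp) (auto simp: S_def intro!: AE_I2)
  qed
  have "\<Lambda> (\<lambda>X. Re (\<phi> X)) = Re (\<phi> (cls M h))" if \<phi>: "\<phi> \<in> vecs (dual (L1 M))" for \<phi>
  proof -
    obtain w K where w: "bounded_measurable M w K"
      "\<And>f. integrable M f \<Longrightarrow> (AE x in M. g0 x = 0 \<longrightarrow> f x = 0) \<Longrightarrow> \<phi> (cls M f) = (LINT x|M. w x * f x)"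
      using functional_density[OF \<phi> g0(1,2)] by blast
    let ?r = "\<lambda>x. Re (w x)" and ?r' = "\<lambda>x. - Re (w x)" and ?s = "\<lambda>x. Im (w x)" and ?s' = "\<lambda>x. - Im (w x)"
    have wM[measurable]: "w \<in> borel_measurable M" by (rule bounded_measurableD[OF w(1)])
    have v: "bounded_measurable M ?r K" "bounded_measurable M ?r' K"
      "bounded_measurable M ?s K" "bounded_measurable M ?s' K"
      unfolding bounded_measurable_def
      using bounded_measurable_bound[OF w(1)] abs_Re_le_cmod abs_Im_le_cmod
      by (auto intro: order_trans)
    \<comment> \<open>Imaginary parts enter the real part of a product with a minus sign, so
      \<open>?s'\<close> goes with \<open>k3\<close> and \<open>?s\<close> with
      \<open>k4\<close>.\<close>
    have Re_split: "Re (LINT x|M. w x * f x) = (LINT x|M. ?r x * k1 x) + (LINT x|M. ?r' x * k2 x) +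
        ((LINT x|M. ?s' x * k3 x) + (LINT x|M. ?s x * k4 x))"
      if k: "integrable M k1" "integrable M k2" "integrable M k3" "integrable M k4"
        and f: "integrable M f" "\<And>x. Re (f x) = k1 x - k2 x" "\<And>x. Im (f x) = k3 x - k4 x" for f k1 k2 k3 k4
    proof -
      have "Re (LINT x|M. w x * f x) = (LINT x|M. Re (w x * f x))"
        using integral_Re[OF integrable_bounded_mult[OF w(1) f(1)]] by simp
      also have "\<dots> = (LINT x|M. (?r x * k1 x + ?r' x * k2 x) + (?s' x * k3 x + ?s x * k4 x))"
        by (intro Bochner_Integration.integral_cong refl) (simp add: f algebra_simps)
      also have "\<dots> = (LINT x|M. ?r x * k1 x) + (LINT x|M. ?r' x * k2 x) +
        ((LINT x|M. ?s' x * k3 x) + (LINT x|M. ?s x * k4 x))"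
        using integrable_bounded_mult[OF v(1) k(1)] integrable_bounded_mult[OF v(2) k(2)]
          integrable_bounded_mult[OF v(4) k(3)] integrable_bounded_mult[OF v(3) k(4)]
        by (simp only: Bochner_Integration.integral_add Bochner_Integration.integrable_add)
      finally show ?thesis .
    qed
    define c1 where "c1 X = (LINT x|M. ?r x * ?p1 (rep X x))" for X
    define c2 where "c2 X = (LINT x|M. ?r' x * ?p2 (rep X x))" for X
    define c3 where "c3 X = (LINT x|M. ?s' x * ?p3 (rep X x))" for X
    define c4 where "c4 X = (LINT x|M. ?s x * ?p4 (rep X x))" for X
    have c: "c1 \<in> bounded_functions B" "c2 \<in> bounded_functions B" "c3 \<in> bounded_functions B" "c4 \<in> bounded_functions B"
      and \<Lambda>c: "\<Lambda> c1 = (LINT x|M. ?r x * h1 x)" "\<Lambda> c2 = (LINT x|M. ?r' x * h2 x)"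
        "\<Lambda> c3 = (LINT x|M. ?s' x * h3 x)" "\<Lambda> c4 = (LINT x|M. ?s x * h4 x)"
      unfolding c1_def[abs_def] c2_def[abs_def] c3_def[abs_def] c4_def[abs_def]
      using h1(3)[OF v(1)] h2(3)[OF v(2)] h3(3)[OF v(4)] h4(3)[OF v(3)] by blast+
    have "Re (\<phi> X) = c1 X + c2 X + (c3 X + c4 X)" if X: "X \<in> B" for X
    proof -
      have "\<phi> X = (LINT x|M. w x * rep X x)"
        using w(2)[OF irep[OF X] f0[OF X]] rep(2)[OF X] by simp
      then show ?thesis
        unfolding c1_def c2_def c3_def c4_def
        using Re_split[OF ip(1,2,3,4)[OF X] irep[OF X]] by (simp add: max_def)
    qed
    then have "\<Lambda> (\<lambda>X. Re (\<phi> X)) = \<Lambda> (\<lambda>X. c1 X + c2 X + (c3 X + c4 X))"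
      by (intro generalized_limit_cong[OF \<Lambda>, symmetric] bounded_functions_add c) simp
    also have "\<dots> = \<Lambda> c1 + \<Lambda> c2 + (\<Lambda> c3 + \<Lambda> c4)"
      by (simp add: generalized_limit_add[OF \<Lambda>] bounded_functions_add c)
    also have "\<dots> = Re (LINT x|M. w x * h x)"
      unfolding \<Lambda>c by (rule Re_split[OF h1(1) h2(1) h3(1) h4(1) h, symmetric]) (simp_all add: h_def)
    also have "\<dots> = Re (\<phi> (cls M h))"
      using w(2)[OF h h0] by simp
    finally show ?thesis .
  qed
  with class_mem_L1[OF h]
  show "\<exists>h\<in>vecs (L1 M). \<forall>\<phi>\<in>vecs (dual (L1 M)). \<Lambda> (\<lambda>X. Re (\<phi> X)) = Re (\<phi> h)" by blast
qed

theorem theorem4p2: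
  fixes M :: "'a measure" and p q :: real and B :: "('a \<Rightarrow> complex) set set"
  assumes "1 \<le> p" and "1 \<le> q" and "B \<subseteq> vecs (L1 M)"
  shows "relatively_weakly_compact (L1 M) B \<longleftrightarrow> almost_multi_bounded (L1 M) p q B"
proof
  assume "relatively_weakly_compact (L1 M) B"
  with assms(3) have "almost_order_bounded M (\<Union>B)"
    by (rule relatively_weakly_compact_imp_almost_order_bounded)
  with assms show "almost_multi_bounded (L1 M) p q B"
    by (rule almost_order_bounded_imp_almost_multi_bounded)
next
  assume "almost_multi_bounded (L1 M) p q B"
  with assms have "almost_order_bounded M (\<Union>B)"
    by (rule almost_multi_bounded_imp_almost_order_bounded)
  with assms(3) show "relatively_weakly_compact (L1 M) B"
    by (rule almost_order_bounded_imp_relatively_weakly_compact)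
qed

end
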